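(* Let $p$ be a prime and let $(t_n)_{n=1}^{\infty}$ be a sequence of positive integers such that $t_n \le n$ for each $n$. For each $n$ and $1 \le i \le n$ let $$\sigma_{n,i} = \begin{cases} [t_n + (i-1)] & (1 \le i \le n-t_n) \\ [n] & (i \ge n-t_n+1), \end{cases}$$ and let $X_n \in \mathrm{M}_n(\mathbb{Z}_p)$ be the Haar-random matrix supported on $\Sigma_n = (\sigma_{n,1},\ldots,\sigma_{n,n})$. Then the following are equivalent: (1) $\lim_{n\to\infty}\mathbb{P}(\det(\overline{X_n}) \neq 0) = \prod_{i=1}^{\infty}(1-p^{-i})$; (2) $\lim_{n\to\infty}(t_n - \log_p n) = \infty$; (3) $\mathrm{cok}(X_n)$ converges to CL.
   Context: $[k] = \{1,\ldots,k\}$; $\mathbb{Z}_p$ is the ring of $p$-adic integers, $\mathbb{F}_p$ the field with $p$ elements; $\log_p$ is the real logarithm to base $p$; $\mathrm{cok}(A) = \mathbb{Z}_p^n / A\mathbb{Z}_p^n$ and $\overline{A} \in \mathrm{M}_n(\mathbb{F}_p)$ is the reduction of $A$ modulo $p$, for $A \in \mathrm{M}_n(\mathbb{Z}_p)$. A $\mathbb{Z}_p$-valued random variable is Haar-random if it is distributed according to the Haar probability measure on $\mathbb{Z}_p$. For subsets $\sigma_{n,1},\ldots,\sigma_{n,n}$ of $[n]$ and $\Sigma_n = (\sigma_{n,1},\ldots,\sigma_{n,n})$, the Haar-random matrix supported on $\Sigma_n$ is the random matrix $X_n \in \mathrm{M}_n(\mathbb{Z}_p)$ whose entries $(X_n)_{i,j}$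 (row $i$, column $j$) with $i \in \sigma_{n,j}$ are Haar-random and independent, and $(X_n)_{i,j} = 0$ whenever $i \notin \sigma_{n,j}$. For a finite abelian $p$-group $G$ put $\mathrm{CL}(G) = \frac{1}{\#\mathrm{Aut}(G)} \prod_{i=1}^{\infty}(1-p^{-i})$. A sequence $(Y_n)_{n\ge1}$ of random finitely generated $\mathbb{Z}_p$-modules converges to CL if $\lim_{n\to\infty}\mathbb{P}(Y_n \cong G) = \mathrm{CL}(G)$ for every finite abelian $p$-group $G$. *)

theory Defs
  imports
    "HOL-Probability.Probability"
    "HOL-Algebra.Bij"
    "HOL-Algebra.Coset"
    "Jordan_Normal_Form.Determinant"
    "Berlekamp_Zassenhaus.Finite_Field"
begin

text \<open>
  Throughout, the prime \<open>p\<close> is the cardinality of a type of class \<open>prime_card\<close>, so that the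
  field with \<open>p\<close> elements is the type \<open>'p mod_ring\<close>.  The ring of \<open>p\<close>-adic integers is the inverse
  limit of the rings of integers modulo \<open>p ^ k\<close>: its elements are the compatible sequences of
  least nonnegative residues.
\<close>

typedef (overloaded) ('p :: prime_card) padic_int =
  "{x :: nat \<Rightarrow> int. \<forall>k. x k \<in> {0..<int CARD('p) ^ k} \<and> x (Suc k) mod int CARD('p) ^ k = x k}"
  morphisms padic_residue Abs_padic_int
  by (rule exI[of _ "\<lambda>_. 0"]) (auto simp: prime_gt_0_nat prime_card)

setup_lifting type_definition_padic_int

lemma CARD_prime_pos: "int CARD('p :: prime_card) > 0"
  by (simp add: prime_gt_0_nat prime_card)

lemma mod_power_Suc: "(a mod (q :: int) ^ Suc k) mod q ^ k = a mod q ^ k"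
  by (simp add: mod_mod_cancel)

instantiation padic_int :: (prime_card) comm_ring_1
begin

lift_definition zero_padic_int :: "'a padic_int" is "\<lambda>_ :: nat. 0 :: int"
  using CARD_prime_pos[where 'p = 'a] by auto

lift_definition one_padic_int :: "'a padic_int" is "\<lambda>k :: nat. 1 mod int CARD('a) ^ k"
  using CARD_prime_pos[where 'p = 'a] by (simp only: mod_power_Suc) simp

lift_definition plus_padic_int :: "'a padic_int \<Rightarrow> 'a padic_int \<Rightarrow> 'a padic_int" is
  "\<lambda>x y (k :: nat). (x k + y k) mod int CARD('a) ^ k"
  using CARD_prime_pos[where 'p = 'a] by (simp only: mod_power_Suc) (simp, metis mod_add_eq)

lift_definition minus_padic_int :: "'a padic_int \<Rightarrow> 'a padic_int \<Rightarrow> 'a padic_int" is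
  "\<lambda>x y (k :: nat). (x k - y k) mod int CARD('a) ^ k"
  using CARD_prime_pos[where 'p = 'a] by (simp only: mod_power_Suc) (simp, metis mod_diff_eq)

lift_definition uminus_padic_int :: "'a padic_int \<Rightarrow> 'a padic_int" is
  "\<lambda>x (k :: nat). (- x k) mod int CARD('a) ^ k"
  using CARD_prime_pos[where 'p = 'a] by (simp only: mod_power_Suc) (simp, metis mod_minus_eq)

lift_definition times_padic_int :: "'a padic_int \<Rightarrow> 'a padic_int \<Rightarrow> 'a padic_int" is
  "\<lambda>x y (k :: nat). (x k * y k) mod int CARD('a) ^ k"
  using CARD_prime_pos[where 'p = 'a] by (simp only: mod_power_Suc) (simp, metis mod_mult_eq)

instance
proof
  fix a b c :: "'a padic_int"
  show "a * b * c = a * (b * c)"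
    by transfer (simp add: mod_simps mult.assoc)
  show "a * b = b * a"
    by transfer (simp add: mult.commute)
  show "1 * a = a"
    by transfer (auto simp: fun_eq_iff mod_simps)
  show "a + b + c = a + (b + c)"
    by transfer (simp add: mod_simps add.assoc)
  show "a + b = b + a"
    by transfer (simp add: add.commute)
  show "0 + a = a"
    by transfer (auto simp: fun_eq_iff)
  show "- a + a = 0"
    by transfer (simp add: mod_simps)
  show "a - b = a + - b"
    by transfer (simp add: mod_simps)
  show "(a + b) * c = a * c + b * c"
    by transfer (simp add: mod_simps distrib_right)
  show "(0 :: 'a padic_int) \<noteq> 1"
    using prime_gt_1_nat[OF prime_card[where 'a = 'a]]
    by transfer (auto dest!: fun_cong[of _ _ 1])
qed

end

text \<open>The \<open>p\<close>-adic topology: the cosets of \<open>p ^ k\<close> times the ring form a basis.\<close>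

instantiation padic_int :: (prime_card) topological_space
begin

definition open_padic_int :: "'a padic_int set \<Rightarrow> bool" where
  "open_padic_int U \<longleftrightarrow>
    (\<forall>x\<in>U. \<exists>k. {y. \<exists>z. y = x + of_nat CARD('a) ^ k * z} \<subseteq> U)"

instance
proof
  show "open (UNIV :: 'a padic_int set)"
    by (simp add: open_padic_int_def)
  fix S T :: "'a padic_int set" assume S: "open S" and T: "open T"
  show "open (S \<inter> T)"
    unfolding open_padic_int_def
  proof
    fix x assume x: "x \<in> S \<inter> T"
    let ?B = "\<lambda>k. {y. \<exists>z. y = x + of_nat CARD('a) ^ k * z}"
    obtain k l where k: "?B k \<subseteq> S" and l: "?B l \<subseteq> T"
      using x S T unfolding open_padic_int_def by blast
    have "?B (k + l) \<subseteq> ?B k"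
      by (auto simp: power_add mult.assoc)
    moreover have "?B (k + l) \<subseteq> ?B l"
      unfolding add.commute[of k l] by (auto simp: power_add mult.assoc)
    ultimately have "?B (k + l) \<subseteq> S \<inter> T"
      using k l by blast
    then show "\<exists>m. ?B m \<subseteq> S \<inter> T" ..
  qed
next
  fix K :: "'a padic_int set set" assume "\<forall>S\<in>K. open S"
  then show "open (\<Union>K)"
    unfolding open_padic_int_def by (meson Sup_upper UnionE subset_trans)
qed

end

lift_definition padic_reduce :: "'p :: prime_card padic_int \<Rightarrow> 'p mod_ring" is "\<lambda>x :: nat \<Rightarrow> int. x 1"
  by (metis power_one_right)

definition haar_prob_measure :: "'p :: prime_card padic_int measure \<Rightarrow> bool" where
  "haar_prob_measure \<mu> \<longleftrightarrow> sets \<mu> = sets borel \<and> prob_space \<mu> \<and>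
    (\<forall>a. \<forall>B\<in>sets borel. emeasure \<mu> ((\<lambda>x. a + x) ` B) = emeasure \<mu> B)"

definition haar_random :: "'w measure \<Rightarrow> ('w \<Rightarrow> 'p :: prime_card padic_int) \<Rightarrow> bool" where
  "haar_random M Y \<longleftrightarrow> Y \<in> borel_measurable M \<and> haar_prob_measure (distr M borel Y)"

text \<open>
  Rows and columns are numbered from 1 in the supports \<open>\<sigma> j\<close>, but from 0 in the matrix type.
\<close>

definition haar_random_matrix_on ::
  "'w measure \<Rightarrow> nat \<Rightarrow> (nat \<Rightarrow> nat set) \<Rightarrow> ('w \<Rightarrow> 'p :: prime_card padic_int mat) \<Rightarrow> bool" where
  "haar_random_matrix_on M n \<sigma> X \<longleftrightarrow>
    (\<forall>\<omega>\<in>space M. X \<omega> \<in> carrier_mat n n) \<and>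
    (\<forall>j\<in>{1..n}. \<forall>i\<in>{1..n} \<inter> \<sigma> j. haar_random M (\<lambda>\<omega>. X \<omega> $$ (i - 1, j - 1))) \<and>
    prob_space.indep_vars M (\<lambda>_. borel) (\<lambda>(i, j) \<omega>. X \<omega> $$ (i - 1, j - 1))
      {(i, j). i \<in> {1..n} \<and> j \<in> {1..n} \<and> i \<in> \<sigma> j} \<and>
    (\<forall>\<omega>\<in>space M. \<forall>j\<in>{1..n}. \<forall>i\<in>{1..n} - \<sigma> j. X \<omega> $$ (i - 1, j - 1) = 0)"

definition cok :: "'p :: prime_card padic_int mat \<Rightarrow> 'p padic_int vec set monoid" where
  "cok A = monoid_vec TYPE('p padic_int) (dim_row A) Mod
    ((\<lambda>v. A *\<^sub>v v) ` carrier_vec (dim_col A))"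

definition finite_abelian_p_group :: "nat \<Rightarrow> 'g monoid \<Rightarrow> bool" where
  "finite_abelian_p_group p G \<longleftrightarrow>
    comm_group G \<and> finite (carrier G) \<and> (\<exists>k. order G = p ^ k)"

definition CL :: "nat \<Rightarrow> 'g monoid \<Rightarrow> real" where
  "CL p G = 1 / real (card (auto G)) * (\<Prod>i. 1 - 1 / real p ^ Suc i)"

text \<open>
  Every finite group is isomorphic to one whose carrier is a set of natural numbers, so
  \<open>G :: nat monoid\<close> covers all isomorphism classes.  A group isomorphism between a
  \<open>p\<close>-adic module and a finite abelian \<open>p\<close>-group is automatically linear over the \<open>p\<close>-adic
  integers, hence the module structure is not recorded.
\<close>

definition converges_to_CL ::
  "nat \<Rightarrow> (nat \<Rightarrow> 'w measure) \<Rightarrow> (nat \<Rightarrow> 'w \<Rightarrow> 'a monoid) \<Rightarrow> bool" where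
  "converges_to_CL p M Y \<longleftrightarrow>
    (\<forall>G :: nat monoid. finite_abelian_p_group p G \<longrightarrow>
      (\<lambda>n. \<P>(\<omega> in M n. Y n \<omega> \<cong> G)) \<longlonglongrightarrow> CL p G)"

definition stair_support :: "(nat \<Rightarrow> nat) \<Rightarrow> nat \<Rightarrow> nat \<Rightarrow> nat set" where
  "stair_support t n i = (if i \<le> n - t n then {1..t n + (i - 1)} else {1..n})"

end

theory Submission
  imports Defs "HOL-Algebra.Product_Groups" "HOL-Real_Asymp.Real_Asymp"
begin

text \<open>
  Number the columns from 0.  Column \<open>j\<close> of the matrix is uniform on the vectors supported on the
  first \<open>min (t + j) n\<close> coordinates.  For \<open>j < n - t\<close> all earlier columns lie in the same coordinate
  subspace, which has dimension \<open>t + j\<close>; if they are independent modulo \<open>p\<close>, then column \<open>j\<close> falls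
  into their span modulo \<open>p\<close> with probability \<open>p ^ j / p ^ (t + j) = 1 / p ^ t\<close>.  Hence the first
  \<open>n - t\<close> columns are independent modulo \<open>p\<close> with probability \<open>a = (1 - 1 / p ^ t) ^ (n - t)\<close>.

  On that event the law of the cokernel depends on \<open>t\<close> alone.  Let \<open>c\<close> be the first \<open>n - t\<close> columns
  and \<open>d\<close> the remaining ones, which are uniform on all vectors.  The cokernel is isomorphic to \<open>G\<close>
  exactly when the columns generate the kernel of a surjection onto \<open>G\<close>, and then they do so for
  \<open>|Aut G|\<close> surjections, all vanishing on \<open>c\<close>.  As \<open>c\<close> extends to a basis by \<open>t\<close> vectors, the
  surjections vanishing on \<open>c\<close> correspond to the \<open>t\<close>-tuples that generate \<open>G\<close>.  The kernel \<open>K\<close> of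
  such a surjection has index \<open>|G|\<close>, and \<open>K / p K\<close> has order \<open>p ^ n\<close>; by Nakayama's lemma \<open>c\<close> and
  \<open>d\<close> generate \<open>K\<close> when \<open>d\<close> lies in \<open>K\<close> and completes \<open>c\<close> to a basis of \<open>K / p K\<close>.  This has
  probability \<open>|G| ^ (- t)\<close> times the product of \<open>1 - p ^ (- i)\<close> over \<open>1 \<le> i \<le> t\<close>.  Summation over
  the surjections gives the quantity \<open>stair_density\<close> below (lemmas
  \<open>card_completions_with_given_quotient\<close> and \<open>card_stair_lists_leading_indep\<close>).  It tends to
  \<open>CL(G)\<close> as \<open>t \<rightarrow> \<infinity>\<close>, because almost all \<open>t\<close>-tuples generate \<open>G\<close>.

  All this is a count in a finite group: if \<open>|G| = p ^ e\<close>, then the residues of the entries modulo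
  \<open>p ^ (e + 1)\<close> decide whether the cokernel is isomorphic to \<open>G\<close>
  (\<open>cok_iso_iff_residue_quotient_iso\<close>), and these residues are independent and uniform
  (\<open>residue_columns_uniform\<close>).

  The three conditions are compared through \<open>n / p ^ t \<rightarrow> 0\<close>, which says that \<open>t - log\<^sub>p n\<close> tends to
  infinity.  A trivial cokernel, that is, a determinant that is nonzero modulo \<open>p\<close>, forces the
  first \<open>n - t\<close> columns to be independent, so that it has probability exactly \<open>a\<close> times the product
  of \<open>1 - p ^ (- i)\<close> over \<open>1 \<le> i \<le> t\<close>.  For this to tend to the infinite product, \<open>t\<close> has to
  tend to infinity and \<open>a\<close> to 1, and then \<open>n / p ^ t \<rightarrow> 0\<close>.  Conversely \<open>n / p ^ t \<rightarrow> 0\<close> makes \<open>t\<close> tend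
  to infinity and \<open>a\<close> to 1, which yields the limit \<open>CL(G)\<close> for every \<open>G\<close>.  The case of
  the trivial group is the limit for the determinant.
\<close>

section \<open>Independence over a subgroup\<close>

text \<open>
  In the applications \<open>F\<close> contains the \<open>p\<close>-th powers of all elements that occur, and the notion is
  then linear independence over the field with \<open>p\<close> elements in the quotient by \<open>F\<close>.  The
  formulation by prefixes lets a list be counted entry by entry.
\<close>

definition indep_over :: "('a, 'b) monoid_scheme \<Rightarrow> 'a set \<Rightarrow> 'a list \<Rightarrow> bool" where
  "indep_over G F cs \<longleftrightarrow> (\<forall>i<length cs. cs ! i \<notin> generate G (F \<union> set (take i cs)))"

lemma indep_over_Nil [simp]: "indep_over G F []"
  by (simp add: indep_over_def)

lemma indep_over_snoc:
  "indep_over G F (cs @ [c]) \<longleftrightarrow> indep_over G F cs \<and> c \<notin> generate G (F \<union> set cs)"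
  by (auto simp: indep_over_def nth_append less_Suc_eq)

lemma (in group) generate_subgroup_self:
  "subgroup H G \<Longrightarrow> generate G H = H"
  by (meson generate.incl generate_subgroup_incl order_refl subset_antisym subsetI)

lemma (in group) subset_set_mult:
  assumes "H \<subseteq> carrier G" "K \<subseteq> carrier G"
  shows "\<one> \<in> K \<Longrightarrow> H \<subseteq> H <#> K" "\<one> \<in> H \<Longrightarrow> K \<subseteq> H <#> K"
proof -
  have 1: "x = x \<otimes> \<one>" if "x \<in> H" for x
    using that assms by auto
  show "H \<subseteq> H <#> K" if "\<one> \<in> K"
    unfolding set_mult_def using that 1 by blast
  have 2: "x = \<one> \<otimes> x" if "x \<in> K" for x
    using that assms by auto
  show "K \<subseteq> H <#> K" if "\<one> \<in> H"
    unfolding set_mult_def using that 2 by blast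
qed

lemma (in group) generate_generate_Un:
  assumes "A \<subseteq> carrier G" "B \<subseteq> carrier G"
  shows "generate G (generate G A \<union> B) = generate G (A \<union> B)"
proof (rule antisym)
  have 1: "generate G A \<subseteq> generate G (A \<union> B)"
    by (rule mono_generate) auto
  have "B \<subseteq> generate G (A \<union> B)"
    by (auto intro: generate.incl)
  with 1 show "generate G (generate G A \<union> B) \<subseteq> generate G (A \<union> B)"
    by (intro generate_subgroup_incl generate_is_subgroup) (use assms in auto)
  show "generate G (A \<union> B) \<subseteq> generate G (generate G A \<union> B)"
    by (rule mono_generate) (auto intro: generate.incl)
qed

lemma (in group) indep_over_append:
  assumes "F \<subseteq> carrier G" "set cs \<subseteq> carrier G" "set ds \<subseteq> carrier G"
  shows "indep_over G F (cs @ ds) \<longleftrightarrow>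
    indep_over G F cs \<and> indep_over G (generate G (F \<union> set cs)) ds"
  using assms(3)
proof (induction ds rule: rev_induct)
  case (snoc d ds)
  have "generate G (generate G (F \<union> set cs) \<union> set ds) = generate G (F \<union> set (cs @ ds))"
    using generate_generate_Un[of "F \<union> set cs" "set ds"] assms snoc.prems by (simp add: Un_assoc)
  then show ?case
    using snoc by (simp flip: append_assoc add: indep_over_snoc)
qed simp

lemma (in group) indep_over_mono:
  assumes "indep_over G F cs" "F' \<subseteq> F"
  shows "indep_over G F' cs"
  using assms mono_generate[OF Un_mono[OF assms(2) subset_refl]]
  unfolding indep_over_def by blast

text \<open>
  The modular law of the lattice of subgroups.  It computes the part of a span modulo \<open>p\<close>-th powers
  that lies in a coordinate subgroup.
\<close>

lemma (in comm_group) generate_Un_Int: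
  assumes P: "subgroup P G" and H: "subgroup H G" and S: "S \<subseteq> H"
  shows "H \<inter> generate G (P \<union> S) = generate G ((P \<inter> H) \<union> S)"
proof
  have SG: "S \<subseteq> carrier G" and PG: "P \<subseteq> carrier G"
    using S H P subgroup.subset by blast+
  have gS: "subgroup (generate G S) G" "generate G S \<subseteq> H"
    using generate_is_subgroup[OF SG] generate_subgroup_incl[OF S H] by auto
  have "S \<subseteq> generate G S"
    by (auto intro: generate.incl)
  moreover have "P \<subseteq> P <#> generate G S" "generate G S \<subseteq> P <#> generate G S"
    by (intro subset_set_mult PG subgroup.subset[OF gS(1)] subgroup.one_closed[OF gS(1)] subgroup.one_closed[OF P])+
  ultimately have "generate G (P \<union> S) \<subseteq> P <#> generate G S"
    by (intro generate_subgroup_incl mult_subgroups P gS) auto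
  moreover have "x \<in> generate G ((P \<inter> H) \<union> S)" if x: "x \<in> H" "x \<in> P <#> generate G S" for x
  proof -
    obtain f s where fs: "f \<in> P" "s \<in> generate G S" "x = f \<otimes> s"
      using x unfolding set_mult_def by auto
    have "f \<in> carrier G" "s \<in> carrier G"
      using fs PG subgroup.subset[OF gS(1)] by auto
    then have "f = x \<otimes> inv s"
      using fs by (simp add: m_assoc)
    then have "f \<in> H"
      using x fs gS(2) H by (metis subgroup.m_closed subgroup.m_inv_closed subsetD)
    moreover have "s \<in> generate G ((P \<inter> H) \<union> S)"
      using fs(2) mono_generate[of S "(P \<inter> H) \<union> S"] by auto
    ultimately show ?thesis
      unfolding fs(3) using fs(1) by (intro generate.eng) (auto intro: generate.incl)
  qed
  ultimately show "H \<inter> generate G (P \<union> S) \<subseteq> generate G ((P \<inter> H) \<union> S)"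
    by blast
  have "generate G ((P \<inter> H) \<union> S) \<subseteq> H"
    using S H by (intro generate_subgroup_incl) auto
  moreover have "generate G ((P \<inter> H) \<union> S) \<subseteq> generate G (P \<union> S)"
    by (rule mono_generate) auto
  ultimately show "generate G ((P \<inter> H) \<union> S) \<subseteq> H \<inter> generate G (P \<union> S)"
    by blast
qed

text \<open>
  Modulo \<open>D\<close>, the element \<open>c\<close> has order \<open>p\<close>, so adjoining it multiplies the order by \<open>p\<close>.
\<close>

lemma (in comm_group) card_generate_insert:
  assumes D: "subgroup D G" and p: "Factorial_Ring.prime (p :: nat)"
    and c: "c \<in> carrier G" "c [^] p \<in> D" "c \<notin> D"
  shows "card (generate G (insert c D)) = p * card D"
proof -
  interpret D: subgroup D G by fact
  note [simp] = D.mem_carrier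
  let ?f = "\<lambda>(x, k). x \<otimes> c [^] (k :: nat)"
  have pk: "c [^] (int p * k) \<in> D" for k :: int
  proof -
    have "(c [^] p) [^] k \<in> D"
      using subgroup_int_pow_closed[OF D c(2)] .
    then show ?thesis
      using c(1) by (simp add: int_pow_pow flip: int_pow_int)
  qed
  have gen: "generate G (insert c D) = D <#> generate G {c}"
  proof
    have sc: "subgroup (generate G {c}) G"
      using c by (intro generate_is_subgroup) auto
    have "subgroup (D <#> generate G {c}) G"
      by (intro mult_subgroups D sc)
    moreover have "D \<subseteq> D <#> generate G {c}" "generate G {c} \<subseteq> D <#> generate G {c}"
      by (intro subset_set_mult D.subset subgroup.subset[OF sc] subgroup.one_closed[OF sc] D.one_closed)+
    moreover have "c \<in> generate G {c}"
      by (auto intro: generate.incl)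
    ultimately show "generate G (insert c D) \<subseteq> D <#> generate G {c}"
      by (intro generate_subgroup_incl) auto
    have "D \<subseteq> generate G (insert c D)" "generate G {c} \<subseteq> generate G (insert c D)"
      by (auto intro: generate.incl subsetD[OF mono_generate[of "{c}" "insert c D"]])
    then show "D <#> generate G {c} \<subseteq> generate G (insert c D)"
      unfolding set_mult_def by (auto intro!: generate.eng)
  qed
  have img: "generate G (insert c D) = ?f ` (D \<times> {..<p})"
  proof (rule antisym; rule subsetI)
    fix y assume "y \<in> generate G (insert c D)"
    then obtain x k where x: "x \<in> D" and y: "y = x \<otimes> c [^] (k :: int)"
      unfolding gen set_mult_def generate_pow[OF c(1)] by auto
    have pos: "int p > 0"
      using prime_gt_0_nat[OF p] by simp
    define r where "r = nat (k mod int p)"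
    have r: "r < p" "int r = k mod int p"
      using pos by (auto simp: r_def nat_less_iff)
    have "y = (x \<otimes> c [^] (int p * (k div int p))) \<otimes> c [^] int r"
      using x c(1) pk unfolding y r by (simp add: m_assoc int_pow_mult[symmetric])
    then have "y = ?f (x \<otimes> c [^] (int p * (k div int p)), r)"
      by (simp add: int_pow_int)
    then show "y \<in> ?f ` (D \<times> {..<p})"
      using x pk r by blast
  next
    fix y assume "y \<in> ?f ` (D \<times> {..<p})"
    then show "y \<in> generate G (insert c D)"
      unfolding gen set_mult_def generate_pow[OF c(1)]
      by (force simp: int_pow_int[symmetric] simp del: int_pow_int)
  qed
  \<comment> \<open>An equality of two such products puts a power of \<open>c\<close> with exponent between 0 and \<open>p\<close> into \<open>D\<close>, and then \<open>c\<close> by Bezout.\<close>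
  have key: False if "k < l" "l < p" "x \<in> D" "y \<in> D" "x \<otimes> c [^] k = y \<otimes> c [^] l" for k l x y
  proof -
    define m where "m = l - k"
    have m: "0 < m" "m < p" "l = m + k"
      using that by (auto simp: m_def)
    have "x \<otimes> c [^] k = (y \<otimes> c [^] m) \<otimes> c [^] k"
      using that c m by (simp add: m_assoc nat_pow_mult)
    then have "x = y \<otimes> c [^] m"
      using that c by simp
    then have "inv y \<otimes> x = c [^] m"
      using that c by (simp add: m_assoc[symmetric])
    then have cm: "c [^] int m \<in> D"
      using that by (metis D.m_closed D.m_inv_closed int_pow_int)
    have "coprime m p"
      using m p by (metis coprime_commute nat_dvd_not_less prime_imp_coprime)
    then obtain u v where uv: "u * int m + v * int p = 1"
      by (metis bezout_int coprime_iff_gcd_eq_1 coprime_int_iff)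
    have "c = c [^] (int m * u) \<otimes> c [^] (int p * v)"
      using c uv by (simp add: int_pow_mult[symmetric] mult.commute)
    moreover have "c [^] (int m * u) \<in> D"
      using subgroup_int_pow_closed[OF D cm, of u] c(1) by (simp add: int_pow_pow)
    ultimately show False
      using pk c(3) by (metis D.m_closed)
  qed
  have "inj_on ?f (D \<times> {..<p})"
  proof (rule inj_onI, clarsimp)
    fix x k y l
    assume *: "x \<in> D" "k < p" "y \<in> D" "l < p" "x \<otimes> c [^] k = y \<otimes> c [^] l"
    have "k = l"
      using key[of k l x y] key[of l k y x] * by (metis linorder_neqE_nat)
    then show "x = y \<and> k = l"
      using * c by simp
  qed
  then show ?thesis
    unfolding img by (simp add: card_image card_cartesian_product)
qed

text \<open>
  Each entry multiplies the order of the generated subgroup by \<open>p\<close> if it is new and leaves it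
  unchanged otherwise.  Independence is therefore a statement about a cardinality, which turns
  spanning and independence into one another when the numbers match.
\<close>

lemma (in comm_group) card_generate_Un_indep:
  assumes F: "subgroup F G" and fin: "finite F" and p: "Factorial_Ring.prime (p :: nat)"
    and cs: "set cs \<subseteq> carrier G" "\<And>c. c \<in> set cs \<Longrightarrow> c [^] p \<in> F"
  shows "finite (generate G (F \<union> set cs)) \<and> card (generate G (F \<union> set cs)) \<le> p ^ length cs * card F \<and>
    (indep_over G F cs \<longleftrightarrow> card (generate G (F \<union> set cs)) = p ^ length cs * card F)"
  using cs
proof (induction cs rule: rev_induct)
  case Nil
  have "generate G F = F"
    by (rule generate_subgroup_self[OF F])
  then show ?case
    using fin by simp
next
  case (snoc c cs)
  let ?D = "generate G (F \<union> set cs)"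
  have FG: "F \<subseteq> carrier G"
    using F subgroup.subset by blast
  have D: "subgroup ?D G"
    using snoc.prems FG by (intro generate_is_subgroup) auto
  have IH: "finite ?D" "card ?D \<le> p ^ length cs * card F"
    "indep_over G F cs \<longleftrightarrow> card ?D = p ^ length cs * card F"
    using snoc by auto
  have c: "c \<in> carrier G" "c [^] p \<in> ?D"
    using snoc.prems by (auto intro: generate.incl)
  have eq: "generate G (F \<union> set (cs @ [c])) = generate G (insert c ?D)"
    using generate_generate_Un[of "F \<union> set cs" "{c}"] snoc.prems FG by auto
  have pos: "0 < card F" "0 < card ?D" "p > 1"
    using F fin D IH(1) subgroup.one_closed[OF F] subgroup.one_closed[OF D] prime_gt_1_nat[OF p]
    by (auto simp: card_gt_0_iff)
  show ?case
  proof (cases "c \<in> ?D")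
    case True
    then have "generate G (insert c ?D) = ?D"
      using generate_subgroup_self[OF D] by (simp add: insert_absorb)
    moreover have "card ?D < p ^ Suc (length cs) * card F"
    proof -
      have "1 * (p ^ length cs * card F) < p * (p ^ length cs * card F)"
        using pos by (intro mult_strict_right_mono) auto
      then show ?thesis
        using IH(2) unfolding power_Suc mult.assoc mult_1 by linarith
    qed
    ultimately show ?thesis
      using True IH unfolding eq indep_over_snoc by auto
  next
    case False
    have "card (generate G (insert c ?D)) = p * card ?D"
      by (rule card_generate_insert[OF D p c False])
    moreover from this have "finite (generate G (insert c ?D))"
      using pos by (intro card_ge_0_finite) simp
    ultimately show ?thesis
      using False IH pos unfolding eq indep_over_snoc by auto
  qed
qed

lemma (in comm_group) subgroup_pow_image:
  assumes "subgroup K G"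
  shows "subgroup ((\<lambda>x. x [^] (p :: nat)) ` K) G"
proof (rule subgroupI)
  interpret K: subgroup K G by fact
  show "(\<lambda>x. x [^] p) ` K \<subseteq> carrier G" "(\<lambda>x. x [^] p) ` K \<noteq> {}"
    using K.one_closed by (blast intro: nat_pow_closed K.mem_carrier)+
  show "inv a \<in> (\<lambda>x. x [^] p) ` K" if "a \<in> (\<lambda>x. x [^] p) ` K" for a
    using that K.mem_carrier by (auto simp: nat_pow_inv intro!: image_eqI[where x = "inv _"])
  show "a \<otimes> b \<in> (\<lambda>x. x [^] p) ` K" if "a \<in> (\<lambda>x. x [^] p) ` K" "b \<in> (\<lambda>x. x [^] p) ` K" for a b
    using that by (smt (verit) K.m_closed K.mem_carrier image_iff nat_pow_distrib)
qed

text \<open>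
  Nakayama's lemma for finite abelian \<open>p\<close>-groups: \<open>K = p K + \<langle>D\<rangle>\<close> in additive notation, substituted
  into itself \<open>m\<close> times, becomes \<open>K = p ^ m K + \<langle>D\<rangle> = \<langle>D\<rangle>\<close>.
\<close>

lemma (in comm_group) generate_eq_of_generate_pow_image:
  assumes K: "subgroup K G" and exp: "\<And>x. x \<in> K \<Longrightarrow> x [^] (p ^ m :: nat) = \<one>"
    and D: "D \<subseteq> K" and gen: "generate G ((\<lambda>x. x [^] (p :: nat)) ` K \<union> D) = K"
  shows "generate G D = K"
proof
  interpret K: subgroup K G by fact
  note [simp] = K.mem_carrier
  have DG: "D \<subseteq> carrier G"
    using D K.subset by auto
  have sD: "subgroup (generate G D) G"
    using DG by (rule generate_is_subgroup)
  show sub: "generate G D \<subseteq> K"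
    using D K by (rule generate_subgroup_incl)
  have pK: "subgroup ((\<lambda>x. x [^] p) ` K) G"
    by (rule subgroup_pow_image[OF K])
  have "subgroup ((\<lambda>x. x [^] p) ` K <#> generate G D) G"
    by (rule mult_subgroups[OF pK sD])
  moreover have "(\<lambda>x. x [^] p) ` K \<subseteq> (\<lambda>x. x [^] p) ` K <#> generate G D"
    "generate G D \<subseteq> (\<lambda>x. x [^] p) ` K <#> generate G D"
    by (intro subset_set_mult subgroup.subset pK sD subgroup.one_closed)+
  moreover have "D \<subseteq> generate G D"
    by (auto intro: generate.incl)
  ultimately have "K \<subseteq> (\<lambda>x. x [^] p) ` K <#> generate G D"
    using generate_subgroup_incl[of "(\<lambda>x. x [^] p) ` K \<union> D" "(\<lambda>x. x [^] p) ` K <#> generate G D"]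
    unfolding gen by blast
  then have step: "\<exists>y\<in>K. \<exists>s\<in>generate G D. x = y [^] p \<otimes> s" if "x \<in> K" for x
    using that unfolding set_mult_def by blast
  have "\<exists>y\<in>K. \<exists>s\<in>generate G D. x = y [^] (p ^ i) \<otimes> s" if "x \<in> K" for x i
  proof (induction i)
    case 0
    show ?case
      using that generate.one[of G D] by (intro bexI[of _ x] bexI[of _ \<one>]) auto
  next
    case (Suc i)
    then obtain y s where y: "y \<in> K" "s \<in> generate G D" "x = y [^] (p ^ i) \<otimes> s" by blast
    obtain z s' where z: "z \<in> K" "s' \<in> generate G D" "y = z [^] p \<otimes> s'"
      using step[OF y(1)] by blast
    have [simp]: "s \<in> carrier G" "s' \<in> carrier G"
      using y z sub by auto
    have "x = z [^] (p ^ Suc i) \<otimes> (s' [^] (p ^ i) \<otimes> s)"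
      unfolding y(3) using y z by (simp add: nat_pow_distrib nat_pow_pow m_assoc)
    moreover have "s' [^] (p ^ i) \<otimes> s \<in> generate G D"
      using y z sD by (metis generate.eng int_pow_int subgroup_int_pow_closed)
    ultimately show ?case
      using z by blast
  qed
  from this[of _ m] show "K \<subseteq> generate G D"
    using exp sub by fastforce
qed

section \<open>Counting generating lists and homomorphisms\<close>

text \<open>
  The set of choices for an entry may depend on the earlier entries, as long as its size depends
  only on the position.
\<close>

lemma card_dependent_lists:
  fixes B :: "nat \<Rightarrow> 'a list \<Rightarrow> 'a set"
  assumes "\<And>i cs. \<lbrakk>i < k; length cs = i; \<forall>j<i. cs ! j \<in> B j (take j cs)\<rbrakk> \<Longrightarrow> finite (B i cs) \<and> card (B i cs) = m i"
  shows "finite {cs. length cs = k \<and> (\<forall>j<k. cs ! j \<in> B j (take j cs))} \<and>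
    card {cs. length cs = k \<and> (\<forall>j<k. cs ! j \<in> B j (take j cs))} = (\<Prod>i<k. m i)"
  using assms
proof (induction k)
  case 0
  show ?case by simp
next
  case (Suc k)
  define S where "S k = {cs. length cs = k \<and> (\<forall>j<k. cs ! j \<in> B j (take j cs))}" for k
  have IH: "finite (S k)" "card (S k) = (\<Prod>i<k. m i)"
    using Suc unfolding S_def by auto
  have B: "finite (B k cs)" "card (B k cs) = m k" if "cs \<in> S k" for cs
    using Suc.prems[of k cs] that unfolding S_def by auto
  have eq: "S (Suc k) = (\<lambda>(cs, c). cs @ [c]) ` (SIGMA cs:S k. B k cs)"
  proof (rule antisym; rule subsetI)
    fix x assume x: "x \<in> S (Suc k)"
    then have "length x = Suc k" by (simp add: S_def)
    then obtain cs c where [simp]: "x = cs @ [c]" "length cs = k"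
      by (metis length_Suc_conv_rev)
    have "cs \<in> S k" using x by (force simp: S_def nth_append less_Suc_eq)
    moreover have "c \<in> B k cs" using x by (auto simp: S_def nth_append less_Suc_eq)
    ultimately show "x \<in> (\<lambda>(cs, c). cs @ [c]) ` (SIGMA cs:S k. B k cs)"
      by (intro image_eqI[where x = "(cs, c)"]) auto
  next
    fix x assume "x \<in> (\<lambda>(cs, c). cs @ [c]) ` (SIGMA cs:S k. B k cs)"
    then show "x \<in> S (Suc k)" by (force simp: S_def nth_append less_Suc_eq)
  qed
  have "inj_on (\<lambda>(cs, c). cs @ [c]) (SIGMA cs:S k. B k cs)"
    by (auto simp: inj_on_def)
  then have "card (S (Suc k)) = (\<Sum>cs\<in>S k. card (B k cs))"
    unfolding eq using IH B by (simp add: card_image card_SigmaI)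
  also have "\<dots> = (\<Prod>i<Suc k. m i)"
    using IH B by simp
  finally show ?case
    using IH B eq unfolding S_def[symmetric] by auto
qed

lemma card_lists_nth_mem:
  assumes "\<And>i. i < k \<Longrightarrow> finite (V i)"
  shows "finite {cs. length cs = k \<and> (\<forall>j<k. cs ! j \<in> V j)} \<and>
    card {cs. length cs = k \<and> (\<forall>j<k. cs ! j \<in> V j)} = (\<Prod>i<k. card (V i))"
  using card_dependent_lists[of k "\<lambda>i _. V i" "\<lambda>i. card (V i)"] assms by auto

lemma (in comm_group) card_indep_over_lists:
  assumes p: "Factorial_Ring.prime (p :: nat)" and K: "subgroup K G" "finite K"
    and D: "subgroup D G" "D \<subseteq> K" "\<And>x. x \<in> K \<Longrightarrow> x [^] p \<in> D"
  shows "card {ds. length ds = t \<and> set ds \<subseteq> K \<and> indep_over G D ds} = (\<Prod>i<t. card K - p ^ i * card D)"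
proof -
  have KG: "K \<subseteq> carrier G"
    using K subgroup.subset by blast
  let ?B = "\<lambda>i cs. K - generate G (D \<union> set cs)"
  have eq: "(set ds \<subseteq> K \<and> indep_over G D ds) = (\<forall>j<t. ds ! j \<in> ?B j (take j ds))" if "length ds = t" for ds t
    using that by (auto simp: indep_over_def set_conv_nth)
  have "finite (?B i cs) \<and> card (?B i cs) = card K - p ^ i * card D"
    if "length cs = i" "\<forall>j<i. cs ! j \<in> ?B j (take j cs)" for i cs
  proof -
    have cs: "set cs \<subseteq> K" "indep_over G D cs"
      using eq[OF that(1)] that(2) by auto
    have sub: "generate G (D \<union> set cs) \<subseteq> K"
      using cs D K by (intro generate_subgroup_incl) auto
    have "card (generate G (D \<union> set cs)) = p ^ i * card D"
      using card_generate_Un_indep[OF D(1) _ p, of cs] cs D K KG that finite_subset by blast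
    then show ?thesis
      using sub K by (simp add: card_Diff_subset finite_subset)
  qed
  then have "card {cs. length cs = t \<and> (\<forall>j<t. cs ! j \<in> ?B j (take j cs))} = (\<Prod>i<t. card K - p ^ i * card D)"
    using card_dependent_lists[of t ?B "\<lambda>i. card K - p ^ i * card D"] by blast
  moreover have "{ds. length ds = t \<and> set ds \<subseteq> K \<and> indep_over G D ds} =
      {cs. length cs = t \<and> (\<forall>j<t. cs ! j \<in> ?B j (take j cs))}"
    using eq by blast
  ultimately show ?thesis by simp
qed

text \<open>
  By Nakayama's lemma, generating \<open>K\<close> is a condition modulo the \<open>p\<close>-th powers \<open>P\<close> of \<open>K\<close>, where
  \<open>K / P\<close> has order \<open>p ^ (length cs + t)\<close>.  Since \<open>t\<close> more entries are just enough to
  generate, they have to be independent over the subgroup \<open>D\<close> generated by \<open>P\<close> and \<open>cs\<close>, and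
  independent lists are counted entry by entry.
\<close>

lemma (in comm_group) card_generating_completions:
  assumes p: "Factorial_Ring.prime (p :: nat)" and K: "subgroup K G" "finite K"
    and exp: "\<And>x. x \<in> K \<Longrightarrow> x [^] (p ^ m) = \<one>"
    and cs: "set cs \<subseteq> K" "indep_over G ((\<lambda>x. x [^] p) ` K) cs"
    and card: "card K = p ^ (length cs + t) * card ((\<lambda>x. x [^] p) ` K)"
  shows "real (card {ds. length ds = t \<and> set ds \<subseteq> carrier G \<and> generate G (set cs \<union> set ds) = K}) =
    real (card K) ^ t * (\<Prod>i<t. 1 - 1 / real p ^ Suc i)"
proof -
  interpret K: subgroup K G by fact
  note KG = K.subset
  define P where "P = (\<lambda>x. x [^] p) ` K"
  have "x [^] p \<in> K" if "x \<in> K" for x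
    using subgroup_int_pow_closed[OF K(1) that, of "int p"] by (simp add: int_pow_int)
  then have P: "subgroup P G" "P \<subseteq> K" "finite P"
    using subgroup_pow_image[OF K(1)] K unfolding P_def by auto
  define D where "D = generate G (P \<union> set cs)"
  have D: "subgroup D G" "D \<subseteq> K" "P \<subseteq> D"
    unfolding D_def using P cs KG generate_is_subgroup[of "P \<union> set cs"] generate_subgroup_incl[OF _ K(1), of "P \<union> set cs"]
    by (auto intro: generate.incl)
  have finD: "finite D"
    using D K finite_subset by blast
  have "card D = p ^ length cs * card P"
    using card_generate_Un_indep[OF P(1,3) p, of cs] cs KG unfolding D_def P_def by auto
  then have cK: "card K = p ^ t * card D"
    using card unfolding P_def by (simp add: power_add)
  have Dp: "x [^] p \<in> D" if "x \<in> K" for x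
    using that D unfolding P_def by auto
  have iff: "generate G (set cs \<union> set ds) = K \<longleftrightarrow> set ds \<subseteq> K \<and> indep_over G D ds"
    if ds: "length ds = t" "set ds \<subseteq> carrier G" for ds
  proof -
    have eq: "generate G (D \<union> set ds) = generate G (P \<union> (set cs \<union> set ds))"
      using generate_generate_Un[of "P \<union> set cs" "set ds"] ds P cs KG unfolding D_def
      by (simp add: Un_assoc subset_trans)
    have ind: "indep_over G D ds \<longleftrightarrow> generate G (D \<union> set ds) = K" if "set ds \<subseteq> K"
    proof -
      have "generate G (D \<union> set ds) \<subseteq> K"
        using that D K by (intro generate_subgroup_incl) auto
      then have "card (generate G (D \<union> set ds)) = card K \<longleftrightarrow> generate G (D \<union> set ds) = K"
        using K card_subset_eq by blast
      then show ?thesis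
        using card_generate_Un_indep[OF D(1) finD p, of ds] ds that Dp cK by (auto simp: subset_iff)
    qed
    show ?thesis
    proof
      assume *: "generate G (set cs \<union> set ds) = K"
      then have "set ds \<subseteq> K"
        by (auto intro: generate.incl)
      moreover have "K \<subseteq> generate G (D \<union> set ds)"
        unfolding eq *[symmetric] by (rule mono_generate) auto
      moreover have "generate G (D \<union> set ds) \<subseteq> K"
        using D K \<open>set ds \<subseteq> K\<close> by (intro generate_subgroup_incl) auto
      ultimately show "set ds \<subseteq> K \<and> indep_over G D ds"
        using ind by auto
    next
      assume *: "set ds \<subseteq> K \<and> indep_over G D ds"
      then have "generate G (P \<union> (set cs \<union> set ds)) = K"
        using ind eq by auto
      then show "generate G (set cs \<union> set ds) = K"
        using * cs generate_eq_of_generate_pow_image[OF K(1) exp, where D = "set cs \<union> set ds"]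
        unfolding P_def by auto
    qed
  qed
  have "{ds. length ds = t \<and> set ds \<subseteq> carrier G \<and> generate G (set cs \<union> set ds) = K} =
    {ds. length ds = t \<and> set ds \<subseteq> K \<and> indep_over G D ds}"
    using iff KG by blast
  then have "card {ds. length ds = t \<and> set ds \<subseteq> carrier G \<and> generate G (set cs \<union> set ds) = K} =
    (\<Prod>i<t. card K - p ^ i * card D)"
    using card_indep_over_lists[OF p K D(1,2) Dp] by simp
  also have "real \<dots> = (\<Prod>i<t. real (card K) * (1 - 1 / real p ^ Suc (t - Suc i)))"
    unfolding of_nat_prod
  proof (rule prod.cong, simp)
    fix i assume i: "i \<in> {..<t}"
    then have "p ^ i * card D \<le> card K"
      unfolding cK using prime_gt_0_nat[OF p] by (intro mult_right_mono power_increasing) auto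
    moreover have "t = i + Suc (t - Suc i)"
      using i by simp
    then have "real p ^ t = real p ^ i * real p ^ Suc (t - Suc i)"
      by (metis power_add)
    ultimately show "real (card K - p ^ i * card D) = real (card K) * (1 - 1 / real p ^ Suc (t - Suc i))"
      using prime_gt_0_nat[OF p] by (simp add: of_nat_diff cK field_simps)
  qed
  also have "\<dots> = real (card K) ^ t * (\<Prod>i<t. 1 - 1 / real p ^ Suc (t - Suc i))"
    by (simp add: prod.distrib)
  also have "(\<Prod>i<t. 1 - 1 / real p ^ Suc (t - Suc i)) = (\<Prod>i<t. 1 - 1 / real p ^ Suc i)"
    by (rule prod.nat_diff_reindex)
  finally show ?thesis .
qed

text \<open>
  Homomorphisms with a fixed default value outside the carrier.  Without this restriction every
  homomorphism would be counted once for each of its extensions to the whole type.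
\<close>

definition ext_hom :: "('a, 'c) monoid_scheme \<Rightarrow> ('b, 'd) monoid_scheme \<Rightarrow> ('a \<Rightarrow> 'b) set" where
  "ext_hom V G = hom V G \<inter> extensional (carrier V)"

lemma finite_ext_hom:
  assumes "finite (carrier V)" "finite (carrier G)"
  shows "finite (ext_hom V G)"
proof (rule finite_subset)
  show "ext_hom V G \<subseteq> carrier V \<rightarrow>\<^sub>E carrier G"
    by (auto simp: ext_hom_def hom_def PiE_def)
  show "finite (carrier V \<rightarrow>\<^sub>E carrier G)"
    using assms by (intro finite_PiE) auto
qed

text \<open>
  Two surjections with the same kernel differ by a unique automorphism of the target.
\<close>

lemma card_surjections_same_kernel:
  assumes V: "group V" and G: "group G" and f: "f \<in> hom V G" "f ` carrier V = carrier G"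
  shows "card {g \<in> ext_hom V G. g ` carrier V = carrier G \<and> kernel V G g = kernel V G f} = card (auto G)"
proof -
  interpret V: group V by fact
  interpret G: group G by fact
  interpret f: group_hom V G f
    using f by unfold_locales
  have fV: "f x \<in> carrier G" if "x \<in> carrier V" for x
    using that f by auto
  have ker: "h x = h y \<longleftrightarrow> x \<otimes>\<^bsub>V\<^esub> inv\<^bsub>V\<^esub> y \<in> kernel V G h"
    if "h \<in> hom V G" "x \<in> carrier V" "y \<in> carrier V" for h x y
  proof -
    interpret h: group_hom V G h
      using that by unfold_locales
    show ?thesis
      using that by (auto simp: kernel_def G.inv_solve_right')
  qed
  let ?S = "{g \<in> ext_hom V G. g ` carrier V = carrier G \<and> kernel V G g = kernel V G f}"
  have "bij_betw (\<lambda>b. \<lambda>x\<in>carrier V. b (f x)) (auto G) ?S"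
    unfolding bij_betw_def
  proof
    show "inj_on (\<lambda>b. \<lambda>x\<in>carrier V. b (f x)) (auto G)"
    proof (rule inj_onI)
      fix a b assume a: "a \<in> auto G" and b: "b \<in> auto G"
        and eq: "(\<lambda>x\<in>carrier V. a (f x)) = (\<lambda>x\<in>carrier V. b (f x))"
      show "a = b"
      proof (rule extensionalityI[of _ "carrier G"])
        show "a \<in> extensional (carrier G)" "b \<in> extensional (carrier G)"
          using a b by (auto simp: auto_def Bij_def)
        fix y assume "y \<in> carrier G"
        then obtain x where "x \<in> carrier V" "y = f x"
          using f by auto
        then show "a y = b y"
          using fun_cong[OF eq, of x] by simp
      qed
    qed
    show "(\<lambda>b. \<lambda>x\<in>carrier V. b (f x)) ` auto G = ?S"
    proof (rule antisym; rule subsetI)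
      fix g assume "g \<in> (\<lambda>b. \<lambda>x\<in>carrier V. b (f x)) ` auto G"
      then obtain b where b: "b \<in> hom G G" "bij_betw b (carrier G) (carrier G)"
        and g: "g = (\<lambda>x\<in>carrier V. b (f x))"
        by (auto simp: auto_def Bij_def)
      interpret b: group_hom G G b
        using b by unfold_locales
      have "g \<in> hom V G"
        unfolding g using f b fV by (intro homI) auto
      moreover have "g ` carrier V = carrier G"
        unfolding g using f b by (auto simp: bij_betw_def image_image[symmetric])
      moreover have "b y = \<one>\<^bsub>G\<^esub> \<longleftrightarrow> y = \<one>\<^bsub>G\<^esub>" if "y \<in> carrier G" for y
        using b that b.hom_one by (metis G.one_closed bij_betw_def inj_on_eq_iff)
      then have "kernel V G g = kernel V G f"
        unfolding g kernel_def using fV by auto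
      ultimately show "g \<in> ?S"
        unfolding g ext_hom_def by auto
    next
      fix g assume "g \<in> ?S"
      then have g: "g \<in> hom V G" "g \<in> extensional (carrier V)" "g ` carrier V = carrier G"
        "kernel V G g = kernel V G f"
        by (auto simp: ext_hom_def)
      have gV: "g x \<in> carrier G" if "x \<in> carrier V" for x
        using that g by auto
      have fg: "g x = g y \<longleftrightarrow> f x = f y" if "x \<in> carrier V" "y \<in> carrier V" for x y
        using ker[OF g(1) that] ker[OF f(1) that] g by simp
      define s where "s = inv_into (carrier V) f"
      have s: "s y \<in> carrier V" "f (s y) = y" if "y \<in> carrier G" for y
        using that f unfolding s_def by (auto intro: inv_into_into f_inv_into_f)
      define b where "b = (\<lambda>y\<in>carrier G. g (s y))"
      have bf: "b (f x) = g x" if "x \<in> carrier V" for x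
        using that fV s fg unfolding b_def by auto
      have bhom: "b \<in> hom G G"
      proof (rule homI)
        show "b y \<in> carrier G" if "y \<in> carrier G" for y
          using that s gV unfolding b_def by auto
        fix y z assume yz: "y \<in> carrier G" "z \<in> carrier G"
        have "b (y \<otimes>\<^bsub>G\<^esub> z) = b (f (s y \<otimes>\<^bsub>V\<^esub> s z))"
          using s yz by simp
        also have "\<dots> = g (s y) \<otimes>\<^bsub>G\<^esub> g (s z)"
          using s yz hom_mult[OF g(1), of "s y" "s z"] bf[of "s y \<otimes>\<^bsub>V\<^esub> s z"] by (simp del: f.hom_mult)
        finally show "b (y \<otimes>\<^bsub>G\<^esub> z) = b y \<otimes>\<^bsub>G\<^esub> b z"
          using yz by (simp add: b_def)
      qed
      moreover have "bij_betw b (carrier G) (carrier G)"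
      proof (rule bij_betw_imageI)
        show "inj_on b (carrier G)"
          using s fg unfolding b_def inj_on_def by (metis (no_types, lifting) restrict_apply')
        have "b ` f ` carrier V = g ` carrier V"
          unfolding image_image using bf by (rule image_cong[OF refl])
        then show "b ` carrier G = carrier G"
          using f g by simp
      qed
      ultimately have "b \<in> auto G"
        by (auto simp: auto_def Bij_def b_def)
      moreover have "g = (\<lambda>x\<in>carrier V. b (f x))"
        using g bf by (auto intro!: extensionalityI[of _ "carrier V"])
      ultimately show "g \<in> (\<lambda>b. \<lambda>x\<in>carrier V. b (f x)) ` auto G"
        by blast
    qed
  qed
  then show ?thesis
    by (simp add: bij_betw_same_card)
qed

text \<open>
  Here \<open>cs\<close> and \<open>fs\<close> together behave like a basis.  A homomorphism is determined by its values on
  them, and by the assumed lower bound there are as many homomorphisms as families of values, so that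
  every family of values occurs.  Prescribing the value 1 on \<open>cs\<close> leaves the values on \<open>fs\<close> free.
\<close>

lemma card_ext_hom_vanishing:
  assumes V: "comm_group V" and G: "comm_group G" and fin: "finite (carrier V)" "finite (carrier G)"
    and bs: "set cs \<union> set fs \<subseteq> carrier V" "generate V (set cs \<union> set fs) = carrier V"
    and ge: "card (carrier G) ^ (length cs + length fs) \<le> card (ext_hom V G)"
  shows "card {h \<in> ext_hom V G. h ` carrier V = carrier G \<and> (\<forall>c\<in>set cs. h c = \<one>\<^bsub>G\<^esub>)} =
    card {gs. length gs = length fs \<and> set gs \<subseteq> carrier G \<and> generate G (set gs) = carrier G}"
proof -
  interpret V: comm_group V by fact
  interpret G: comm_group G by fact
  let ?b = "cs @ fs"
  let ?L = "{gs. set gs \<subseteq> carrier G \<and> length gs = length ?b}"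
  have inj: "inj_on (\<lambda>h. map h ?b) (ext_hom V G)"
  proof (rule inj_onI)
    fix h k assume hk: "h \<in> ext_hom V G" "k \<in> ext_hom V G" "map h ?b = map k ?b"
    then have h: "h \<in> hom V G" "k \<in> hom V G" "\<And>x. x \<in> set cs \<union> set fs \<Longrightarrow> h x = k x"
      by (auto simp: ext_hom_def)
    interpret h: group_hom V G h using h by unfold_locales
    interpret k: group_hom V G k using h by unfold_locales
    have "h x = k x" if "x \<in> generate V (set cs \<union> set fs)" for x
      using that
    proof (induction rule: generate.induct)
      case (eng x y)
      then show ?case
        using V.generate_in_carrier[OF bs(1)] by simp
    next
      case (inv x)
      then have "x \<in> carrier V" using bs by auto
      then show ?case using h(3)[OF inv] by simp
    qed (use h in auto)
    then show "h = k"
      using hk unfolding bs(2) ext_hom_def by (auto intro: extensionalityI)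
  qed
  \<comment> \<open>Evaluation is injective into a set that is not larger than its domain.\<close>
  have img: "(\<lambda>h. map h ?b) ` ext_hom V G = ?L"
  proof (rule card_seteq)
    show "finite ?L"
      using finite_lists_length_eq[OF fin(2)] .
    show "(\<lambda>h. map h ?b) ` ext_hom V G \<subseteq> ?L"
      using bs(1) by (auto simp: ext_hom_def hom_def Pi_def subset_iff)
    show "card ?L \<le> card ((\<lambda>h. map h ?b) ` ext_hom V G)"
      using ge unfolding card_image[OF inj] card_lists_length_eq[OF fin(2)] by simp
  qed
  have surj_iff: "h ` carrier V = carrier G \<longleftrightarrow> generate G (set (map h fs)) = carrier G"
    if h: "h \<in> ext_hom V G" "\<forall>c\<in>set cs. h c = \<one>\<^bsub>G\<^esub>" for h
  proof -
    interpret h: group_hom V G h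
      using h by unfold_locales (auto simp: ext_hom_def)
    have "h ` carrier V = generate G (h ` (set cs \<union> set fs))"
      using h.generate_img[of "set cs \<union> set fs"] bs by simp
    also have "\<dots> = generate G (set (map h fs))"
    proof (rule antisym)
      have hf: "h ` set fs \<subseteq> carrier G"
        using bs by auto
      show "generate G (h ` (set cs \<union> set fs)) \<subseteq> generate G (set (map h fs))"
        using h hf by (intro G.generate_subgroup_incl G.generate_is_subgroup)
          (auto intro: generate.one generate.incl)
      show "generate G (set (map h fs)) \<subseteq> generate G (h ` (set cs \<union> set fs))"
        by (rule G.mono_generate) auto
    qed
    finally show ?thesis by simp
  qed
  let ?A = "{h \<in> ext_hom V G. h ` carrier V = carrier G \<and> (\<forall>c\<in>set cs. h c = \<one>\<^bsub>G\<^esub>)}"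
  have "bij_betw (\<lambda>h. map h fs) ?A
    {gs. length gs = length fs \<and> set gs \<subseteq> carrier G \<and> generate G (set gs) = carrier G}"
  proof (rule bij_betw_imageI)
    show "inj_on (\<lambda>h. map h fs) ?A"
    proof (rule inj_onI)
      fix h k assume "h \<in> ?A" "k \<in> ?A" "map h fs = map k fs"
      then show "h = k"
        by (intro inj_onD[OF inj]) auto
    qed
    show "(\<lambda>h. map h fs) ` ?A =
      {gs. length gs = length fs \<and> set gs \<subseteq> carrier G \<and> generate G (set gs) = carrier G}"
    proof (rule antisym; rule subsetI)
      fix gs assume "gs \<in> (\<lambda>h. map h fs) ` ?A"
      then show "gs \<in> {gs. length gs = length fs \<and> set gs \<subseteq> carrier G \<and> generate G (set gs) = carrier G}"
        using surj_iff bs(1) by (auto simp: ext_hom_def hom_def Pi_def subset_iff)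
    next
      fix gs assume gs: "gs \<in> {gs. length gs = length fs \<and> set gs \<subseteq> carrier G \<and> generate G (set gs) = carrier G}"
      then have "replicate (length cs) \<one>\<^bsub>G\<^esub> @ gs \<in> ?L"
        by (auto split: if_splits)
      then obtain h where h: "h \<in> ext_hom V G" "map h ?b = replicate (length cs) \<one>\<^bsub>G\<^esub> @ gs"
        unfolding img[symmetric] by auto
      then have "map h cs = replicate (length cs) \<one>\<^bsub>G\<^esub>" and hf: "map h fs = gs"
        by auto
      then have "\<forall>c\<in>set cs. h c = \<one>\<^bsub>G\<^esub>"
        by (metis in_set_replicate list.set_map image_eqI)
      then have "h \<in> ?A"
        using h gs surj_iff[of h] hf by auto
      then show "gs \<in> (\<lambda>h. map h fs) ` ?A"
        using hf by blast
    qed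
  qed
  then show ?thesis
    by (rule bij_betw_same_card)
qed

lemma card_carrier_eq_kernel:
  assumes V: "group V" and G: "group G" and h: "h \<in> hom V G" "h ` carrier V = carrier G"
    and fin: "finite (carrier V)"
  shows "card (carrier V) = card (carrier G) * card (kernel V G h)"
proof -
  interpret V: group V by fact
  interpret h: group_hom V G h
    using assms by (simp add: group_hom_def group_hom_axioms_def)
  have "card (carrier (V Mod kernel V G h)) = card (carrier G)"
    using h.FactGroup_iso_set[OF h(2)] by (auto simp: iso_def dest: bij_betw_same_card)
  then show ?thesis
    using V.lagrange_finite[OF fin h.subgroup_kernel] by (simp add: FactGroup_def order_def)
qed

text \<open>
  Double counting of the pairs of a list \<open>ds\<close> and a surjection \<open>h\<close> onto \<open>G\<close> such that \<open>cs\<close> and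
  \<open>ds\<close> generate the kernel of \<open>h\<close>.  A list with quotient isomorphic to \<open>G\<close> occurs in as many pairs
  as \<open>G\<close> has automorphisms.  A surjection occurs only if it vanishes on \<open>cs\<close>, and then as often as
  \<open>cs\<close> can be completed to a generating list of its kernel.
\<close>

lemma card_completions_with_given_quotient:
  assumes V: "comm_group V" and G: "comm_group G" and fin: "finite (carrier V)" "finite (carrier G)"
    and p: "Factorial_Ring.prime (p :: nat)"
    and exp: "\<And>x. x \<in> carrier V \<Longrightarrow> x [^]\<^bsub>V\<^esub> (p ^ m) = \<one>\<^bsub>V\<^esub>"
    and cs: "set cs \<subseteq> carrier V" "indep_over V ((\<lambda>x. x [^]\<^bsub>V\<^esub> p) ` carrier V) cs"
    and cardV: "card (carrier V) = p ^ (length cs + t) * card ((\<lambda>x. x [^]\<^bsub>V\<^esub> p) ` carrier V)"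
    and homs: "card (carrier G) ^ (length cs + t) \<le> card (ext_hom V G)"
    and ker: "\<And>h. h \<in> hom V G \<Longrightarrow>
      card (kernel V G h) = p ^ (length cs + t) * card ((\<lambda>x. x [^]\<^bsub>V\<^esub> p) ` kernel V G h)"
  shows "real (card (auto G) * card {ds. length ds = t \<and> set ds \<subseteq> carrier V \<and>
      V Mod generate V (set cs \<union> set ds) \<cong> G}) =
    real (card {gs. length gs = t \<and> set gs \<subseteq> carrier G \<and> generate G (set gs) = carrier G}) *
      (real (card (carrier V)) / real (card (carrier G))) ^ t * (\<Prod>i<t. 1 - 1 / real p ^ Suc i)"
proof -
  interpret V: comm_group V by fact
  interpret G: comm_group G by fact
  let ?L = "{ds. length ds = t \<and> set ds \<subseteq> carrier V}"
  let ?S = "{h \<in> ext_hom V G. h ` carrier V = carrier G \<and> (\<forall>c\<in>set cs. h c = \<one>\<^bsub>G\<^esub>)}"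
  let ?H = "{h \<in> ext_hom V G. h ` carrier V = carrier G}"
  define c where "c = (real (card (carrier V)) / real (card (carrier G))) ^ t * (\<Prod>i<t. 1 - 1 / real p ^ Suc i)"
  have finL: "finite ?L"
    using finite_lists_length_eq[OF fin(1), of t] by (simp add: conj_commute)
  have finH: "finite ?H"
    using finite_ext_hom[OF fin] by simp
  have Gpos: "card (carrier G) > 0"
    using fin G.one_closed by (auto simp: card_gt_0_iff)
  \<comment> \<open>The count of completions, applied to the whole group, is positive: \<open>cs\<close> extends to a generating list.\<close>
  obtain fs where fs: "length fs = t" "set fs \<subseteq> carrier V" "generate V (set cs \<union> set fs) = carrier V"
  proof -
    have "real (card {ds. length ds = t \<and> set ds \<subseteq> carrier V \<and> generate V (set cs \<union> set ds) = carrier V}) =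
        real (card (carrier V)) ^ t * (\<Prod>i<t. 1 - 1 / real p ^ Suc i)"
      by (rule V.card_generating_completions[OF p V.subgroup_self fin(1) exp cs cardV])
    also have "\<dots> > 0"
    proof (intro mult_pos_pos prod_pos zero_less_power)
      show "0 < real (card (carrier V))"
        using fin V.one_closed by (auto simp: card_gt_0_iff)
      show "0 < 1 - 1 / real p ^ Suc i" for i
        using prime_gt_1_nat[OF p] one_less_power[of "real p" "Suc i"] by (simp del: power_Suc)
    qed
    finally have "{ds. length ds = t \<and> set ds \<subseteq> carrier V \<and> generate V (set cs \<union> set ds) = carrier V} \<noteq> {}"
      by (metis card.empty less_irrefl of_nat_0)
    then show ?thesis
      using that by blast
  qed
  have cardS: "card ?S = card {gs. length gs = t \<and> set gs \<subseteq> carrier G \<and> generate G (set gs) = carrier G}"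
    using card_ext_hom_vanishing[OF V G fin, of cs fs] fs cs homs by auto
  \<comment> \<open>The constant \<open>c\<close> counts the completions of \<open>cs\<close> in one kernel, whose order is \<open>|V| / |G|\<close>.\<close>
  have fibre: "real (card {ds \<in> ?L. generate V (set cs \<union> set ds) = kernel V G h}) = (if h \<in> ?S then c else 0)"
    if h: "h \<in> ?H" for h
  proof -
    interpret h: group_hom V G h
      using h by unfold_locales (auto simp: ext_hom_def)
    have hh: "h \<in> hom V G" "h ` carrier V = carrier G"
      using h by (auto simp: ext_hom_def)
    let ?K = "kernel V G h"
    have K: "subgroup ?K V"
      by (rule h.subgroup_kernel)
    have finK: "finite ?K"
      using K fin subgroup.subset finite_subset by metis
    show ?thesis
    proof (cases "h \<in> ?S")
      case True
      then have csK: "set cs \<subseteq> ?K"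
        using cs by (auto simp: kernel_def)
      have "indep_over V ((\<lambda>x. x [^]\<^bsub>V\<^esub> p) ` ?K) cs"
        using subgroup.subset[OF K] by (intro V.indep_over_mono[OF cs(2)] image_mono)
      moreover have "x [^]\<^bsub>V\<^esub> (p ^ m) = \<one>\<^bsub>V\<^esub>" if "x \<in> ?K" for x
        using exp subgroup.mem_carrier[OF K that] .
      ultimately have "real (card {ds. length ds = t \<and> set ds \<subseteq> carrier V \<and> generate V (set cs \<union> set ds) = ?K}) =
          real (card ?K) ^ t * (\<Prod>i<t. 1 - 1 / real p ^ Suc i)"
        by (intro V.card_generating_completions[OF p K finK _ csK] ker hh) auto
      moreover have "real (card ?K) = real (card (carrier V)) / real (card (carrier G))"
        using card_carrier_eq_kernel[OF V.is_group G.is_group hh fin(1)] Gpos by simp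
      ultimately show ?thesis
        using True by (simp add: c_def conj_assoc)
    next
      case False
      then obtain x where x: "x \<in> set cs" "x \<notin> ?K"
        using h by (auto simp: kernel_def)
      then have "{ds \<in> ?L. generate V (set cs \<union> set ds) = ?K} = {}"
        by (auto intro: generate.incl)
      then show ?thesis
        using False by (simp only: card.empty if_False)
    qed
  qed
  \<comment> \<open>The lists whose quotient is \<open>G\<close> have fibres of size \<open>|Aut G|\<close>, all other fibres are empty.\<close>
  have auts: "card {h \<in> ?H. generate V (set cs \<union> set ds) = kernel V G h} =
      (if V Mod generate V (set cs \<union> set ds) \<cong> G then card (auto G) else 0)"
    if ds: "ds \<in> ?L" for ds
  proof -
    let ?D = "generate V (set cs \<union> set ds)"
    have D: "subgroup ?D V"
      using cs ds by (intro V.generate_is_subgroup) auto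
    interpret D: normal ?D V
      using D by (rule V.subgroup_imp_normal)
    show ?thesis
    proof (cases "V Mod ?D \<cong> G")
      case True
      then obtain f where f: "f \<in> iso (V Mod ?D) G"
        by (auto simp: is_iso_def)
      let ?g = "\<lambda>x. f (?D #>\<^bsub>V\<^esub> x)"
      have q: "(\<lambda>x. ?D #>\<^bsub>V\<^esub> x) \<in> hom V (V Mod ?D)"
        by (rule D.r_coset_hom_Mod)
      have "f \<in> hom (V Mod ?D) G" and bij: "bij_betw f (carrier (V Mod ?D)) (carrier G)"
        using f by (auto simp: iso_def)
      interpret f: group_hom "V Mod ?D" G f
        using \<open>f \<in> hom (V Mod ?D) G\<close> D.factorgroup_is_group
        by (simp add: group_hom_def group_hom_axioms_def)
      have g: "?g \<in> hom V G"
        using hom_compose[OF q f.homh] by (simp add: comp_def)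
      have gs: "?g ` carrier V = carrier G"
        using bij unfolding bij_betw_def carrier_FactGroup image_image by simp
      have kg: "kernel V G ?g = ?D"
      proof -
        have "?g x = \<one>\<^bsub>G\<^esub> \<longleftrightarrow> x \<in> ?D" if x: "x \<in> carrier V" for x
        proof -
          have "?D #>\<^bsub>V\<^esub> x \<in> carrier (V Mod ?D)" "\<one>\<^bsub>V Mod ?D\<^esub> \<in> carrier (V Mod ?D)"
            using x f.G.one_closed by (auto simp: carrier_FactGroup)
          then have "?g x = \<one>\<^bsub>G\<^esub> \<longleftrightarrow> ?D #>\<^bsub>V\<^esub> x = \<one>\<^bsub>V Mod ?D\<^esub>"
            using bij f.hom_one unfolding bij_betw_def by (metis inj_on_eq_iff)
          also have "\<dots> \<longleftrightarrow> x \<in> ?D"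
            unfolding one_FactGroup using V.coset_join1[OF _ x D] V.coset_join2[OF x D] by blast
          finally show ?thesis .
        qed
        then show ?thesis
          using D.subset by (auto simp: kernel_def)
      qed
      have "{h \<in> ?H. ?D = kernel V G h} = {h \<in> ext_hom V G. h ` carrier V = carrier G \<and> kernel V G h = kernel V G ?g}"
        unfolding kg by auto
      then show ?thesis
        using card_surjections_same_kernel[OF V.is_group G.is_group g gs] True by simp
    next
      case False
      have "V Mod ?D \<cong> G" if h: "h \<in> ?H" "?D = kernel V G h" for h
      proof -
        interpret h: group_hom V G h
          using h by unfold_locales (auto simp: ext_hom_def)
        show ?thesis
          using h.FactGroup_iso h by simp
      qed
      then have "{h \<in> ?H. ?D = kernel V G h} = {}"
        using False by blast
      then show ?thesis
        using False by (simp only: card.empty if_False)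
    qed
  qed
  have "(\<Sum>ds\<in>?L. card {h \<in> ?H. generate V (set cs \<union> set ds) = kernel V G h}) =
      (\<Sum>h\<in>?H. card {ds \<in> ?L. generate V (set cs \<union> set ds) = kernel V G h})"
    by (rule sum_multicount_gen[OF finL finH]) auto
  also have "(\<Sum>ds\<in>?L. card {h \<in> ?H. generate V (set cs \<union> set ds) = kernel V G h}) =
      (\<Sum>ds\<in>?L. if V Mod generate V (set cs \<union> set ds) \<cong> G then card (auto G) else 0)"
    by (rule sum.cong[OF refl auts])
  also have "\<dots> = card {ds \<in> ?L. V Mod generate V (set cs \<union> set ds) \<cong> G} * card (auto G)"
    using finL by (simp add: sum.If_cases Int_def)
  finally have "real (card (auto G) * card {ds \<in> ?L. V Mod generate V (set cs \<union> set ds) \<cong> G}) =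
      (\<Sum>h\<in>?H. real (card {ds \<in> ?L. generate V (set cs \<union> set ds) = kernel V G h}))"
    by (simp add: mult.commute flip: of_nat_sum)
  also have "\<dots> = (\<Sum>h\<in>?H. if h \<in> ?S then c else 0)"
    by (rule sum.cong[OF refl fibre])
  also have "\<dots> = real (card (?H \<inter> ?S)) * c"
    by (simp only: sum.inter_restrict[OF finH, symmetric] sum_constant)
  also have "?H \<inter> ?S = ?S"
    by auto
  finally show ?thesis
    unfolding cardS c_def by (simp add: conj_assoc mult.assoc)
qed

section \<open>Free modules over the integers modulo a prime power\<close>

definition residue_group :: "nat \<Rightarrow> nat \<Rightarrow> (nat \<Rightarrow> int) monoid" where
  "residue_group q n = product_group {..<n} (\<lambda>_. integer_mod_group q)"

definition coord_subgroup :: "nat \<Rightarrow> nat \<Rightarrow> nat \<Rightarrow> (nat \<Rightarrow> int) set" where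
  "coord_subgroup q n h = (\<Pi>\<^sub>E i\<in>{..<n}. if i < h then {0..<int q} else {0})"

lemma carrier_residue_group: "q > 0 \<Longrightarrow> carrier (residue_group q n) = {..<n} \<rightarrow>\<^sub>E {0..<int q}"
  by (simp add: residue_group_def carrier_integer_mod_group)

lemma residue_group_simps:
  "x \<otimes>\<^bsub>residue_group q n\<^esub> y = (\<lambda>i\<in>{..<n}. (x i + y i) mod int q)"
  "\<one>\<^bsub>residue_group q n\<^esub> = (\<lambda>i\<in>{..<n}. 0)"
  by (simp_all add: residue_group_def)

lemma comm_group_residue_group: "comm_group (residue_group q n)"
proof -
  have "group (residue_group q n)"
    unfolding residue_group_def by (rule product_group) simp
  then show ?thesis
    by (rule group.group_comm_groupI) (simp add: residue_group_simps add.commute)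
qed

lemma finite_residue_group: "q > 0 \<Longrightarrow> finite (carrier (residue_group q n))"
  by (auto simp: carrier_residue_group intro!: finite_PiE)

lemma residue_group_nat_pow:
  "x \<in> carrier (residue_group q n) \<Longrightarrow> q > 0 \<Longrightarrow>
    x [^]\<^bsub>residue_group q n\<^esub> (k :: nat) = (\<lambda>i\<in>{..<n}. (int k * x i) mod int q)"
proof (induction k)
  case 0
  then show ?case by (simp add: residue_group_simps)
next
  case (Suc k)
  then show ?case
    by (auto simp: residue_group_simps fun_eq_iff mod_simps algebra_simps)
qed

lemma coord_subgroup_full: "q > 0 \<Longrightarrow> coord_subgroup q n n = carrier (residue_group q n)"
  by (auto simp: coord_subgroup_def carrier_residue_group intro!: PiE_cong)

lemma subgroup_coord_subgroup:
  assumes "q > 0"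
  shows "subgroup (coord_subgroup q n h) (residue_group q n)"
proof -
  have "subgroup {0..<int q} (integer_mod_group q)"
    using group.subgroup_self[OF group_integer_mod_group[of q]] assms by (simp add: carrier_integer_mod_group)
  moreover have "subgroup {0} (integer_mod_group q)"
    using group.triv_subgroup[OF group_integer_mod_group[of q]] by simp
  ultimately show ?thesis
    unfolding coord_subgroup_def residue_group_def
    by (subst PiE_subgroup_product_group) auto
qed

lemma card_PiE_supported:
  assumes "h \<le> n"
  shows "card (\<Pi>\<^sub>E i\<in>{..<n}. if i < h then A else {0}) = card A ^ h"
proof -
  have "card (\<Pi>\<^sub>E i\<in>{..<n}. if i < h then A else {0}) = (\<Prod>i<n. if i < h then card A else 1)"
    by (subst card_PiE) (auto intro!: prod.cong)
  also have "\<dots> = (\<Prod>i\<in>{..<n} \<inter> {..<h}. card A)"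
    using prod.inter_restrict[of "{..<n}" "\<lambda>_. card A" "{..<h}"] by simp
  also have "{..<n} \<inter> {..<h} = {..<h}"
    using assms by auto
  finally show ?thesis by simp
qed

lemma card_coord_subgroup: "h \<le> n \<Longrightarrow> card (coord_subgroup q n h) = q ^ h"
  unfolding coord_subgroup_def by (simp add: card_PiE_supported)

lemma pow_image_coord_subgroup:
  fixes p e n h :: nat
  assumes p: "p > 0"
  defines "V \<equiv> residue_group (p ^ Suc e) n"
  shows "(\<lambda>x. x [^]\<^bsub>V\<^esub> p) ` coord_subgroup (p ^ Suc e) n h =
    (\<Pi>\<^sub>E i\<in>{..<n}. if i < h then (*) (int p) ` {0..<int (p ^ e)} else {0})"
proof (rule antisym; rule subsetI)
  have q: "p ^ Suc e > 0" using p by simp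
  have cV: "x \<in> coord_subgroup (p ^ Suc e) n h \<Longrightarrow> x \<in> carrier V" for x
    using subgroup.mem_carrier[OF subgroup_coord_subgroup[OF q]] unfolding V_def by blast
  have mod: "(int p * a) mod int (p ^ Suc e) = int p * (a mod int (p ^ e))" for a
    by simp
  have pow: "x [^]\<^bsub>V\<^esub> p = (\<lambda>i\<in>{..<n}. int p * (x i mod int (p ^ e)))"
    if "x \<in> coord_subgroup (p ^ Suc e) n h" for x
    using residue_group_nat_pow[OF cV[OF that, unfolded V_def] q, of p] unfolding mod V_def .
  show "y \<in> (\<Pi>\<^sub>E i\<in>{..<n}. if i < h then (*) (int p) ` {0..<int (p ^ e)} else {0})"
    if "y \<in> (\<lambda>x. x [^]\<^bsub>V\<^esub> p) ` coord_subgroup (p ^ Suc e) n h" for y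
  proof -
    from that obtain x where x: "x \<in> coord_subgroup (p ^ Suc e) n h" "y = x [^]\<^bsub>V\<^esub> p"
      by auto
    then have "x i = 0" if "i < n" "\<not> i < h" for i
      using that by (auto simp: coord_subgroup_def PiE_def Pi_def)
    then show ?thesis
      unfolding x(2) pow[OF x(1)] using p by (auto simp: PiE_def Pi_def)
  qed
  show "y \<in> (\<lambda>x. x [^]\<^bsub>V\<^esub> p) ` coord_subgroup (p ^ Suc e) n h"
    if y: "y \<in> (\<Pi>\<^sub>E i\<in>{..<n}. if i < h then (*) (int p) ` {0..<int (p ^ e)} else {0})" for y
  proof -
    define x where "x = (\<lambda>i\<in>{..<n}. y i div int p)"
    have yi: "\<exists>a. y i = int p * a \<and> 0 \<le> a \<and> a < int (p ^ e) \<and> (\<not> i < h \<longrightarrow> a = 0)" if "i < n" for i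
    proof (cases "i < h")
      case True
      then show ?thesis using y that by (force simp: PiE_def Pi_def)
    next
      case False
      then show ?thesis using y that p by (force simp: PiE_def Pi_def)
    qed
    have le: "int (p ^ e) \<le> int (p ^ Suc e)"
      using p by simp
    have x: "x \<in> coord_subgroup (p ^ Suc e) n h"
      unfolding coord_subgroup_def
    proof (rule PiE_I)
      fix i assume "i \<in> {..<n}"
      then show "x i \<in> (if i < h then {0..<int (p ^ Suc e)} else {0})"
        using yi[of i] le p by (auto simp: x_def simp del: power_Suc of_nat_power)
    qed (simp add: x_def)
    moreover have "y = x [^]\<^bsub>V\<^esub> p"
      unfolding pow[OF x]
    proof (rule extensionalityI[of _ "{..<n}"])
      show "y i = (\<lambda>i\<in>{..<n}. int p * (x i mod int (p ^ e))) i" if "i \<in> {..<n}" for i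
        using that yi[of i] p by (auto simp: x_def)
    qed (use y in \<open>auto simp: PiE_def\<close>)
    ultimately show ?thesis by blast
  qed
qed

lemma card_pow_image_coord_subgroup:
  assumes "p > 0" "h \<le> n"
  shows "card ((\<lambda>x. x [^]\<^bsub>residue_group (p ^ Suc e) n\<^esub> p) ` coord_subgroup (p ^ Suc e) n h) = (p ^ e) ^ h"
proof -
  have "card ((*) (int p) ` {0..<int (p ^ e)}) = p ^ e"
    using assms by (subst card_image) (auto simp: inj_on_def simp del: of_nat_power)
  then show ?thesis
    unfolding pow_image_coord_subgroup[OF assms(1)] using assms by (simp add: card_PiE_supported)
qed

text \<open>
  A \<open>p\<close>-th power that is supported on the first \<open>h\<close> coordinates is the \<open>p\<close>-th power of an element
  with that support.
\<close>

lemma pow_image_Int_coord_subgroup: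
  assumes p: "p > 0"
  shows "(\<lambda>x. x [^]\<^bsub>residue_group (p ^ Suc e) n\<^esub> p) ` carrier (residue_group (p ^ Suc e) n) \<inter> coord_subgroup (p ^ Suc e) n h =
    (\<lambda>x. x [^]\<^bsub>residue_group (p ^ Suc e) n\<^esub> p) ` coord_subgroup (p ^ Suc e) n h"
proof -
  have "(*) (int p) ` {0..<int (p ^ e)} \<subseteq> {0..<int (p ^ Suc e)}"
    using p by auto
  moreover have "0 \<in> (*) (int p) ` {0..<int (p ^ e)}"
    using p by (auto intro!: image_eqI[of _ _ 0])
  ultimately have "(\<Pi>\<^sub>E i\<in>{..<n}. if i < n then (*) (int p) ` {0..<int (p ^ e)} else {0}) \<inter>
      coord_subgroup (p ^ Suc e) n h = (\<Pi>\<^sub>E i\<in>{..<n}. if i < h then (*) (int p) ` {0..<int (p ^ e)} else {0})"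
    unfolding coord_subgroup_def PiE_Int by (intro PiE_cong) auto
  then show ?thesis
    unfolding coord_subgroup_full[OF zero_less_power[OF p], symmetric] pow_image_coord_subgroup[OF p] .
qed

text \<open>
  The \<open>p\<close>-th power map sends a subgroup \<open>K\<close> onto its \<open>p\<close>-th powers, and its kernel is the
  \<open>p\<close>-torsion of \<open>K\<close>.  In the group of vectors modulo \<open>p ^ (e + 1)\<close> the \<open>p\<close>-torsion has order
  \<open>p ^ n\<close> and consists of \<open>p ^ e\<close>-th powers, so that a homomorphism into a group of exponent
  \<open>p ^ e\<close> kills all of it.  This is the reason to work modulo \<open>p ^ (e + 1)\<close> and not modulo \<open>p ^ e\<close>.
  It also takes the place of the fact that a submodule of finite index of a free module over the
  \<open>p\<close>-adic integers is free of the same rank.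
\<close>

lemma card_kernel_eq_card_pow_image:
  fixes p e n :: nat
  assumes p: "p > 0" 
  defines "V \<equiv> residue_group (p ^ Suc e) n"
  assumes G: "group G" and exp: "\<And>g. g \<in> carrier G \<Longrightarrow> g [^]\<^bsub>G\<^esub> (p ^ e) = \<one>\<^bsub>G\<^esub>"
    and h: "h \<in> hom V G"
  shows "card (kernel V G h) = p ^ n * card ((\<lambda>x. x [^]\<^bsub>V\<^esub> p) ` kernel V G h)"
proof -
  have q: "p ^ Suc e > 0" using p by simp
  interpret V: comm_group V
    unfolding V_def by (rule comm_group_residue_group)
  have fin: "finite (carrier V)"
    unfolding V_def by (rule finite_residue_group[OF q])
  define T where "T = {x \<in> carrier V. x [^]\<^bsub>V\<^esub> p = \<one>\<^bsub>V\<^esub>}"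
  \<comment> \<open>The subgroup \<open>T\<close> is the \<open>p\<close>-torsion; its order is found by taking the whole group for \<open>K\<close>.\<close>
  have gen: "card K = card T * card ((\<lambda>x. x [^]\<^bsub>V\<^esub> p) ` K)" if K: "subgroup K V" "T \<subseteq> K" for K
  proof -
    have KV: "K \<subseteq> carrier V"
      using K subgroup.subset by blast
    let ?P = "(\<lambda>x. x [^]\<^bsub>V\<^esub> p) ` K"
    have P: "subgroup ?P V"
      by (rule V.subgroup_pow_image[OF K(1)])
    have "(\<lambda>x. x [^]\<^bsub>V\<^esub> p) \<in> hom (V\<lparr>carrier := K\<rparr>) (V\<lparr>carrier := ?P\<rparr>)"
      using KV by (intro homI) (auto simp: V.nat_pow_distrib subset_iff)
    then have "card (carrier (V\<lparr>carrier := K\<rparr>)) = card (carrier (V\<lparr>carrier := ?P\<rparr>)) *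
        card (kernel (V\<lparr>carrier := K\<rparr>) (V\<lparr>carrier := ?P\<rparr>) (\<lambda>x. x [^]\<^bsub>V\<^esub> p))"
      using fin KV finite_subset
      by (intro card_carrier_eq_kernel subgroup.subgroup_is_group[OF K(1) V.is_group]
          subgroup.subgroup_is_group[OF P V.is_group]) auto
    moreover have "kernel (V\<lparr>carrier := K\<rparr>) (V\<lparr>carrier := ?P\<rparr>) (\<lambda>x. x [^]\<^bsub>V\<^esub> p) = T"
      using K KV by (auto simp: kernel_def T_def)
    ultimately show ?thesis by simp
  qed
  have "(p ^ Suc e) ^ n = card T * (p ^ e) ^ n"
    using gen[OF V.subgroup_self] card_pow_image_coord_subgroup[of p n n e] card_coord_subgroup[of n n "p ^ Suc e"] p
    unfolding V_def T_def coord_subgroup_full[OF q] by auto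
  then have T: "card T = p ^ n"
    using p by (simp add: power_mult_distrib)
  interpret h: group_hom V G h
    using h G V.is_group by (simp add: group_hom_def group_hom_axioms_def)
  have "T \<subseteq> kernel V G h"
  proof
    fix x assume x: "x \<in> T"
    then have xV: "x \<in> carrier V" by (simp add: T_def)
    define w where "w = (\<lambda>i\<in>{..<n}. x i div int (p ^ e))"
    have xi: "x i = int (p ^ e) * w i" "0 \<le> w i" "w i < int (p ^ Suc e)" if i: "i < n" for i
    proof -
      have xr: "0 \<le> x i" "x i < int (p ^ Suc e)"
        using xV i unfolding V_def carrier_residue_group[OF q] by (auto simp: PiE_def Pi_def)
      have "(int p * x i) mod int (p ^ Suc e) = 0"
        using x i residue_group_nat_pow[OF xV[unfolded V_def] q, of p]
        unfolding T_def V_def residue_group_simps(2) by (auto dest: fun_cong[of _ _ i])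
      then have "int p * int (p ^ e) dvd int p * x i"
        by (simp add: mod_eq_0_iff_dvd)
      then have "int (p ^ e) dvd x i"
        using p by simp
      then show 1: "x i = int (p ^ e) * w i"
        using i by (simp add: w_def)
      show "0 \<le> w i"
        using xr i by (simp add: w_def pos_imp_zdiv_nonneg_iff p)
      have "w i \<le> x i"
        unfolding 1 using \<open>0 \<le> w i\<close> p
        by (metis mult_le_cancel_right1 mult.commute of_nat_0_less_iff int_one_le_iff_zero_less zero_less_power not_less)
      then show "w i < int (p ^ Suc e)"
        using xr by linarith
    qed
    have wV: "w \<in> carrier V"
      unfolding V_def carrier_residue_group[OF q] using xi by (auto simp: w_def)
    have "w [^]\<^bsub>V\<^esub> (p ^ e) = x"
      unfolding V_def residue_group_nat_pow[OF wV[unfolded V_def] q]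
    proof (rule extensionalityI[of _ "{..<n}"])
      show "x \<in> extensional {..<n}"
        using xV unfolding V_def carrier_residue_group[OF q] by (auto simp: PiE_def)
      fix i assume i: "i \<in> {..<n}"
      have "x i mod int (p ^ Suc e) = x i"
        using xV i unfolding V_def carrier_residue_group[OF q] by (auto simp: PiE_def Pi_def)
      then show "(\<lambda>i\<in>{..<n}. int (p ^ e) * w i mod int (p ^ Suc e)) i = x i"
        using i xi(1)[of i] by simp
    qed simp
    then have "h x = h w [^]\<^bsub>G\<^esub> (p ^ e)"
      using wV by (metis h.hom_nat_pow)
    then show "x \<in> kernel V G h"
      using xV wV exp by (simp add: kernel_def)
  qed
  from gen[OF h.subgroup_kernel this] show ?thesis
    by (simp add: T)
qed

text \<open>
  Every family of \<open>n\<close> elements of \<open>G\<close> consists of the images of the unit vectors under a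
  homomorphism, because exponents in \<open>G\<close> matter only modulo \<open>q\<close>.
\<close>

lemma card_ext_hom_residue_group:
  assumes G: "comm_group G" and fin: "finite (carrier G)"
    and q: "q > 1" and exp: "\<And>g. g \<in> carrier G \<Longrightarrow> g [^]\<^bsub>G\<^esub> q = \<one>\<^bsub>G\<^esub>"
  shows "card (carrier G) ^ n \<le> card (ext_hom (residue_group q n) G)"
proof -
  interpret G: comm_group G by fact
  define V where "V = residue_group q n"
  have q0: "q > 0" using q by simp
  note V = carrier_residue_group[OF q0, of n, folded V_def]
  interpret V: comm_group V
    unfolding V_def by (rule comm_group_residue_group)
  define F where "F g = (\<lambda>v\<in>carrier V. finprod G (\<lambda>i. g i [^]\<^bsub>G\<^esub> (v i :: int)) {..<n})" for g
  have gc: "g i \<in> carrier G" if "g \<in> {..<n} \<rightarrow>\<^sub>E carrier G" "i < n" for g i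
    using that by (auto simp: PiE_def Pi_def)
  have pm: "x [^]\<^bsub>G\<^esub> (a mod int q) = x [^]\<^bsub>G\<^esub> a" if "x \<in> carrier G" for x and a :: int
  proof -
    have "x [^]\<^bsub>G\<^esub> a = x [^]\<^bsub>G\<^esub> (int q * (a div int q)) \<otimes>\<^bsub>G\<^esub> x [^]\<^bsub>G\<^esub> (a mod int q)"
      using that by (simp add: G.int_pow_mult[symmetric])
    also have "x [^]\<^bsub>G\<^esub> (int q * (a div int q)) = (x [^]\<^bsub>G\<^esub> (int q)) [^]\<^bsub>G\<^esub> (a div int q)"
      using that by (simp add: G.int_pow_pow)
    also have "x [^]\<^bsub>G\<^esub> (int q) = \<one>\<^bsub>G\<^esub>"
      using exp[OF that] by (simp add: int_pow_int)
    finally show ?thesis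
      using that by simp
  qed
  have hom: "F g \<in> ext_hom V G" if g: "g \<in> {..<n} \<rightarrow>\<^sub>E carrier G" for g
  proof -
    have c: "(\<lambda>i. g i [^]\<^bsub>G\<^esub> (v i :: int)) \<in> {..<n} \<rightarrow> carrier G" for v
      using gc[OF g] by auto
    have "F g \<in> hom V G"
    proof (rule homI)
      show "F g v \<in> carrier G" if "v \<in> carrier V" for v
        using that c by (simp add: F_def)
      fix v w assume vw: "v \<in> carrier V" "w \<in> carrier V"
      have "F g (v \<otimes>\<^bsub>V\<^esub> w) = finprod G (\<lambda>i. g i [^]\<^bsub>G\<^esub> v i \<otimes>\<^bsub>G\<^esub> g i [^]\<^bsub>G\<^esub> w i) {..<n}"
      proof -
        have "F g (v \<otimes>\<^bsub>V\<^esub> w) = finprod G (\<lambda>i. g i [^]\<^bsub>G\<^esub> ((v \<otimes>\<^bsub>V\<^esub> w) i)) {..<n}"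
          using vw by (simp add: F_def)
        also have "\<dots> = finprod G (\<lambda>i. g i [^]\<^bsub>G\<^esub> v i \<otimes>\<^bsub>G\<^esub> g i [^]\<^bsub>G\<^esub> w i) {..<n}"
          using gc[OF g] by (intro G.finprod_cong') (auto simp: V_def residue_group_simps pm G.int_pow_mult)
        finally show ?thesis .
      qed
      also have "\<dots> = F g v \<otimes>\<^bsub>G\<^esub> F g w"
        using vw c by (simp add: F_def G.finprod_multf)
      finally show "F g (v \<otimes>\<^bsub>V\<^esub> w) = F g v \<otimes>\<^bsub>G\<^esub> F g w" .
    qed
    then show ?thesis
      by (simp add: ext_hom_def F_def)
  qed
  have unit: "F g (\<lambda>j\<in>{..<n}. if j = i then 1 else 0) = g i"
    if g: "g \<in> {..<n} \<rightarrow>\<^sub>E carrier G" and i: "i < n" for g i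
  proof -
    have "(\<lambda>j\<in>{..<n}. if j = i then 1 else 0) \<in> carrier V"
      unfolding V using q by auto
    then have "F g (\<lambda>j\<in>{..<n}. if j = i then 1 else 0) = finprod G (\<lambda>j. if i = j then g j else \<one>\<^bsub>G\<^esub>) {..<n}"
      using gc[OF g] unfolding F_def by (auto intro!: G.finprod_cong' simp: G.int_pow_1)
    also have "\<dots> = g i"
      using gc[OF g] i by (subst G.finprod_singleton) auto
    finally show ?thesis .
  qed
  have "inj_on F ({..<n} \<rightarrow>\<^sub>E carrier G)"
  proof (rule inj_onI)
    fix g k assume gk: "g \<in> {..<n} \<rightarrow>\<^sub>E carrier G" "k \<in> {..<n} \<rightarrow>\<^sub>E carrier G" "F g = F k"
    show "g = k"
      using gk unit by (intro PiE_ext[OF gk(1,2)]) (metis lessThan_iff)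
  qed
  moreover have "F ` ({..<n} \<rightarrow>\<^sub>E carrier G) \<subseteq> ext_hom V G"
    using hom by auto
  moreover have "finite (ext_hom V G)"
    unfolding V_def by (intro finite_ext_hom finite_residue_group q0 fin)
  ultimately have "card ({..<n} \<rightarrow>\<^sub>E carrier G) \<le> card (ext_hom V G)"
    by (rule card_inj_on_le)
  then show ?thesis
    by (simp add: card_PiE V_def)
qed

text \<open>
  If the entries before position \<open>i\<close> are independent modulo \<open>p\<close>, they generate, together with the
  \<open>p\<close>-th powers, a subgroup that meets the \<open>i\<close>-th coordinate subgroup in a fraction
  \<open>p ^ i / p ^ h i\<close> of its elements.  This uses that the heights never decrease, so that the earlier
  entries lie in the coordinate subgroup, and the modular law.
\<close>

lemma card_staircase_indep:
  fixes p e n r :: nat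
  assumes p: "Factorial_Ring.prime p"
    and h: "\<And>i. i < r \<Longrightarrow> h i \<le> n" "\<And>i j. i \<le> j \<Longrightarrow> j < r \<Longrightarrow> h i \<le> h j"
      "\<And>i. i < r \<Longrightarrow> i \<le> h i"
  defines "V \<equiv> residue_group (p ^ Suc e) n"
  shows "real (card {cs. length cs = r \<and> (\<forall>i<r. cs ! i \<in> coord_subgroup (p ^ Suc e) n (h i)) \<and>
      indep_over V ((\<lambda>x. x [^]\<^bsub>V\<^esub> p) ` carrier V) cs}) =
    (\<Prod>i<r. real (card (coord_subgroup (p ^ Suc e) n (h i))) * (1 - 1 / real p ^ (h i - i)))"
proof -
  have p0: "p > 0" and q: "p ^ Suc e > 0"
    using prime_gt_0_nat[OF p] by auto
  interpret V: comm_group V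
    unfolding V_def by (rule comm_group_residue_group)
  have fin: "finite (carrier V)"
    unfolding V_def by (rule finite_residue_group[OF q])
  let ?W = "coord_subgroup (p ^ Suc e) n"
  let ?P = "(\<lambda>x. x [^]\<^bsub>V\<^esub> p) ` carrier V"
  have W: "subgroup (?W k) V" for k
    unfolding V_def by (rule subgroup_coord_subgroup[OF q])
  have WV: "?W k \<subseteq> carrier V" for k
    using W subgroup.subset by blast
  have Wmono: "?W k \<subseteq> ?W l" if "k \<le> l" for k l
    unfolding coord_subgroup_def using that q by (intro PiE_mono) auto
  have P: "subgroup ?P V"
    by (rule V.subgroup_pow_image[OF V.subgroup_self])
  have PW: "?P \<inter> ?W k = (\<lambda>x. x [^]\<^bsub>V\<^esub> p) ` ?W k" for k
    unfolding V_def by (rule pow_image_Int_coord_subgroup[OF p0])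
  let ?B = "\<lambda>i cs. ?W (h i) - generate V (?P \<union> set cs)"
  let ?m = "\<lambda>i. card (?W (h i)) - p ^ i * card ((\<lambda>x. x [^]\<^bsub>V\<^esub> p) ` ?W (h i))"
  have eq: "((\<forall>i<k. cs ! i \<in> ?W (h i)) \<and> indep_over V ?P cs) = (\<forall>j<k. cs ! j \<in> ?B j (take j cs))"
    if "length cs = k" for cs k
    using that by (auto simp: indep_over_def)
  have B: "finite (?B i cs) \<and> card (?B i cs) = ?m i"
    if i: "i < r" "length cs = i" "\<forall>j<i. cs ! j \<in> ?B j (take j cs)" for i cs
  proof -
    have cs: "\<forall>j<i. cs ! j \<in> ?W (h j)" "indep_over V ?P cs"
      using eq[OF i(2)] i(3) by auto
    have csW: "set cs \<subseteq> ?W (h i)"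
    proof
      fix c assume "c \<in> set cs"
      then obtain j where j: "j < i" "c = cs ! j"
        using i by (auto simp: in_set_conv_nth)
      then show "c \<in> ?W (h i)"
        using cs Wmono[OF h(2)[of j i]] i by auto
    qed
    let ?Q = "(\<lambda>x. x [^]\<^bsub>V\<^esub> p) ` ?W (h i)"
    have Q: "subgroup ?Q V"
      by (rule V.subgroup_pow_image[OF W])
    have finW: "finite (?W (h i))"
      using WV fin finite_subset by blast
    have "?W (h i) \<inter> generate V (?P \<union> set cs) = generate V (?Q \<union> set cs)"
      using V.generate_Un_Int[OF P W csW] unfolding PW .
    moreover have "card (generate V (?Q \<union> set cs)) = p ^ i * card ?Q"
    proof -
      have "indep_over V ?Q cs"
        using V.indep_over_mono[OF cs(2)] PW[of "h i"] by blast
      then show ?thesis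
        using V.card_generate_Un_indep[OF Q _ p, of cs] csW WV[of "h i"] finW i by auto
    qed
    moreover have "card (?B i cs) = card (?W (h i)) - card (?W (h i) \<inter> generate V (?P \<union> set cs))"
      using finW by (simp add: card_Diff_subset_Int)
    ultimately show ?thesis
      using finW by simp
  qed
  have "{cs. length cs = r \<and> (\<forall>i<r. cs ! i \<in> ?W (h i)) \<and> indep_over V ?P cs} =
      {cs. length cs = r \<and> (\<forall>j<r. cs ! j \<in> ?B j (take j cs))}"
    using eq by blast
  then have count: "card {cs. length cs = r \<and> (\<forall>i<r. cs ! i \<in> ?W (h i)) \<and> indep_over V ?P cs} = (\<Prod>i<r. ?m i)"
    using card_dependent_lists[of r ?B ?m] B by simp
  have "real (\<Prod>i<r. ?m i) = (\<Prod>i<r. real (card (?W (h i))) * (1 - 1 / real p ^ (h i - i)))"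
    unfolding of_nat_prod
  proof (rule prod.cong[OF refl])
    fix i assume "i \<in> {..<r}"
    then have i: "i < r" by simp
    have c: "card ((\<lambda>x. x [^]\<^bsub>V\<^esub> p) ` ?W (h i)) = (p ^ e) ^ h i"
      unfolding V_def by (rule card_pow_image_coord_subgroup[OF p0 h(1)[OF i]])
    have hi: "h i = i + (h i - i)"
      using h(3)[OF i] by simp
    have d: "card (?W (h i)) = p ^ h i * (p ^ e) ^ h i"
      using card_coord_subgroup[OF h(1)[OF i]] by (simp add: power_mult_distrib)
    have le: "p ^ i * (p ^ e) ^ h i \<le> p ^ h i * (p ^ e) ^ h i"
      using h(3)[OF i] p0 by (intro mult_right_mono power_increasing) auto
    have "real p ^ h i = real p ^ i * real p ^ (h i - i)"
      by (subst hi) (simp only: power_add)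
    then show "real (?m i) = real (card (?W (h i))) * (1 - 1 / real p ^ (h i - i))"
      unfolding c d of_nat_diff[OF le] using p0 by (simp add: field_simps)
  qed
  then show ?thesis
    unfolding count .
qed

section \<open>Residues of p-adic integers\<close>

lemma padic_residue_mem:
  "0 \<le> padic_residue (x :: 'p :: prime_card padic_int) k" "padic_residue x k < int CARD('p) ^ k"
  using padic_residue[of x] by auto

lemma padic_residue_mod:
  "padic_residue (x :: 'p :: prime_card padic_int) (k + j) mod int CARD('p) ^ k = padic_residue x k"
proof (induction j)
  case 0
  show ?case
    using padic_residue_mem[of x k] by simp
next
  case (Suc j)
  have "padic_residue x (Suc (k + j)) mod int CARD('p) ^ (k + j) = padic_residue x (k + j)"
    using padic_residue[of x] by auto
  then have "padic_residue x (k + j) mod int CARD('p) ^ k = padic_residue x (Suc (k + j)) mod int CARD('p) ^ k"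
    by (metis le_add1 le_imp_power_dvd mod_mod_cancel)
  then show ?case
    using Suc by simp
qed

lemma padic_residue_of_nat:
  "padic_residue (of_nat m :: 'p :: prime_card padic_int) k = int m mod int CARD('p) ^ k"
  by (induction m) (simp_all add: zero_padic_int.rep_eq plus_padic_int.rep_eq one_padic_int.rep_eq mod_simps)

lemma padic_residue_eq_0_iff:
  "padic_residue (x :: 'p :: prime_card padic_int) k = 0 \<longleftrightarrow> (\<exists>z. x = of_nat (CARD('p) ^ k) * z)"
proof
  let ?p = "int CARD('p)"
  have p: "?p > 0" by (rule CARD_prime_pos)
  assume x0: "padic_residue x k = 0"
  \<comment> \<open>The quotient by \<open>p ^ k\<close> is known modulo \<open>p ^ j\<close> once \<open>x\<close> is known modulo \<open>p ^ (k + j)\<close>.\<close>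
  define z where "z j = padic_residue x (k + j) div ?p ^ k" for j
  have xz: "padic_residue x (k + j) = ?p ^ k * z j" for j
    using padic_residue_mod[of x k j] x0 by (auto simp: z_def)
  have z: "z \<in> {x. \<forall>k. x k \<in> {0..<?p ^ k} \<and> x (Suc k) mod ?p ^ k = x k}"
  proof (intro CollectI allI conjI)
    fix j
    have "0 \<le> ?p ^ k * z j" "?p ^ k * z j < ?p ^ k * ?p ^ j"
      using padic_residue_mem[of x "k + j"] unfolding xz by (auto simp: power_add)
    then show "z j \<in> {0..<?p ^ j}"
      using zero_less_power[OF p, of k] by (simp add: zero_le_mult_iff)
    have "(?p ^ k * z (Suc j)) mod (?p ^ k * ?p ^ j) = ?p ^ k * z j"
      using padic_residue_mod[of x "k + j" 1] xz[of "Suc j"] xz[of j] by (simp add: power_add)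
    then show "z (Suc j) mod ?p ^ j = z j"
      using p by simp
  qed
  have "padic_residue x j = padic_residue (of_nat (CARD('p) ^ k) * Abs_padic_int z :: 'p padic_int) j" for j
  proof -
    have "padic_residue (of_nat (CARD('p) ^ k) * Abs_padic_int z :: 'p padic_int) j = (?p ^ k * z j) mod ?p ^ j"
      unfolding times_padic_int.rep_eq padic_residue_of_nat Abs_padic_int_inverse[OF z]
      by (simp add: mod_simps)
    also have "\<dots> = padic_residue x (j + k) mod ?p ^ j"
      using xz[of j] by (simp add: add.commute)
    finally show ?thesis
      by (simp add: padic_residue_mod)
  qed
  then show "\<exists>z. x = of_nat (CARD('p) ^ k) * z"
    by (metis ext padic_residue_inject)
qed (auto simp: times_padic_int.rep_eq padic_residue_of_nat simp del: of_nat_power of_nat_simps, simp)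

lemma padic_residue_of_int:
  "padic_residue (of_int a :: 'p :: prime_card padic_int) k = a mod int CARD('p) ^ k"
  by (cases a rule: int_cases2) (simp_all add: padic_residue_of_nat uminus_padic_int.rep_eq mod_simps)

lemma padic_reduce_eq: "padic_reduce (x :: 'p :: prime_card padic_int) = of_int_mod_ring (padic_residue x 1)"
proof (transfer, goal_cases)
  case (1 x)
  then have "x 1 \<in> {0..<int CARD('p) ^ 1}" by blast
  then show ?case by simp
qed

lemma comm_ring_hom_padic_reduce: "comm_ring_hom (padic_reduce :: 'p :: prime_card padic_int \<Rightarrow> 'p mod_ring)"
proof
  fix x y :: "'p padic_int"
  show "padic_reduce (x + y) = padic_reduce x + padic_reduce y"
    by transfer simp
  show "padic_reduce (x * y) = padic_reduce x * padic_reduce y"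
    by transfer simp
  show "padic_reduce (0 :: 'p padic_int) = 0"
    by transfer simp
  show "padic_reduce (1 :: 'p padic_int) = 1"
    using prime_gt_1_nat[OF prime_card[where 'a = 'p]] by transfer simp
qed

text \<open>
  The inverses modulo the powers of \<open>p\<close> are unique, hence compatible.
\<close>

lemma padic_unit:
  assumes "padic_reduce (x :: 'p :: prime_card padic_int) \<noteq> 0"
  shows "\<exists>y. x * y = 1"
proof -
  let ?p = "int CARD('p)"
  have p: "?p > 1" "Factorial_Ring.prime ?p"
    using prime_gt_1_nat[OF prime_card[where 'a = 'p]] prime_card[where 'a = 'p] by auto
  have x1: "padic_residue x 1 \<noteq> 0"
    using assms by (auto simp: padic_reduce_eq)
  have cop: "coprime (padic_residue x k) (?p ^ k)" for k
  proof (cases k)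
    case (Suc j)
    have "padic_residue x (1 + j) mod ?p \<noteq> 0"
      using padic_residue_mod[of x 1 j] x1 by simp
    then have "coprime ?p (padic_residue x k)"
      using p Suc by (intro prime_imp_coprime) auto
    then show ?thesis
      by (simp add: coprime_commute)
  qed simp
  define y where "y k = fst (bezout_coefficients (padic_residue x k) (?p ^ k)) mod ?p ^ k" for k
  have xy: "[padic_residue x k * y k = 1] (mod ?p ^ k)" for k
  proof -
    let ?c = "bezout_coefficients (padic_residue x k) (?p ^ k)"
    have "fst ?c * padic_residue x k + snd ?c * ?p ^ k = 1"
      using bezout_coefficients_fst_snd[of "padic_residue x k" "?p ^ k"] cop[of k] by simp
    then have "(padic_residue x k * fst ?c) mod ?p ^ k = 1 mod ?p ^ k"
      by (metis mod_mult_self1 mult.commute add.commute)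
    then show ?thesis
      by (simp add: y_def cong_def mod_simps)
  qed
  have y: "y \<in> {x. \<forall>k. x k \<in> {0..<?p ^ k} \<and> x (Suc k) mod ?p ^ k = x k}"
  proof (intro CollectI allI conjI)
    fix k
    show "y k \<in> {0..<?p ^ k}"
      using p by (simp add: y_def)
    have "[padic_residue x (Suc k) = padic_residue x k] (mod ?p ^ k)"
      using padic_residue_mod[of x k 1] padic_residue_mod[of x k 0] by (simp add: cong_def)
    moreover have "[padic_residue x (Suc k) * y (Suc k) = 1] (mod ?p ^ k)"
      using xy[of "Suc k"] by (rule cong_dvd_modulus) simp
    ultimately have "[padic_residue x k * y (Suc k) = padic_residue x k * y k] (mod ?p ^ k)"
      using xy[of k] by (meson cong_scalar_right cong_sym cong_trans)
    then have "[y (Suc k) = y k] (mod ?p ^ k)"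
      using cop[of k] cong_mult_lcancel by blast
    then show "y (Suc k) mod ?p ^ k = y k"
      by (simp add: cong_def y_def)
  qed
  have "x * Abs_padic_int y = 1"
    using xy by (auto simp: padic_residue_inject[symmetric] fun_eq_iff times_padic_int.rep_eq
        one_padic_int.rep_eq Abs_padic_int_inverse[OF y] cong_def)
  then show ?thesis by blast
qed

section \<open>Cokernels of p-adic matrices\<close>

text \<open>
  The subgroup by which the cokernel divides.
\<close>

definition image_mat :: "'a :: comm_ring_1 mat \<Rightarrow> 'a vec set" where
  "image_mat A = (\<lambda>v. A *\<^sub>v v) ` carrier_vec (dim_col A)"

definition vec_residue :: "nat \<Rightarrow> nat \<Rightarrow> 'p :: prime_card padic_int vec \<Rightarrow> (nat \<Rightarrow> int)" where
  "vec_residue k n v = (\<lambda>i\<in>{..<n}. padic_residue (v $ i) k)"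

lemma image_mat_I:
  assumes "A \<in> carrier_mat n n" "v \<in> carrier_vec n"
  shows "A *\<^sub>v v \<in> image_mat A"
  using assms by (auto simp: image_mat_def)

lemma cok_eq: "A \<in> carrier_mat n n \<Longrightarrow> cok A = monoid_vec TYPE('p :: prime_card padic_int) n Mod image_mat A"
  by (auto simp: cok_def image_mat_def)

lemma monoid_vec_pow:
  "v \<in> carrier_vec n \<Longrightarrow>
    v [^]\<^bsub>monoid_vec TYPE('a :: comm_ring_1) n\<^esub> (k :: nat) = of_nat k \<cdot>\<^sub>v v"
  by (induction k) (auto simp: monoid_vec_simps nat_pow_def algebra_simps intro!: eq_vecI)

lemma mult_mat_vec_smult:
  "A \<in> carrier_mat n n \<Longrightarrow> v \<in> carrier_vec n \<Longrightarrow>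
    A *\<^sub>v (c \<cdot>\<^sub>v v) = c \<cdot>\<^sub>v (A *\<^sub>v (v :: 'a :: comm_ring_1 vec))"
  by (intro eq_vecI) auto

lemma smult_image_mat:
  assumes "A \<in> carrier_mat n n" "x \<in> image_mat A"
  shows "c \<cdot>\<^sub>v x \<in> image_mat A"
proof -
  obtain v where v: "v \<in> carrier_vec n" "x = A *\<^sub>v v"
    using assms by (auto simp: image_mat_def)
  have "A *\<^sub>v (c \<cdot>\<^sub>v v) \<in> image_mat A"
    using v by (intro image_mat_I[OF assms(1)]) simp
  then show ?thesis
    unfolding v(2) using assms v(1) by (simp add: mult_mat_vec_smult)
qed

lemma subgroup_image_mat:
  assumes "A \<in> carrier_mat n n"
  shows "subgroup (image_mat A) (monoid_vec TYPE('a :: comm_ring_1) n)"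
proof -
  interpret comm_group "monoid_vec TYPE('a) n"
    by (rule comm_group_vec)
  have inv: "inv\<^bsub>monoid_vec TYPE('a) n\<^esub> v = (- 1) \<cdot>\<^sub>v v" if "v \<in> carrier_vec n" for v
    using that by (intro inv_equality) (auto simp: monoid_vec_simps)
  have sub: "image_mat A \<subseteq> carrier_vec n"
    using assms by (auto simp: image_mat_def)
  show ?thesis
  proof (rule subgroupI)
    show "image_mat A \<subseteq> carrier (monoid_vec TYPE('a) n)"
      using sub by (simp add: monoid_vec_simps)
    show "image_mat A \<noteq> {}"
      using image_mat_I[OF assms zero_carrier_vec] by blast
    show "inv\<^bsub>monoid_vec TYPE('a) n\<^esub> x \<in> image_mat A" if x: "x \<in> image_mat A" for x
      using smult_image_mat[OF assms x, of "- 1"] inv[of x] sub x by auto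
    show "x \<otimes>\<^bsub>monoid_vec TYPE('a) n\<^esub> y \<in> image_mat A" if xy: "x \<in> image_mat A" "y \<in> image_mat A" for x y
    proof -
      obtain v w where "v \<in> carrier_vec n" "x = A *\<^sub>v v" "w \<in> carrier_vec n" "y = A *\<^sub>v w"
        using xy assms by (auto simp: image_mat_def)
      then have "x \<otimes>\<^bsub>monoid_vec TYPE('a) n\<^esub> y = A *\<^sub>v (v + w)" "v + w \<in> carrier_vec n"
        using assms by (auto simp: monoid_vec_simps mult_add_distrib_mat_vec)
      then show ?thesis
        using image_mat_I[OF assms] by metis
    qed
  qed
qed

lemma vec_residue_hom:
  "vec_residue k n \<in> hom (monoid_vec TYPE('p :: prime_card padic_int) n) (residue_group (CARD('p) ^ k) n)"
proof (rule homI)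
  have q: "CARD('p) ^ k > 0"
    by simp
  show "vec_residue k n v \<in> carrier (residue_group (CARD('p) ^ k) n)" for v :: "'p padic_int vec"
    unfolding carrier_residue_group[OF q] using padic_residue_mem[where 'p = 'p] by (auto simp: vec_residue_def)
qed (auto simp: monoid_vec_simps vec_residue_def residue_group_simps plus_padic_int.rep_eq)

lemma vec_residue_surj:
  "(vec_residue k n :: 'p :: prime_card padic_int vec \<Rightarrow> _) ` carrier_vec n =
    carrier (residue_group (CARD('p) ^ k) n)"
proof (rule antisym; rule subsetI)
  have q: "CARD('p) ^ k > 0"
    by simp
  fix x assume "x \<in> carrier (residue_group (CARD('p) ^ k) n)"
  then have x: "x \<in> extensional {..<n}" "\<And>i. i < n \<Longrightarrow> 0 \<le> x i \<and> x i < int CARD('p) ^ k"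
    unfolding carrier_residue_group[OF q] by (auto simp: PiE_def Pi_def)
  define v :: "'p padic_int vec" where "v = vec n (\<lambda>i. of_int (x i))"
  have "vec_residue k n v = x"
    using x by (intro extensionalityI[of _ "{..<n}"]) (auto simp: vec_residue_def v_def padic_residue_of_int)
  moreover have "v \<in> carrier_vec n"
    by (simp add: v_def)
  ultimately show "x \<in> (vec_residue k n :: 'p padic_int vec \<Rightarrow> _) ` carrier_vec n"
    by blast
qed (use vec_residue_hom[of k n, where 'p = 'p] in \<open>auto simp: hom_def Pi_def monoid_vec_simps\<close>)

lemma vec_residue_eq_one_iff_dvd:
  assumes "v \<in> carrier_vec n"
  shows "vec_residue k n v = \<one>\<^bsub>residue_group (CARD('p) ^ k) n\<^esub> \<longleftrightarrow>
    (\<exists>w\<in>carrier_vec n. (v :: 'p :: prime_card padic_int vec) = of_nat (CARD('p) ^ k) \<cdot>\<^sub>v w)"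
proof
  assume v: "vec_residue k n v = \<one>\<^bsub>residue_group (CARD('p) ^ k) n\<^esub>"
  have "\<exists>z. v $ i = of_nat (CARD('p) ^ k) * z" if "i < n" for i
    using fun_cong[OF v, of i] that
    unfolding padic_residue_eq_0_iff[symmetric] by (simp add: vec_residue_def residue_group_simps)
  then obtain z where z: "\<And>i. i < n \<Longrightarrow> v $ i = of_nat (CARD('p) ^ k) * z i"
    by metis
  then have "v = of_nat (CARD('p) ^ k) \<cdot>\<^sub>v vec n z"
    using assms by (intro eq_vecI) auto
  then show "\<exists>w\<in>carrier_vec n. v = of_nat (CARD('p) ^ k) \<cdot>\<^sub>v w"
    by (intro bexI[of _ "vec n z"]) auto
next
  assume "\<exists>w\<in>carrier_vec n. v = of_nat (CARD('p) ^ k) \<cdot>\<^sub>v w"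
  then obtain w where w: "w \<in> carrier_vec n" "v = of_nat (CARD('p) ^ k) \<cdot>\<^sub>v w" by blast
  have "padic_residue (v $ i) k = 0" if "i < n" for i
    unfolding padic_residue_eq_0_iff using w that by auto
  then show "vec_residue k n v = \<one>\<^bsub>residue_group (CARD('p) ^ k) n\<^esub>"
    by (auto simp: vec_residue_def residue_group_simps)
qed

lemma vec_residue_smult:
  assumes "v \<in> carrier_vec n"
  shows "vec_residue k n (c \<cdot>\<^sub>v v) =
    vec_residue k n v [^]\<^bsub>residue_group (CARD('p) ^ k) n\<^esub> nat (padic_residue (c :: 'p :: prime_card padic_int) k)"
proof -
  have q: "CARD('p) ^ k > 0"
    by simp
  have "vec_residue k n v \<in> carrier (residue_group (CARD('p) ^ k) n)"
    using assms vec_residue_hom[of k n, where 'p = 'p] by (auto simp: hom_def Pi_def monoid_vec_simps)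
  from residue_group_nat_pow[OF this q, of "nat (padic_residue c k)"] show ?thesis
    using assms padic_residue_mem[of c k]
    by (simp add: vec_residue_def times_padic_int.rep_eq restrict_def fun_eq_iff)
qed

text \<open>
  The residues of \<open>A *\<^sub>v v\<close> are an integral combination of the residues of the columns, with the
  residues of the entries of \<open>v\<close> as coefficients.  The proof adds one column at a time.
\<close>

lemma vec_residue_image_mat:
  assumes A: "A \<in> carrier_mat n n"
  shows "vec_residue k n ` image_mat A =
    generate (residue_group (CARD('p) ^ k) n) (set (map (vec_residue k n) (cols (A :: 'p :: prime_card padic_int mat))))"
    (is "_ = generate ?V ?C")
proof
  let ?L = "monoid_vec TYPE('p padic_int) n"
  interpret L: comm_group ?L
    by (rule comm_group_vec)
  interpret V: comm_group ?V
    by (rule comm_group_residue_group)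
  interpret pi: group_hom ?L ?V "vec_residue k n"
    using vec_residue_hom[of k n, where 'p = 'p] by unfold_locales
  have colc: "col A j \<in> carrier_vec n" for j
    using A by (simp add: carrier_vecI)
  have C: "?C = (\<lambda>j. vec_residue k n (col A j)) ` {..<n}"
    using A by (auto simp: cols_def)
  have CV: "?C \<subseteq> carrier ?V"
    unfolding C using colc pi.hom_closed by (auto simp: monoid_vec_simps)
  have gC: "subgroup (generate ?V ?C) ?V"
    by (rule V.generate_is_subgroup[OF CV])
  show "vec_residue k n ` image_mat A \<subseteq> generate ?V ?C"
  proof
    fix y assume "y \<in> vec_residue k n ` image_mat A"
    then obtain v where v: "v \<in> carrier_vec n" "y = vec_residue k n (A *\<^sub>v v)"
      using A by (auto simp: image_mat_def)
    \<comment> \<open>The vector \<open>v\<close> cut off after its first \<open>m\<close> entries.\<close>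
    define w where "w m = vec n (\<lambda>j. if j < m then v $ j else 0)" for m
    have "vec_residue k n (A *\<^sub>v w m) \<in> generate ?V ?C" if "m \<le> n" for m
      using that
    proof (induction m)
      case 0
      have "A *\<^sub>v w 0 = 0\<^sub>v n"
        using A by (intro eq_vecI) (auto simp: w_def scalar_prod_def)
      then show ?case
        using pi.hom_one generate.one[of ?V] by (simp add: monoid_vec_simps)
    next
      case (Suc m)
      have "A *\<^sub>v w (Suc m) = A *\<^sub>v w m + v $ m \<cdot>\<^sub>v col A m"
      proof (rule eq_vecI)
        fix i assume "i < dim_vec (A *\<^sub>v w m + v $ m \<cdot>\<^sub>v col A m)"
        then have i: "i < n" using A by simp
        have "(A *\<^sub>v w (Suc m)) $ i = (\<Sum>j<n. A $$ (i, j) * (if j < Suc m then v $ j else 0))"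
          using A i by (simp add: w_def scalar_prod_def atLeast0LessThan)
        also have "\<dots> = (\<Sum>j<n. A $$ (i, j) * (if j < m then v $ j else 0) + (if j = m then v $ j * A $$ (i, j) else 0))"
          by (rule sum.cong) (auto simp: less_Suc_eq)
        also have "\<dots> = (A *\<^sub>v w m + v $ m \<cdot>\<^sub>v col A m) $ i"
          using A i Suc.prems by (simp add: w_def scalar_prod_def atLeast0LessThan sum.distrib)
        finally show "(A *\<^sub>v w (Suc m)) $ i = (A *\<^sub>v w m + v $ m \<cdot>\<^sub>v col A m) $ i" .
      qed (use A in auto)
      moreover have "A *\<^sub>v w m \<in> carrier_vec n"
        by (rule mult_mat_vec_carrier[OF A]) (simp add: w_def)
      ultimately have "vec_residue k n (A *\<^sub>v w (Suc m)) =
          vec_residue k n (A *\<^sub>v w m) \<otimes>\<^bsub>?V\<^esub> vec_residue k n (v $ m \<cdot>\<^sub>v col A m)"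
        using pi.hom_mult[of "A *\<^sub>v w m" "v $ m \<cdot>\<^sub>v col A m"] colc[of m] by (simp add: monoid_vec_simps)
      moreover have "vec_residue k n (v $ m \<cdot>\<^sub>v col A m) \<in> generate ?V ?C"
      proof -
        have "vec_residue k n (col A m) \<in> generate ?V ?C"
          using Suc.prems unfolding C by (intro generate.incl) auto
        then show ?thesis
          unfolding vec_residue_smult[OF colc] int_pow_int[symmetric]
          by (rule V.subgroup_int_pow_closed[OF gC])
      qed
      ultimately show ?case
        using Suc by (auto intro: generate.eng)
    qed
    from this[of n] have "vec_residue k n (A *\<^sub>v w n) \<in> generate ?V ?C" by simp
    moreover have "w n = v"
      using v by (intro eq_vecI) (auto simp: w_def)
    ultimately show "y \<in> generate ?V ?C"
      using v by simp
  qed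
  have "?C \<subseteq> vec_residue k n ` image_mat A"
  proof
    fix c assume "c \<in> ?C"
    then obtain j where j: "j < n" "c = vec_residue k n (col A j)"
      unfolding C by auto
    then have "col A j = A *\<^sub>v unit_vec n j"
      using A by (intro eq_vecI) auto
    then show "c \<in> vec_residue k n ` image_mat A"
      using image_mat_I[OF A, of "unit_vec n j"] j by auto
  qed
  moreover have "subgroup (vec_residue k n ` image_mat A) ?V"
    by (rule pi.subgroup_img_is_subgroup[OF subgroup_image_mat[OF A]])
  ultimately show "generate ?V ?C \<subseteq> vec_residue k n ` image_mat A"
    by (rule V.generate_subgroup_incl)
qed

lemma pow_mem_of_Mod_iso:
  assumes H: "comm_group H" and Q: "subgroup Q H" and G: "group G" and iso: "H Mod Q \<cong> G"
    and exp: "\<And>g. g \<in> carrier G \<Longrightarrow> g [^]\<^bsub>G\<^esub> (k :: nat) = \<one>\<^bsub>G\<^esub>"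
    and x: "x \<in> carrier H"
  shows "x [^]\<^bsub>H\<^esub> k \<in> Q"
proof -
  interpret H: comm_group H by fact
  interpret Q: normal Q H
    using Q by (rule H.subgroup_imp_normal)
  obtain f where f: "f \<in> hom (H Mod Q) G" "bij_betw f (carrier (H Mod Q)) (carrier G)"
    using iso by (auto simp: is_iso_def iso_def)
  interpret f: group_hom "H Mod Q" G f
    using f(1) G Q.factorgroup_is_group by (simp add: group_hom_def group_hom_axioms_def)
  let ?y = "Q #>\<^bsub>H\<^esub> x"
  have y: "?y \<in> carrier (H Mod Q)"
    using x by (auto simp: carrier_FactGroup)
  have "f (?y [^]\<^bsub>H Mod Q\<^esub> k) = f \<one>\<^bsub>H Mod Q\<^esub>"
    using f.hom_nat_pow[OF y] exp[OF f.hom_closed[OF y]] f.hom_one by simp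
  then have "?y [^]\<^bsub>H Mod Q\<^esub> k = \<one>\<^bsub>H Mod Q\<^esub>"
    using f(2) y by (metis bij_betw_def f.G.nat_pow_closed f.G.one_closed inj_on_eq_iff)
  then have "Q #>\<^bsub>H\<^esub> (x [^]\<^bsub>H\<^esub> k) = Q"
    using Q.FactGroup_pow[OF x] by simp
  then show ?thesis
    using H.coset_join1[OF _ _ Q] x by simp
qed

text \<open>
  If the image of \<open>A\<close> contains all multiples of \<open>p ^ k\<close>, then passing to residues modulo \<open>p ^ k\<close>
  divides by nothing new.
\<close>

lemma cok_iso_residue_quotient:
  fixes A :: "'p :: prime_card padic_int mat"
  assumes A: "A \<in> carrier_mat n n"
    and im: "\<And>w. w \<in> carrier_vec n \<Longrightarrow> of_nat (CARD('p) ^ k) \<cdot>\<^sub>v w \<in> image_mat A"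
  shows "cok A \<cong> residue_group (CARD('p) ^ k) n Mod
    generate (residue_group (CARD('p) ^ k) n) (set (map (vec_residue k n) (cols A)))"
proof -
  let ?L = "monoid_vec TYPE('p padic_int) n"
  let ?V = "residue_group (CARD('p) ^ k) n"
  define D where "D = generate ?V (set (map (vec_residue k n) (cols A)))"
  interpret L: comm_group ?L
    by (rule comm_group_vec)
  interpret V: comm_group ?V
    by (rule comm_group_residue_group)
  interpret pi: group_hom ?L ?V "vec_residue k n"
    using vec_residue_hom[of k n, where 'p = 'p] by unfold_locales
  have img: "vec_residue k n ` image_mat A = D"
    unfolding D_def by (rule vec_residue_image_mat[OF A])
  have imL: "image_mat A \<subseteq> carrier_vec n"
    using subgroup.subset[OF subgroup_image_mat[OF A]] by (simp add: monoid_vec_simps)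
  have sD: "subgroup D ?V"
    unfolding img[symmetric] by (rule pi.subgroup_img_is_subgroup[OF subgroup_image_mat[OF A]])
  interpret D: normal D ?V
    using sD by (rule V.subgroup_imp_normal)
  let ?h = "\<lambda>v. D #>\<^bsub>?V\<^esub> vec_residue k n v"
  have "?h \<in> hom ?L (?V Mod D)"
    using hom_compose[OF pi.homh D.r_coset_hom_Mod] by (simp add: comp_def)
  then interpret h: group_hom ?L "?V Mod D" ?h
    using D.factorgroup_is_group by (simp add: group_hom_def group_hom_axioms_def)
  have surj: "?h ` carrier ?L = carrier (?V Mod D)"
    using vec_residue_surj[of k n, where 'p = 'p] unfolding carrier_FactGroup
    by (metis image_image monoid_vec_simps(2))
  have ker: "kernel ?L (?V Mod D) ?h = image_mat A"
  proof (rule antisym; rule subsetI)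
    fix v assume "v \<in> kernel ?L (?V Mod D) ?h"
    then have v: "v \<in> carrier_vec n" "D #>\<^bsub>?V\<^esub> vec_residue k n v = D"
      by (auto simp: kernel_def monoid_vec_simps)
    have "vec_residue k n v \<in> D"
      using V.coset_join1[OF v(2) _ sD] pi.hom_closed[of v] v(1) by (simp add: monoid_vec_simps)
    then obtain u where u: "u \<in> image_mat A" "vec_residue k n v = vec_residue k n u"
      unfolding img[symmetric] by auto
    have uc: "u \<in> carrier_vec n"
      using u imL by auto
    have "vec_residue k n (v \<otimes>\<^bsub>?L\<^esub> inv\<^bsub>?L\<^esub> u) = \<one>\<^bsub>?V\<^esub>"
    proof -
      have "v \<in> carrier ?L" "u \<in> carrier ?L"
        using v uc by (simp_all add: monoid_vec_simps)
      then show ?thesis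
        using u by simp
    qed
    moreover have "v \<otimes>\<^bsub>?L\<^esub> inv\<^bsub>?L\<^esub> u \<in> carrier_vec n"
      using L.m_closed[of v "inv\<^bsub>?L\<^esub> u"] L.inv_closed[of u] v uc unfolding monoid_vec_simps(2) by blast
    ultimately obtain w where w: "w \<in> carrier_vec n" "v \<otimes>\<^bsub>?L\<^esub> inv\<^bsub>?L\<^esub> u = of_nat (CARD('p) ^ k) \<cdot>\<^sub>v w"
      using vec_residue_eq_one_iff_dvd[of "v \<otimes>\<^bsub>?L\<^esub> inv\<^bsub>?L\<^esub> u" n k] by blast
    then have "v \<otimes>\<^bsub>?L\<^esub> inv\<^bsub>?L\<^esub> u \<in> image_mat A"
      using im[OF w(1)] by simp
    then have "(v \<otimes>\<^bsub>?L\<^esub> inv\<^bsub>?L\<^esub> u) \<otimes>\<^bsub>?L\<^esub> u \<in> image_mat A"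
      using u(1) by (rule subgroup.m_closed[OF subgroup_image_mat[OF A]])
    then show "v \<in> image_mat A"
    proof -
      have "v \<in> carrier ?L" "u \<in> carrier ?L"
        using v uc by (simp_all add: monoid_vec_simps)
      then show ?thesis
        using \<open>(v \<otimes>\<^bsub>?L\<^esub> inv\<^bsub>?L\<^esub> u) \<otimes>\<^bsub>?L\<^esub> u \<in> image_mat A\<close> by (simp add: L.m_assoc)
    qed
  next
    fix v assume v: "v \<in> image_mat A"
    then have "vec_residue k n v \<in> D"
      unfolding img[symmetric] by blast
    then have "D #>\<^bsub>?V\<^esub> vec_residue k n v = D"
      using V.coset_join2[OF _ sD] D.subset by blast
    then show "v \<in> kernel ?L (?V Mod D) ?h"
      using v imL by (auto simp: kernel_def monoid_vec_simps)
  qed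
  show ?thesis
    using h.FactGroup_iso[OF surj] unfolding ker cok_eq[OF A] by (simp only: D_def)
qed

text \<open>
  Nakayama's lemma for the image of a \<open>p\<close>-adic matrix.  Applied to the unit vectors, the assumption
  says \<open>p ^ e (1 - p C) = A B\<close> for some matrices \<open>B\<close> and \<open>C\<close>.  The determinant of \<open>1 - p C\<close> is 1
  modulo \<open>p\<close>, so \<open>1 - p C\<close> is invertible and \<open>p ^ e\<close> is a right multiple of \<open>A\<close>.
\<close>

lemma padic_nakayama:
  fixes A :: "'p :: prime_card padic_int mat"
  assumes A: "A \<in> carrier_mat n n"
    and step: "\<And>w. w \<in> carrier_vec n \<Longrightarrow> \<exists>u\<in>carrier_vec n. \<exists>z\<in>carrier_vec n.
      of_nat (CARD('p) ^ e) \<cdot>\<^sub>v w = A *\<^sub>v u + of_nat (CARD('p) ^ Suc e) \<cdot>\<^sub>v z"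
    and w: "w \<in> carrier_vec n"
  shows "of_nat (CARD('p) ^ e) \<cdot>\<^sub>v w \<in> image_mat A"
proof -
  interpret padic_reduce: comm_ring_hom "padic_reduce :: 'p padic_int \<Rightarrow> 'p mod_ring"
    by (rule comm_ring_hom_padic_reduce)
  define c :: "'p padic_int" where "c = of_nat (CARD('p) ^ e)"
  define P :: "'p padic_int" where "P = of_nat CARD('p)"
  have "\<exists>u z. u \<in> carrier_vec n \<and> z \<in> carrier_vec n \<and> c \<cdot>\<^sub>v unit_vec n j = A *\<^sub>v u + (P * c) \<cdot>\<^sub>v z" for j
    using step[of "unit_vec n j"] unfolding c_def P_def by (simp add: Bex_def)
  then obtain u z where u: "\<And>j. u j \<in> carrier_vec n" "\<And>j. z j \<in> carrier_vec n"
    "\<And>j. c \<cdot>\<^sub>v unit_vec n j = A *\<^sub>v u j + (P * c) \<cdot>\<^sub>v z j"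
    by metis
  define B where "B = mat n n (\<lambda>(i, j). u j $ i)"
  define C where "C = mat n n (\<lambda>(i, j). z j $ i)"
  define D where "D = 1\<^sub>m n - P \<cdot>\<^sub>m C"
  have BC: "B \<in> carrier_mat n n" "C \<in> carrier_mat n n" "D \<in> carrier_mat n n"
    by (auto simp: B_def C_def D_def)
  have AB: "A * B = c \<cdot>\<^sub>m D"
  proof (rule eq_matI)
    fix i j assume "i < dim_row (c \<cdot>\<^sub>m D)" "j < dim_col (c \<cdot>\<^sub>m D)"
    then have ij: "i < n" "j < n"
      using BC by auto
    have "col B j = u j"
      using ij u(1)[of j] by (intro eq_vecI) (auto simp: B_def)
    then have "(A * B) $$ (i, j) = (A *\<^sub>v u j) $ i"
      using A BC ij by simp
    moreover have "(c \<cdot>\<^sub>v unit_vec n j) $ i = (A *\<^sub>v u j + (P * c) \<cdot>\<^sub>v z j) $ i"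
      using u(3) by simp
    then have "c * (if i = j then 1 else 0) = (A *\<^sub>v u j) $ i + P * c * z j $ i"
      using A ij u(1)[of j] u(2)[of j] by (simp add: unit_vec_def)
    ultimately show "(A * B) $$ (i, j) = (c \<cdot>\<^sub>m D) $$ (i, j)"
      using ij by (simp add: D_def C_def algebra_simps)
  qed (use A BC in auto)
  have "map_mat padic_reduce D = 1\<^sub>m n"
  proof (rule eq_matI)
    have "padic_reduce P = 0"
      by (simp add: padic_reduce_eq P_def padic_residue_of_nat)
    then show "map_mat padic_reduce D $$ (i, j) = 1\<^sub>m n $$ (i, j)" if "i < dim_row (1\<^sub>m n)" "j < dim_col (1\<^sub>m n)" for i j
      using that BC unfolding D_def
      by (auto simp: padic_reduce.hom_minus padic_reduce.hom_mult)
  qed (use BC in auto)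
  then have "padic_reduce (Determinant.det D) = 1"
    unfolding padic_reduce.hom_det[symmetric] by simp
  then obtain d where d: "Determinant.det D * d = 1"
    using padic_unit[of "Determinant.det D"] by auto
  have adj: "adj_mat D \<in> carrier_mat n n" "D * adj_mat D = Determinant.det D \<cdot>\<^sub>m 1\<^sub>m n"
    using adj_mat[OF BC(3)] by auto
  let ?v = "B *\<^sub>v (adj_mat D *\<^sub>v (d \<cdot>\<^sub>v w))"
  have "A *\<^sub>v ?v = (A * B) *\<^sub>v (adj_mat D *\<^sub>v (d \<cdot>\<^sub>v w))"
    using A BC adj w by (subst assoc_mult_mat_vec[of _ n n _ n]) auto
  also have "\<dots> = c \<cdot>\<^sub>v (D *\<^sub>v (adj_mat D *\<^sub>v (d \<cdot>\<^sub>v w)))"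
    unfolding AB using BC adj w by (intro eq_vecI) auto
  also have "D *\<^sub>v (adj_mat D *\<^sub>v (d \<cdot>\<^sub>v w)) = (Determinant.det D \<cdot>\<^sub>m 1\<^sub>m n) *\<^sub>v (d \<cdot>\<^sub>v w)"
    using BC adj w by (subst assoc_mult_mat_vec[of _ n n _ n, symmetric]) auto
  also have "\<dots> = Determinant.det D \<cdot>\<^sub>v (1\<^sub>m n *\<^sub>v (d \<cdot>\<^sub>v w))"
    using w by (intro eq_vecI) auto
  also have "\<dots> = w"
    using w d by (simp add: smult_smult_assoc)
  finally show ?thesis
    using image_mat_I[OF A, of ?v] adj BC w unfolding c_def by simp
qed

text \<open>
  In both directions the image of \<open>A\<close> contains the multiples of \<open>p ^ e\<close>, since \<open>p ^ e\<close> kills \<open>G\<close>: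
  directly if the cokernel is isomorphic to \<open>G\<close>, and up to multiples of \<open>p ^ (e + 1)\<close> if the quotient
  of residues is, which Nakayama's lemma repairs.  The extra factor \<open>p\<close> in the modulus is what
  makes Nakayama's lemma applicable.
\<close>

lemma cok_iso_iff_residue_quotient_iso:
  fixes A :: "'p :: prime_card padic_int mat"
  assumes A: "A \<in> carrier_mat n n" and G: "group G" and ord: "order G = CARD('p) ^ e"
  defines "V \<equiv> residue_group (CARD('p) ^ Suc e) n"
  shows "cok A \<cong> G \<longleftrightarrow> V Mod generate V (set (map (vec_residue (Suc e) n) (cols A))) \<cong> G"
proof -
  let ?L = "monoid_vec TYPE('p padic_int) n"
  let ?D = "generate V (set (map (vec_residue (Suc e) n) (cols A)))"
  interpret V: comm_group V
    unfolding V_def by (rule comm_group_residue_group)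
  interpret L: comm_group ?L
    by (rule comm_group_vec)
  interpret G: group G by fact
  interpret pi: group_hom ?L V "vec_residue (Suc e) n"
    using vec_residue_hom[of "Suc e" n, where 'p = 'p] by unfold_locales (simp add: V_def)
  have img: "vec_residue (Suc e) n ` image_mat A = ?D"
    unfolding V_def by (rule vec_residue_image_mat[OF A])
  have sD: "subgroup ?D V"
    unfolding img[symmetric] by (rule pi.subgroup_img_is_subgroup[OF subgroup_image_mat[OF A]])
  have exp: "g [^]\<^bsub>G\<^esub> (CARD('p) ^ e) = \<one>\<^bsub>G\<^esub>" if "g \<in> carrier G" for g
    using G.pow_order_eq_1[OF that] ord by simp
  have iso: "cok A \<cong> V Mod ?D"
    if im: "\<And>w. w \<in> carrier_vec n \<Longrightarrow> of_nat (CARD('p) ^ e) \<cdot>\<^sub>v w \<in> image_mat A"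
  proof -
    have "of_nat (CARD('p) ^ Suc e) \<cdot>\<^sub>v w \<in> image_mat A" if "w \<in> carrier_vec n" for w
      using smult_image_mat[OF A im[OF that], of "of_nat CARD('p)"] by (simp add: smult_smult_assoc)
    then show ?thesis
      unfolding V_def by (rule cok_iso_residue_quotient[OF A])
  qed
  show ?thesis
  proof
    assume c: "cok A \<cong> G"
    have "of_nat (CARD('p) ^ e) \<cdot>\<^sub>v w \<in> image_mat A" if "w \<in> carrier_vec n" for w
      using pow_mem_of_Mod_iso[OF comm_group_vec subgroup_image_mat[OF A] G _ exp, of w] c that
      by (simp add: cok_eq[OF A] monoid_vec_simps(2) monoid_vec_pow)
    from iso[OF this] have "cok A \<cong> V Mod ?D" .
    moreover have "group (cok A)"
      unfolding cok_eq[OF A]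
      by (intro normal.factorgroup_is_group L.subgroup_imp_normal subgroup_image_mat[OF A])
    ultimately show "V Mod ?D \<cong> G"
      using c by (meson group.iso_sym iso_trans)
  next
    assume v: "V Mod ?D \<cong> G"
    have "of_nat (CARD('p) ^ e) \<cdot>\<^sub>v w \<in> image_mat A" if w: "w \<in> carrier_vec n" for w
    proof (rule padic_nakayama[OF A _ w])
      fix w :: "'p padic_int vec" assume w: "w \<in> carrier_vec n"
      let ?w = "of_nat (CARD('p) ^ e) \<cdot>\<^sub>v w"
      have "vec_residue (Suc e) n w [^]\<^bsub>V\<^esub> (CARD('p) ^ e) \<in> ?D"
        using w by (intro pow_mem_of_Mod_iso[OF V.comm_group_axioms sD G v exp]) (auto simp: monoid_vec_simps)
      also have "vec_residue (Suc e) n w [^]\<^bsub>V\<^esub> (CARD('p) ^ e) = vec_residue (Suc e) n ?w"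
        using w pi.hom_nat_pow[of w "CARD('p) ^ e"] by (simp add: monoid_vec_simps(2) monoid_vec_pow)
      finally obtain x where x: "x \<in> image_mat A" "vec_residue (Suc e) n ?w = vec_residue (Suc e) n x"
        unfolding img[symmetric] by auto
      then obtain u where u: "u \<in> carrier_vec n" "x = A *\<^sub>v u"
        using A by (auto simp: image_mat_def)
      have xc: "x \<in> carrier_vec n"
        unfolding u using A u by simp
      have wc: "?w \<in> carrier_vec n"
        using w by simp
      have "vec_residue (Suc e) n (?w \<otimes>\<^bsub>?L\<^esub> inv\<^bsub>?L\<^esub> x) = \<one>\<^bsub>V\<^esub>"
      proof -
        have "?w \<in> carrier ?L" "x \<in> carrier ?L"
          using wc xc by (simp_all add: monoid_vec_simps)
        then show ?thesis
          using x by simp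
      qed
      moreover have dc: "?w \<otimes>\<^bsub>?L\<^esub> inv\<^bsub>?L\<^esub> x \<in> carrier_vec n"
        using L.m_closed[of ?w "inv\<^bsub>?L\<^esub> x"] L.inv_closed[of x] wc xc unfolding monoid_vec_simps(2) by blast
      ultimately obtain z where z: "z \<in> carrier_vec n"
        "?w \<otimes>\<^bsub>?L\<^esub> inv\<^bsub>?L\<^esub> x = of_nat (CARD('p) ^ Suc e) \<cdot>\<^sub>v z"
        using vec_residue_eq_one_iff_dvd[OF dc, of "Suc e"] unfolding V_def by blast
      have "?w = x \<otimes>\<^bsub>?L\<^esub> (?w \<otimes>\<^bsub>?L\<^esub> inv\<^bsub>?L\<^esub> x)"
      proof -
        have "?w \<in> carrier ?L" "x \<in> carrier ?L"
          using wc xc by (simp_all add: monoid_vec_simps)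
        then show ?thesis
          using L.m_lcomm[of x ?w "inv\<^bsub>?L\<^esub> x"] by (simp del: of_nat_power)
      qed
      then have "?w = A *\<^sub>v u + of_nat (CARD('p) ^ Suc e) \<cdot>\<^sub>v z"
        unfolding z(2) unfolding u(2) by (simp only: monoid_vec_simps(1))
      then show "\<exists>u\<in>carrier_vec n. \<exists>z\<in>carrier_vec n. ?w = A *\<^sub>v u + of_nat (CARD('p) ^ Suc e) \<cdot>\<^sub>v z"
        using u z by blast
    qed
    from iso[OF this] show "cok A \<cong> G"
      using v by (rule iso_trans)
  qed
qed

lemma det_reduce_nonzero_iff:
  fixes A :: "'p :: prime_card padic_int mat"
  assumes A: "A \<in> carrier_mat n n"
  shows "Determinant.det (map_mat padic_reduce A) \<noteq> 0 \<longleftrightarrow> image_mat A = carrier_vec n"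
proof -
  interpret padic_reduce: comm_ring_hom "padic_reduce :: 'p padic_int \<Rightarrow> 'p mod_ring"
    by (rule comm_ring_hom_padic_reduce)
  show ?thesis
  proof
    assume "Determinant.det (map_mat padic_reduce A) \<noteq> 0"
    then obtain d where d: "Determinant.det A * d = 1"
      using padic_unit[of "Determinant.det A"] by auto
    have adj: "adj_mat A \<in> carrier_mat n n" "A * adj_mat A = Determinant.det A \<cdot>\<^sub>m 1\<^sub>m n"
      using adj_mat[OF A] by auto
    have "w \<in> image_mat A" if w: "w \<in> carrier_vec n" for w
    proof -
      have "A *\<^sub>v (adj_mat A *\<^sub>v (d \<cdot>\<^sub>v w)) = (Determinant.det A \<cdot>\<^sub>m 1\<^sub>m n) *\<^sub>v (d \<cdot>\<^sub>v w)"
        using A adj w by (subst assoc_mult_mat_vec[of _ n n _ n, symmetric]) auto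
      also have "\<dots> = Determinant.det A \<cdot>\<^sub>v (1\<^sub>m n *\<^sub>v (d \<cdot>\<^sub>v w))"
        using w by (intro eq_vecI) auto
      also have "\<dots> = w"
        using w d by (simp add: smult_smult_assoc)
      finally show ?thesis
        using image_mat_I[OF A, of "adj_mat A *\<^sub>v (d \<cdot>\<^sub>v w)"] adj w by simp
    qed
    then show "image_mat A = carrier_vec n"
      using A by (auto simp: image_mat_def)
  next
    assume im: "image_mat A = carrier_vec n"
    have "\<exists>u. u \<in> carrier_vec n \<and> unit_vec n j = A *\<^sub>v u" for j
      using im A unit_vec_carrier[of n j] unfolding image_mat_def by auto
    then obtain u where u: "\<And>j. u j \<in> carrier_vec n" "\<And>j. unit_vec n j = A *\<^sub>v u j"
      by metis
    define B where "B = mat n n (\<lambda>(i, j). u j $ i)"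
    have B: "B \<in> carrier_mat n n"
      by (simp add: B_def)
    have "A * B = 1\<^sub>m n"
    proof (rule eq_matI)
      fix i j assume "i < dim_row (1\<^sub>m n)" "j < dim_col (1\<^sub>m n)"
      then have ij: "i < n" "j < n" by auto
      have "col B j = u j"
        using ij u(1)[of j] by (intro eq_vecI) (auto simp: B_def)
      then have "(A * B) $$ (i, j) = (A *\<^sub>v u j) $ i"
        using A B ij by simp
      also have "\<dots> = 1\<^sub>m n $$ (i, j)"
        using ij by (simp flip: u(2))
      finally show "(A * B) $$ (i, j) = 1\<^sub>m n $$ (i, j)" .
    qed (use A B in auto)
    then have "Determinant.det A * Determinant.det B = 1"
      using det_mult[OF A B] by simp
    then have "padic_reduce (Determinant.det A) * padic_reduce (Determinant.det B) = 1"
      by (metis padic_reduce.hom_mult padic_reduce.hom_one)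
    then show "Determinant.det (map_mat padic_reduce A) \<noteq> 0"
      by auto
  qed
qed

lemma trivial_Mod_iso_iff:
  assumes H: "comm_group H" and Q: "subgroup Q H" and G: "group G" "carrier G = {\<one>\<^bsub>G\<^esub>}"
  shows "H Mod Q \<cong> G \<longleftrightarrow> Q = carrier H"
proof -
  interpret H: comm_group H by fact
  interpret G: group G by fact
  interpret Q: normal Q H
    using Q by (rule H.subgroup_imp_normal)
  show ?thesis
  proof
    assume iso: "H Mod Q \<cong> G"
    have "x [^]\<^bsub>H\<^esub> (1 :: nat) \<in> Q" if "x \<in> carrier H" for x
      using G(2) by (intro pow_mem_of_Mod_iso[OF H Q G(1) iso _ that]) auto
    then show "Q = carrier H"
      using Q.subset by auto
  next
    assume Q': "Q = carrier H"
    have "carrier (H Mod Q) = {Q}"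
      using H.coset_join2[OF _ Q] H.one_closed unfolding carrier_FactGroup Q' by force
    then have "(\<lambda>_. \<one>\<^bsub>G\<^esub>) \<in> iso (H Mod Q) G"
      using G(2) by (auto simp: iso_def hom_def bij_betw_def)
    then show "H Mod Q \<cong> G"
      by (auto simp: is_iso_def)
  qed
qed

lemma det_reduce_nonzero_iff_cok_trivial:
  fixes A :: "'p :: prime_card padic_int mat"
  assumes A: "A \<in> carrier_mat n n" and G: "group G" "carrier G = {\<one>\<^bsub>G\<^esub>}"
  shows "Determinant.det (map_mat padic_reduce A) \<noteq> 0 \<longleftrightarrow> cok A \<cong> G"
  using trivial_Mod_iso_iff[OF comm_group_vec subgroup_image_mat[OF A] G] det_reduce_nonzero_iff[OF A]
  by (simp add: cok_eq[OF A] monoid_vec_simps)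

section \<open>Haar-random matrices modulo a power of p\<close>

text \<open>
  As the total mass is 1, the common probability \<open>r\<close> of the values is \<open>1 / card \<Omega>\<close>.
\<close>

lemma (in prob_space) prob_uniform_finite:
  assumes fin: "finite \<Omega>" and mem: "\<And>\<omega>. \<omega> \<in> space M \<Longrightarrow> f \<omega> \<in> \<Omega>"
    and ev: "\<And>c. c \<in> \<Omega> \<Longrightarrow> {\<omega> \<in> space M. f \<omega> = c} \<in> events"
    and r: "\<And>c. c \<in> \<Omega> \<Longrightarrow> prob {\<omega> \<in> space M. f \<omega> = c} = r"
  shows "{\<omega> \<in> space M. f \<omega> \<in> S} \<in> events"
    and "prob {\<omega> \<in> space M. f \<omega> \<in> S} = real (card (S \<inter> \<Omega>)) / real (card \<Omega>)"
proof -
  have un: "{\<omega> \<in> space M. f \<omega> \<in> T} = (\<Union>c\<in>T \<inter> \<Omega>. {\<omega> \<in> space M. f \<omega> = c})" for T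
    using mem by auto
  show "{\<omega> \<in> space M. f \<omega> \<in> S} \<in> events"
    unfolding un using fin ev by (intro sets.finite_UN) auto
  have p: "prob {\<omega> \<in> space M. f \<omega> \<in> T} = real (card (T \<inter> \<Omega>)) * r" for T
  proof -
    have "prob {\<omega> \<in> space M. f \<omega> \<in> T} = (\<Sum>c\<in>T \<inter> \<Omega>. prob {\<omega> \<in> space M. f \<omega> = c})"
      unfolding un using fin ev
      by (intro finite_measure_finite_Union) (auto simp: disjoint_family_on_def)
    then show ?thesis
      using r by simp
  qed
  have "{\<omega> \<in> space M. f \<omega> \<in> \<Omega>} = space M"
    using mem by auto
  then have "real (card \<Omega>) * r = 1"
    using p[of \<Omega>] prob_space by simp
  then show "prob {\<omega> \<in> space M. f \<omega> \<in> S} = real (card (S \<inter> \<Omega>)) / real (card \<Omega>)"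
    unfolding p by (metis divide_inverse inverse_unique mult.commute)
qed

lemma padic_residue_cylinder_measurable:
  "{x :: 'p :: prime_card padic_int. padic_residue x k = a} \<in> sets borel"
proof (rule borel_open)
  show "open {x :: 'p padic_int. padic_residue x k = a}"
    unfolding open_padic_int_def
  proof (intro ballI exI[of _ k] subsetI)
    fix x y :: "'p padic_int"
    assume x: "x \<in> {x. padic_residue x k = a}" and "y \<in> {y. \<exists>z. y = x + of_nat CARD('p) ^ k * z}"
    then obtain z where y: "y = x + of_nat (CARD('p) ^ k) * z"
      by auto
    have "padic_residue (of_nat (CARD('p) ^ k) * z :: 'p padic_int) k = 0"
      unfolding padic_residue_eq_0_iff by blast
    then have "padic_residue y k = padic_residue x k mod int CARD('p) ^ k"
      unfolding y plus_padic_int.rep_eq by simp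
    then show "y \<in> {x. padic_residue x k = a}"
      using x padic_residue_mem[of x k] by simp
  qed
qed

text \<open>
  The residue classes modulo \<open>p ^ k\<close> are translates of each other.
\<close>

lemma haar_random_residue:
  fixes Y :: "'w \<Rightarrow> 'p :: prime_card padic_int"
  assumes Y: "haar_random M Y" and a: "a \<in> {0..<int CARD('p) ^ k}"
  shows "measure M (Y -` {x. padic_residue x k = a} \<inter> space M) = 1 / real CARD('p) ^ k"
proof -
  define \<mu> where "\<mu> = distr M borel Y"
  have meas: "Y \<in> borel_measurable M" and haar: "haar_prob_measure \<mu>"
    using Y by (auto simp: haar_random_def \<mu>_def)
  interpret \<mu>: prob_space \<mu>
    using haar by (simp add: haar_prob_measure_def)
  have sp: "space \<mu> = UNIV" "sets \<mu> = sets borel"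
    by (simp_all add: \<mu>_def)
  let ?B = "\<lambda>a. {x :: 'p padic_int. padic_residue x k = a}"
  have eq: "measure \<mu> (?B a) = measure \<mu> (?B 0)" if a: "a \<in> {0..<int CARD('p) ^ k}" for a
  proof -
    have "?B a = (+) (of_int a) ` ?B 0"
    proof (rule antisym; rule subsetI)
      fix x assume "x \<in> ?B a"
      then have "x - of_int a \<in> ?B 0"
        by (simp add: minus_padic_int.rep_eq padic_residue_of_int mod_simps)
      then show "x \<in> (+) (of_int a) ` ?B 0"
        by (intro image_eqI[of _ _ "x - of_int a"]) auto
    next
      fix x assume "x \<in> (+) (of_int a) ` ?B 0"
      then show "x \<in> ?B a"
        using a by (auto simp: plus_padic_int.rep_eq padic_residue_of_int)
    qed
    then show ?thesis
      using haar padic_residue_cylinder_measurable[of k 0, where 'p = 'p]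
      by (simp add: haar_prob_measure_def measure_def)
  qed
  have "\<mu>.prob {x \<in> space \<mu>. padic_residue x k \<in> {a}} =
      real (card ({a} \<inter> {0..<int CARD('p) ^ k})) / real (card {0..<int CARD('p) ^ k})"
  proof (rule \<mu>.prob_uniform_finite(2))
    show "padic_residue x k \<in> {0..<int CARD('p) ^ k}" for x :: "'p padic_int"
      using padic_residue_mem[of x k] by simp
    show "{x \<in> space \<mu>. padic_residue x k = c} \<in> \<mu>.events" for c
      using padic_residue_cylinder_measurable[of k c, where 'p = 'p] by (simp add: sp)
    show "\<mu>.prob {x \<in> space \<mu>. padic_residue x k = c} = measure \<mu> (?B 0)"
      if "c \<in> {0..<int CARD('p) ^ k}" for c
      using eq[OF that] by (simp add: sp)
  qed simp
  also have "{a} \<inter> {0..<int CARD('p) ^ k} = {a}"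
    using a by auto
  finally have "measure \<mu> (?B a) = 1 / real CARD('p) ^ k"
    by (simp add: sp nat_power_eq)
  then show ?thesis
    unfolding \<mu>_def using measure_distr[OF meas padic_residue_cylinder_measurable] by simp
qed

definition residue_columns :: "nat \<Rightarrow> nat \<Rightarrow> 'p :: prime_card padic_int mat \<Rightarrow> (nat \<Rightarrow> int) list" where
  "residue_columns k n A = map (vec_residue k n) (cols A)"

text \<open>
  The lists of columns modulo \<open>q\<close> that respect the staircase.  With columns numbered from 0, column
  \<open>j\<close> has height \<open>t + j\<close> until this exceeds \<open>n\<close>, and height \<open>n\<close> from \<open>j = n - t\<close> on.
\<close>

definition stair_lists :: "nat \<Rightarrow> nat \<Rightarrow> nat \<Rightarrow> (nat \<Rightarrow> int) list set" where
  "stair_lists q n t = {cs. length cs = n \<and> (\<forall>j<n. cs ! j \<in> coord_subgroup q n (min (t + j) n))}"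

lemma mem_stair_support_iff:
  assumes "T n = t" "t \<le> n" "i < n" "j < n"
  shows "Suc i \<in> stair_support T n (Suc j) \<longleftrightarrow> i < min (t + j) n"
  using assms by (auto simp: stair_support_def)

text \<open>
  By independence each list has the same probability, namely \<open>1 / q\<close> to the number of cells of the
  staircase.
\<close>

lemma residue_columns_uniform:
  fixes X :: "'w \<Rightarrow> 'p :: prime_card padic_int mat"
  assumes M: "prob_space M" and X: "haar_random_matrix_on M n (stair_support T n) X"
    and T: "T n = t" and t: "1 \<le> t" "t \<le> n"
  shows "\<omega> \<in> space M \<Longrightarrow> residue_columns k n (X \<omega>) \<in> stair_lists (CARD('p) ^ k) n t"
    and "{\<omega> \<in> space M. residue_columns k n (X \<omega>) \<in> S} \<in> sets M"
    and "measure M {\<omega> \<in> space M. residue_columns k n (X \<omega>) \<in> S} =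
      real (card (S \<inter> stair_lists (CARD('p) ^ k) n t)) / real (card (stair_lists (CARD('p) ^ k) n t))"
proof -
  interpret prob_space M by fact
  let ?q = "CARD('p) ^ k"
  let ?\<Omega> = "stair_lists ?q n t"
  let ?C = "\<lambda>\<omega>. residue_columns k n (X \<omega>)"
  define I where "I = {(i, j). i \<in> {1..n} \<and> j \<in> {1..n} \<and> i \<in> stair_support T n j}"
  have q: "?q > 0" by simp
  have Xc: "X \<omega> \<in> carrier_mat n n" if "\<omega> \<in> space M" for \<omega>
    using X that by (auto simp: haar_random_matrix_on_def)
  have haar: "haar_random M (\<lambda>\<omega>. X \<omega> $$ (i - 1, j - 1))" if "(i, j) \<in> I" for i j
    using X that by (auto simp: haar_random_matrix_on_def I_def)
  have indep: "indep_vars (\<lambda>_. borel) (\<lambda>(i, j) \<omega>. X \<omega> $$ (i - 1, j - 1)) I"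
    using X by (auto simp: haar_random_matrix_on_def I_def)
  have zero: "X \<omega> $$ (i, j) = 0" if "\<omega> \<in> space M" "i < n" "j < n" "\<not> i < min (t + j) n" for \<omega> i j
  proof -
    have "Suc j \<in> {1..n}" "Suc i \<in> {1..n} - stair_support T n (Suc j)"
      using that mem_stair_support_iff[of T, OF T t(2), of i j] by auto
    then have "X \<omega> $$ (Suc i - 1, Suc j - 1) = 0"
      using X that(1) unfolding haar_random_matrix_on_def by blast
    then show ?thesis by simp
  qed
  have I_iff: "(Suc i, Suc j) \<in> I \<longleftrightarrow> i < n \<and> j < n \<and> i < min (t + j) n" for i j
    using mem_stair_support_iff[of T, OF T t(2), of i j] by (auto simp: I_def)
  have C_nth: "?C \<omega> ! j = (\<lambda>i\<in>{..<n}. padic_residue (X \<omega> $$ (i, j)) k)" "length (?C \<omega>) = n"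
    if "\<omega> \<in> space M" "j < n" for \<omega> j
    using Xc[OF that(1)] that(2) by (auto simp: residue_columns_def vec_residue_def cols_def fun_eq_iff restrict_def)
  have mem: "?C \<omega> \<in> ?\<Omega>" if \<omega>: "\<omega> \<in> space M" for \<omega>
  proof -
    have "?C \<omega> ! j \<in> coord_subgroup ?q n (min (t + j) n)" if j: "j < n" for j
      unfolding C_nth(1)[OF \<omega> j] coord_subgroup_def
      using zero[OF \<omega> _ j] padic_residue_mem[where 'p = 'p]
      by (auto simp: zero_padic_int.rep_eq)
    moreover have "length (?C \<omega>) = n"
      using C_nth(2)[OF \<omega>, of 0] t by simp
    ultimately show ?thesis
      by (simp add: stair_lists_def)
  qed
  then show "\<omega> \<in> space M \<Longrightarrow> residue_columns k n (X \<omega>) \<in> stair_lists (CARD('p) ^ k) n t" .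
  have finI: "finite I"
    by (rule finite_subset[of _ "{1..n} \<times> {1..n}"]) (auto simp: I_def)
  have Ine: "I \<noteq> {}"
    using I_iff[of 0 0] t by auto
  define A where "A cs = (\<lambda>(i, j). {x :: 'p padic_int. padic_residue x k = (cs ! (j - 1)) (i - 1)})" for cs :: "(nat \<Rightarrow> int) list"
  have event: "{\<omega> \<in> space M. ?C \<omega> = cs} =
      (\<Inter>p\<in>I. (case p of (i, j) \<Rightarrow> \<lambda>\<omega>. X \<omega> $$ (i - 1, j - 1)) -` A cs p \<inter> space M)"
    if cs: "cs \<in> ?\<Omega>" for cs
  proof (rule antisym; rule subsetI)
    fix \<omega> assume \<omega>: "\<omega> \<in> {\<omega> \<in> space M. ?C \<omega> = cs}"
    show "\<omega> \<in> (\<Inter>p\<in>I. (case p of (i, j) \<Rightarrow> \<lambda>\<omega>. X \<omega> $$ (i - 1, j - 1)) -` A cs p \<inter> space M)"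
    proof
      fix p assume "p \<in> I"
      moreover obtain i j where p: "p = (Suc i, Suc j)"
        using \<open>p \<in> I\<close> by (auto simp: I_def) (metis Suc_pred' Suc_le_eq)
      ultimately have ij: "i < n" "j < n"
        using I_iff by auto
      have "(cs ! j) i = padic_residue (X \<omega> $$ (i, j)) k"
        using C_nth(1)[of \<omega> j] \<omega> ij by auto
      then show "\<omega> \<in> (case p of (i, j) \<Rightarrow> \<lambda>\<omega>. X \<omega> $$ (i - 1, j - 1)) -` A cs p \<inter> space M"
        using \<omega> by (simp add: p A_def)
    qed
  next
    fix \<omega> assume *: "\<omega> \<in> (\<Inter>p\<in>I. (case p of (i, j) \<Rightarrow> \<lambda>\<omega>. X \<omega> $$ (i - 1, j - 1)) -` A cs p \<inter> space M)"
    then have \<omega>: "\<omega> \<in> space M"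
      using Ine by auto
    have csj: "cs ! j \<in> coord_subgroup ?q n (min (t + j) n)" "length cs = n" if "j < n" for j
      using cs that by (auto simp: stair_lists_def)
    have "?C \<omega> ! j = cs ! j" if j: "j < n" for j
    proof (rule extensionalityI[of _ "{..<n}"])
      show "cs ! j \<in> extensional {..<n}"
        using csj[OF j] by (auto simp: coord_subgroup_def PiE_def)
      show "?C \<omega> ! j \<in> extensional {..<n}"
        unfolding C_nth(1)[OF \<omega> j] by simp
      fix i assume "i \<in> {..<n}"
      then have i: "i < n" by simp
      show "(?C \<omega> ! j) i = (cs ! j) i"
      proof (cases "i < min (t + j) n")
        case True
        then have "(Suc i, Suc j) \<in> I"
          using I_iff i j by blast
        with * have "\<omega> \<in> (case (Suc i, Suc j) of (i, j) \<Rightarrow> \<lambda>\<omega>. X \<omega> $$ (i - 1, j - 1)) -` A cs (Suc i, Suc j) \<inter> space M"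
          by blast
        then show ?thesis
          unfolding C_nth(1)[OF \<omega> j] using i by (simp add: A_def)
      next
        case False
        then have "(cs ! j) i = 0"
          using csj(1)[OF j] i unfolding coord_subgroup_def by (auto simp: PiE_def Pi_def)
        then show ?thesis
          unfolding C_nth(1)[OF \<omega> j] using i zero[OF \<omega> i j False] by (simp add: zero_padic_int.rep_eq)
      qed
    qed
    moreover have "length (?C \<omega>) = length cs"
      using csj(2)[of 0] C_nth(2)[OF \<omega>, of 0] t by simp
    ultimately have "?C \<omega> = cs"
      using csj(2)[of 0] t by (intro nth_equalityI) auto
    then show "\<omega> \<in> {\<omega> \<in> space M. ?C \<omega> = cs}"
      using \<omega> by simp
  qed
  have Aborel: "A cs p \<in> sets borel" for cs p
    using padic_residue_cylinder_measurable[where 'p = 'p] by (auto simp: A_def split: prod.splits)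
  have ev: "{\<omega> \<in> space M. ?C \<omega> = cs} \<in> events" if cs: "cs \<in> ?\<Omega>" for cs
    unfolding event[OF cs]
  proof (rule sets.finite_INT[OF finI Ine])
    fix p assume "p \<in> I"
    then have "(case p of (i, j) \<Rightarrow> \<lambda>\<omega>. X \<omega> $$ (i - 1, j - 1)) \<in> borel_measurable M"
      using haar by (auto simp: haar_random_def split: prod.splits)
    then show "(case p of (i, j) \<Rightarrow> \<lambda>\<omega>. X \<omega> $$ (i - 1, j - 1)) -` A cs p \<inter> space M \<in> events"
      using Aborel by (rule measurable_sets)
  qed
  have pr: "prob {\<omega> \<in> space M. ?C \<omega> = cs} = (1 / real CARD('p) ^ k) ^ card I" if cs: "cs \<in> ?\<Omega>" for cs
  proof -
    have "prob {\<omega> \<in> space M. ?C \<omega> = cs} =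
        (\<Prod>p\<in>I. prob ((case p of (i, j) \<Rightarrow> \<lambda>\<omega>. X \<omega> $$ (i - 1, j - 1)) -` A cs p \<inter> space M))"
      unfolding event[OF cs] by (rule indep_varsD_finite[OF indep Ine finI Aborel])
    also have "\<dots> = (\<Prod>p\<in>I. 1 / real CARD('p) ^ k)"
    proof (rule prod.cong[OF refl])
      fix p assume "p \<in> I"
      moreover obtain i j where p: "p = (Suc i, Suc j)"
        using \<open>p \<in> I\<close> by (auto simp: I_def) (metis Suc_pred' Suc_le_eq)
      ultimately have ij: "i < n" "j < n" "i < min (t + j) n" "(Suc i, Suc j) \<in> I"
        using I_iff by auto
      have "(cs ! j) i \<in> {0..<int ?q}"
      proof -
        have "cs ! j \<in> coord_subgroup ?q n (min (t + j) n)"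
          using cs ij by (auto simp: stair_lists_def)
        then show ?thesis
          using ij unfolding coord_subgroup_def by (auto simp: PiE_def Pi_def)
      qed
      then have "measure M ((\<lambda>\<omega>. X \<omega> $$ (i, j)) -` {x. padic_residue x k = (cs ! j) i} \<inter> space M) = 1 / real CARD('p) ^ k"
        using haar[OF ij(4)] by (intro haar_random_residue) auto
      then show "prob ((case p of (i, j) \<Rightarrow> \<lambda>\<omega>. X \<omega> $$ (i - 1, j - 1)) -` A cs p \<inter> space M) = 1 / real CARD('p) ^ k"
        by (simp add: p A_def)
    qed
    finally show ?thesis by simp
  qed
  have fin: "finite ?\<Omega>"
    using card_lists_nth_mem[of n "\<lambda>j. coord_subgroup ?q n (min (t + j) n)"]
    unfolding stair_lists_def coord_subgroup_def by (simp add: finite_PiE)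
  show "{\<omega> \<in> space M. residue_columns k n (X \<omega>) \<in> S} \<in> sets M"
    by (rule prob_uniform_finite(1)[OF fin mem ev pr])
  show "measure M {\<omega> \<in> space M. residue_columns k n (X \<omega>) \<in> S} =
      real (card (S \<inter> ?\<Omega>)) / real (card ?\<Omega>)"
    by (rule prob_uniform_finite(2)[OF fin mem ev pr])
qed

section \<open>Asymptotics\<close>

definition euler_prod :: "nat \<Rightarrow> nat \<Rightarrow> real" where
  "euler_prod p t = (\<Prod>i<t. 1 - 1 / real p ^ Suc i)"

lemma euler_factor: "p > 1 \<Longrightarrow> 0 < 1 - 1 / real p ^ Suc i" "p > 1 \<Longrightarrow> 1 - 1 / real p ^ Suc i \<le> 1"
  using one_less_power[of "real p" "Suc i"] by (simp_all del: power_Suc)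

lemma euler_prod_bounds:
  assumes "p > 1"
  shows "0 < euler_prod p t" "euler_prod p t \<le> 1"
  unfolding euler_prod_def using euler_factor[OF assms]
  by (auto intro!: prod_pos prod_le_1 simp: less_imp_le simp del: power_Suc)

lemma euler_prod_LIMSEQ:
  assumes p: "p > 1"
  shows "euler_prod p \<longlonglongrightarrow> (\<Prod>i. 1 - 1 / real p ^ Suc i)" and "0 < (\<Prod>i. 1 - 1 / real p ^ Suc i)"
proof -
  have "summable (\<lambda>i. 1 / real p * (1 / real p) ^ i)"
    using p by (intro summable_mult summable_geometric) simp
  then have sm: "summable (\<lambda>i. \<bar>- (1 / real p ^ Suc i)\<bar>)"
    by (simp add: power_divide)
  have "- (1 / real p ^ Suc i) \<noteq> - 1" for i
    using euler_factor(1)[OF p, of i] by linarith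
  then have conv: "convergent_prod (\<lambda>i. 1 - 1 / real p ^ Suc i)"
    using summable_imp_convergent_prod_real[OF sm] by simp
  have "(\<lambda>n. euler_prod p (Suc n)) \<longlonglongrightarrow> (\<Prod>i. 1 - 1 / real p ^ Suc i)"
    using convergent_prod_LIMSEQ[OF conv] unfolding euler_prod_def lessThan_Suc_atMost .
  then show lim: "euler_prod p \<longlonglongrightarrow> (\<Prod>i. 1 - 1 / real p ^ Suc i)"
    by (rule LIMSEQ_imp_Suc)
  have "0 \<le> (\<Prod>i. 1 - 1 / real p ^ Suc i)"
    using euler_prod_bounds(1)[OF p] by (intro LIMSEQ_le_const[OF lim]) (auto intro: less_imp_le)
  moreover have "(\<Prod>i. 1 - 1 / real p ^ Suc i) \<noteq> 0"
    using euler_factor(1)[OF p] by (intro prodinf_nonzero[OF conv]) (metis less_irrefl)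
  ultimately show "0 < (\<Prod>i. 1 - 1 / real p ^ Suc i)"
    by simp
qed

text \<open>
  The ratio \<open>n / p ^ t n\<close> is \<open>p\<close> to the power \<open>- (t n - log p n)\<close>.
\<close>

lemma threshold_iff_ratio_tendsto_0:
  fixes t :: "nat \<Rightarrow> nat"
  assumes p: "p > (1 :: nat)"
  shows "filterlim (\<lambda>n. real (t n) - log (real p) (real n)) at_top sequentially \<longleftrightarrow>
    (\<lambda>n. real n / real p ^ t n) \<longlonglongrightarrow> 0"
proof -
  have eq: "real n / real p ^ t n = real p powr - (real (t n) - log (real p) (real n))" if "n \<ge> 1" for n
    using p that by (simp add: powr_diff powr_realpow)
  show ?thesis
  proof
    assume *: "filterlim (\<lambda>n. real (t n) - log (real p) (real n)) at_top sequentially"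
    have "((\<lambda>x. real p powr - x) \<longlongrightarrow> 0) at_top"
      using p by real_asymp
    from filterlim_compose[OF this *]
    show "(\<lambda>n. real n / real p ^ t n) \<longlonglongrightarrow> 0"
      by (rule Lim_transform_eventually) (use eq in \<open>auto intro: eventually_sequentiallyI[of 1]\<close>)
  next
    assume *: "(\<lambda>n. real n / real p ^ t n) \<longlonglongrightarrow> 0"
    show "filterlim (\<lambda>n. real (t n) - log (real p) (real n)) at_top sequentially"
      unfolding filterlim_at_top
    proof
      fix Z :: real
      have "0 < real p powr - Z"
        using p by simp
      from order_tendstoD(2)[OF * this] eventually_ge_at_top[of 1]
      show "\<forall>\<^sub>F n in sequentially. Z \<le> real (t n) - log (real p) (real n)"
      proof eventually_elim
        case (elim n)
        then have "real p powr - (real (t n) - log (real p) (real n)) < real p powr - Z"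
          using eq by simp
        then show ?case
          using p by simp
      qed
    qed
  qed
qed

text \<open>
  The second limit is Bernoulli's inequality.
\<close>

lemma ratio_tendsto_0_imp:
  fixes t :: "nat \<Rightarrow> nat"
  assumes p: "p > (1 :: nat)" and *: "(\<lambda>n. real n / real p ^ t n) \<longlonglongrightarrow> 0"
  shows "filterlim t at_top sequentially"
    and "(\<lambda>n. (1 - 1 / real p ^ t n) ^ (n - t n)) \<longlonglongrightarrow> 1"
proof -
  show "filterlim t at_top sequentially"
    unfolding filterlim_at_top
  proof
    fix Z :: nat
    have "0 < 1 / real p ^ Z"
      using p by simp
    from order_tendstoD(2)[OF * this] eventually_ge_at_top[of 1]
    show "\<forall>\<^sub>F n in sequentially. Z \<le> t n"
    proof eventually_elim
      case (elim n)
      have "1 / real p ^ t n \<le> real n / real p ^ t n"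
        using elim p by (intro divide_right_mono) auto
      then have "1 / real p ^ t n < 1 / real p ^ Z"
        using elim by linarith
      then have "real p ^ Z < real p ^ t n"
        using p by (simp add: divide_less_cancel frac_less2 field_simps)
      then show ?case
        using p by (simp add: less_imp_le)
    qed
  qed
  show "(\<lambda>n. (1 - 1 / real p ^ t n) ^ (n - t n)) \<longlonglongrightarrow> 1"
  proof (rule tendsto_sandwich)
    show "(\<lambda>n. 1 - real n / real p ^ t n) \<longlonglongrightarrow> 1"
      using tendsto_diff[OF tendsto_const *, of 1] by simp
    show "\<forall>\<^sub>F n in sequentially. 1 - real n / real p ^ t n \<le> (1 - 1 / real p ^ t n) ^ (n - t n)"
    proof (intro always_eventually allI)
      fix n
      have u: "0 \<le> 1 / real p ^ t n" "1 / real p ^ t n \<le> 1"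
        using p by (auto simp: divide_le_eq_1)
      have "1 - real n / real p ^ t n \<le> 1 + real (n - t n) * - (1 / real p ^ t n)"
        using u mult_right_mono[of "real (n - t n)" "real n" "1 / real p ^ t n"] by simp
      also have "\<dots> \<le> (1 + - (1 / real p ^ t n)) ^ (n - t n)"
        using u by (intro Bernoulli_inequality) simp
      finally show "1 - real n / real p ^ t n \<le> (1 - 1 / real p ^ t n) ^ (n - t n)"
        by simp
    qed
    show "\<forall>\<^sub>F n in sequentially. (1 - 1 / real p ^ t n) ^ (n - t n) \<le> 1"
      using p by (intro always_eventually allI power_le_one) (auto simp: divide_le_eq_1)
  qed simp
qed

text \<open>
  Write \<open>a n\<close> for the power of \<open>1 - 1 / p ^ t n\<close>.  If \<open>t n < Z\<close> for infinitely many \<open>n\<close>, then \<open>a n\<close>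
  would tend to 0 along these \<open>n\<close>, although the limit is positive; so \<open>t\<close> tends to infinity.  Then
  the product of the first \<open>t n\<close> factors converges to the same limit and \<open>a n\<close> tends to 1.  As
  \<open>a n\<close> is at most \<open>exp (- (n - t n) / p ^ t n)\<close>, it follows that \<open>(n - t n) / p ^ t n\<close> tends to 0,
  and \<open>t n / p ^ t n\<close> does so anyway.
\<close>

lemma ratio_tendsto_0_of_nonsingular_limit:
  fixes t :: "nat \<Rightarrow> nat"
  assumes p: "p > (1 :: nat)" and t: "\<And>n. n \<ge> 1 \<Longrightarrow> 1 \<le> t n \<and> t n \<le> n"
    and lim: "(\<lambda>n. (1 - 1 / real p ^ t n) ^ (n - t n) * euler_prod p (t n)) \<longlonglongrightarrow> (\<Prod>i. 1 - 1 / real p ^ Suc i)"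
  shows "(\<lambda>n. real n / real p ^ t n) \<longlonglongrightarrow> 0"
proof -
  define C where "C = (\<Prod>i. 1 - 1 / real p ^ Suc i)"
  define a where "a n = (1 - 1 / real p ^ t n) ^ (n - t n)" for n
  note C = euler_prod_LIMSEQ[OF p, folded C_def]
  have u: "0 \<le> 1 - 1 / real p ^ k" "1 - 1 / real p ^ k \<le> 1" for k
    using p by (auto simp: divide_le_eq_1)
  have t_top: "filterlim t at_top sequentially"
    unfolding filterlim_at_top
  proof
    fix Z :: nat
    have "(\<lambda>n. (1 - 1 / real p ^ Suc Z) ^ (n - Suc Z)) \<longlonglongrightarrow> 0"
    proof -
      have "(\<lambda>n. (1 - 1 / real p ^ Suc Z) ^ n) \<longlonglongrightarrow> 0"
        using u[of "Suc Z"] p by (intro LIMSEQ_power_zero) (simp del: power_Suc)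
      then show ?thesis
        using LIMSEQ_offset[of "\<lambda>n. (1 - 1 / real p ^ Suc Z) ^ (n - Suc Z)" "Suc Z"] by simp
    qed
    from order_tendstoD(2)[OF this, of "C / 2"] order_tendstoD(1)[OF lim, of "C / 2"] C(2)
    have "\<forall>\<^sub>F n in sequentially. (1 - 1 / real p ^ Suc Z) ^ (n - Suc Z) < C / 2"
      "\<forall>\<^sub>F n in sequentially. C / 2 < a n * euler_prod p (t n)"
      by (auto simp: C_def a_def)
    then show "\<forall>\<^sub>F n in sequentially. Z \<le> t n"
    proof eventually_elim
      case (elim n)
      show ?case
      proof (rule ccontr)
        assume "\<not> Z \<le> t n"
        then have tz: "t n \<le> Suc Z" by simp
        have "a n * euler_prod p (t n) \<le> a n"
          using euler_prod_bounds(2)[OF p, of "t n"] u[of "t n"]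
          by (intro mult_left_le) (auto simp: a_def)
        also have "a n \<le> (1 - 1 / real p ^ Suc Z) ^ (n - t n)"
          unfolding a_def using tz p u
          by (intro power_mono diff_left_mono divide_left_mono power_increasing)
              (auto simp del: power_Suc)
        also have "\<dots> \<le> (1 - 1 / real p ^ Suc Z) ^ (n - Suc Z)"
          using tz u[of "Suc Z"] by (intro power_decreasing) (auto simp del: power_Suc)
        finally show False
          using elim by linarith
      qed
    qed
  qed
  have et: "(\<lambda>n. euler_prod p (t n)) \<longlonglongrightarrow> C"
    by (rule filterlim_compose[OF C(1) t_top])
  have "(\<lambda>n. a n * euler_prod p (t n) / euler_prod p (t n)) \<longlonglongrightarrow> C / C"
    using C(2) lim et unfolding a_def C_def by (intro tendsto_divide) auto
  then have a1: "a \<longlonglongrightarrow> 1"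
    using C(2) euler_prod_bounds(1)[OF p] by (simp add: less_imp_neq[THEN not_sym])
  have a_pos: "\<forall>\<^sub>F n in sequentially. 0 < a n"
    using order_tendstoD(1)[OF a1, of 0] by simp
  have nt: "(\<lambda>n. real (n - t n) / real p ^ t n) \<longlonglongrightarrow> 0"
  proof (rule tendsto_sandwich[OF _ _ tendsto_const[of 0]])
    show "\<forall>\<^sub>F n in sequentially. 0 \<le> real (n - t n) / real p ^ t n"
      by simp
    show "(\<lambda>n. - ln (a n)) \<longlonglongrightarrow> 0"
      using tendsto_minus[OF tendsto_ln[OF a1]] by simp
    show "\<forall>\<^sub>F n in sequentially. real (n - t n) / real p ^ t n \<le> - ln (a n)"
      using a_pos
    proof eventually_elim
      case (elim n)
      have "a n \<le> exp (- (1 / real p ^ t n)) ^ (n - t n)"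
        unfolding a_def using u by (intro power_mono exp_minus_ge) auto
      also have "\<dots> = exp (- (real (n - t n) / real p ^ t n))"
        by (simp flip: exp_of_nat_mult)
      finally have "ln (a n) \<le> - (real (n - t n) / real p ^ t n)"
        using elim by (metis exp_gt_zero ln_exp ln_le_cancel_iff)
      then show ?case by simp
    qed
  qed
  have tt: "(\<lambda>n. real (t n) / real p ^ t n) \<longlonglongrightarrow> 0"
  proof -
    have "(\<lambda>k. real k / real p ^ k) \<longlonglongrightarrow> 0"
      using p by real_asymp
    from filterlim_compose[OF this t_top] show ?thesis .
  qed
  have "(\<lambda>n. real (n - t n) / real p ^ t n + real (t n) / real p ^ t n) \<longlonglongrightarrow> 0"
    using tendsto_add[OF nt tt] by simp
  then show ?thesis
  proof (rule Lim_transform_eventually)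
    show "\<forall>\<^sub>F n in sequentially. real (n - t n) / real p ^ t n + real (t n) / real p ^ t n = real n / real p ^ t n"
      using t by (intro eventually_sequentiallyI[of 1]) (simp add: of_nat_diff flip: add_divide_distrib)
  qed
qed

text \<open>
  A list that does not generate \<open>G\<close> lies in one of finitely many proper subgroups, each of which has
  at most half as many elements as \<open>G\<close>.
\<close>

lemma card_generating_lists_LIMSEQ:
  assumes G: "group G" and fin: "finite (carrier G)"
  shows "(\<lambda>t. real (card {gs. length gs = t \<and> set gs \<subseteq> carrier G \<and> generate G (set gs) = carrier G}) /
    real (card (carrier G)) ^ t) \<longlonglongrightarrow> 1"
proof -
  interpret G: group G by fact
  let ?g = "\<lambda>t. {gs. length gs = t \<and> set gs \<subseteq> carrier G \<and> generate G (set gs) = carrier G}"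
  let ?L = "\<lambda>t H. {gs. set gs \<subseteq> H \<and> length gs = t}"
  let ?N = "card (carrier G)"
  define \<H> where "\<H> = {H. subgroup H G \<and> H \<noteq> carrier G}"
  have N: "?N > 0"
    using fin G.one_closed by (auto simp: card_gt_0_iff)
  have sub: "\<H> \<subseteq> Pow (carrier G)"
    unfolding \<H>_def using subgroup.subset by blast
  have fH: "finite \<H>"
    using sub fin by (meson finite_Pow_iff finite_subset)
  have finL: "finite (?L t H)" if "H \<subseteq> carrier G" for t H
    using that fin finite_subset finite_lists_length_eq by metis
  have half: "2 * card H \<le> ?N" if H: "H \<in> \<H>" for H
  proof -
    have "subgroup H G" "H \<noteq> carrier G" "H \<subseteq> carrier G"
      using H sub by (auto simp: \<H>_def)
    then have lt: "card H < ?N" and eq: "?N = card (rcosets\<^bsub>G\<^esub> H) * card H"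
      using fin G.lagrange_finite[OF fin, of H] by (auto simp: psubset_card_mono order_def)
    then have "card (rcosets\<^bsub>G\<^esub> H) \<noteq> 0" "card (rcosets\<^bsub>G\<^esub> H) \<noteq> 1"
      using N by auto
    then have "2 \<le> card (rcosets\<^bsub>G\<^esub> H)"
      by simp
    then show ?thesis
      using mult_le_mono1 eq by metis
  qed
  have lower: "1 - 2 ^ ?N * (1 / 2) ^ t \<le> real (card (?g t)) / real ?N ^ t" for t
  proof -
    have "?L t (carrier G) \<subseteq> ?g t \<union> (\<Union>H\<in>\<H>. ?L t H)"
    proof
      fix gs assume gs: "gs \<in> ?L t (carrier G)"
      have "set gs \<subseteq> generate G (set gs)"
        by (auto intro: generate.incl)
      moreover have "generate G (set gs) \<in> \<H>" if "generate G (set gs) \<noteq> carrier G"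
        unfolding \<H>_def using gs that G.generate_is_subgroup by auto
      ultimately show "gs \<in> ?g t \<union> (\<Union>H\<in>\<H>. ?L t H)"
        using gs by blast
    qed
    moreover have fg: "finite (?g t)"
      by (rule finite_subset[OF _ finL[of "carrier G" t]]) auto
    moreover have fU: "finite (\<Union>H\<in>\<H>. ?L t H)"
      using fH finL sub by blast
    ultimately have "card (?L t (carrier G)) \<le> card (?g t) + card (\<Union>H\<in>\<H>. ?L t H)"
      by (meson card_Un_le card_mono finite_UnI le_trans)
    also have "card (\<Union>H\<in>\<H>. ?L t H) \<le> (\<Sum>H\<in>\<H>. card (?L t H))"
      by (rule card_UN_le[OF fH])
    also have "card (?L t (carrier G)) = ?N ^ t"
      by (rule card_lists_length_eq[OF fin])
    finally have "?N ^ t \<le> card (?g t) + (\<Sum>H\<in>\<H>. card (?L t H))" by simp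
    then have "real (?N ^ t) \<le> real (card (?g t) + (\<Sum>H\<in>\<H>. card (?L t H)))"
      by (rule of_nat_mono)
    then have "real ?N ^ t \<le> real (card (?g t)) + (\<Sum>H\<in>\<H>. real (card (?L t H)))"
      by simp
    also have "(\<Sum>H\<in>\<H>. real (card (?L t H))) \<le> (\<Sum>H\<in>\<H>. (real ?N / 2) ^ t)"
    proof (rule sum_mono)
      fix H assume H: "H \<in> \<H>"
      then have "finite H"
        using sub fin finite_subset by blast
      then have "real (card (?L t H)) = real (card H) ^ t"
        by (simp add: card_lists_length_eq)
      also have "\<dots> \<le> (real ?N / 2) ^ t"
        using half[OF H] by (intro power_mono) auto
      finally show "real (card (?L t H)) \<le> (real ?N / 2) ^ t" .
    qed
    also have "\<dots> = real (card \<H>) * (real ?N / 2) ^ t"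
      by simp
    also have "\<dots> \<le> 2 ^ ?N * (real ?N / 2) ^ t"
    proof (rule mult_right_mono)
      have "card \<H> \<le> 2 ^ ?N"
        using card_mono[OF _ sub] fin by (simp add: card_Pow)
      then show "real (card \<H>) \<le> 2 ^ ?N"
        by (metis of_nat_le_iff of_nat_numeral of_nat_power)
    qed simp
    finally have "real ?N ^ t \<le> real (card (?g t)) + 2 ^ ?N * (real ?N / 2) ^ t" by simp
    then show ?thesis
      using N by (simp add: field_simps power_divide)
  qed
  have upper: "real (card (?g t)) / real ?N ^ t \<le> 1" for t
  proof -
    have "card (?g t) \<le> card (?L t (carrier G))"
      by (rule card_mono[OF finL]) auto
    then have "real (card (?g t)) \<le> real ?N ^ t"
      by (simp add: card_lists_length_eq[OF fin] flip: of_nat_power)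
    then show ?thesis
      using N by (simp add: divide_le_eq_1)
  qed
  show ?thesis
  proof (rule tendsto_sandwich)
    have "(\<lambda>t. 1 - 2 ^ ?N * (1 / 2 :: real) ^ t) \<longlonglongrightarrow> 1 - 2 ^ ?N * 0"
      by (intro tendsto_intros LIMSEQ_power_zero) auto
    then show "(\<lambda>t. 1 - 2 ^ ?N * (1 / 2 :: real) ^ t) \<longlonglongrightarrow> 1" by simp
  qed (use lower upper in auto)
qed

section \<open>The distribution of the cokernel of a staircase matrix\<close>

lemma card_lists_split:
  assumes fin: "\<And>i. i < r + t \<Longrightarrow> finite (W i)"
  shows "card {cs. length cs = r + t \<and> (\<forall>j<r + t. cs ! j \<in> W j) \<and> P (take r cs) \<and> Q (take r cs) (drop r cs)} =
    (\<Sum>c\<in>{c. length c = r \<and> (\<forall>j<r. c ! j \<in> W j) \<and> P c}.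
      card {d. length d = t \<and> (\<forall>j<t. d ! j \<in> W (r + j)) \<and> Q c d})"
    (is "card ?S = (\<Sum>c\<in>?A. card (?B c))")
proof -
  have "bij_betw (\<lambda>(c, d). c @ d) (SIGMA c:?A. ?B c) ?S"
  proof (rule bij_betw_imageI)
    show "inj_on (\<lambda>(c, d). c @ d) (SIGMA c:?A. ?B c)"
      by (auto simp: inj_on_def)
    show "(\<lambda>(c, d). c @ d) ` (SIGMA c:?A. ?B c) = ?S"
    proof (rule antisym; rule subsetI)
      fix x assume "x \<in> (\<lambda>(c, d). c @ d) ` (SIGMA c:?A. ?B c)"
      then obtain c d where x: "x = c @ d" "c \<in> ?A" "d \<in> ?B c" by auto
      have "(c @ d) ! j \<in> W j" if "j < r + t" for j
      proof (cases "j < r")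
        case True
        then show ?thesis using x by (simp add: nth_append)
      next
        case False
        then have "j - r < t" "r + (j - r) = j"
          using that by auto
        then have "d ! (j - r) \<in> W j"
          using x by (metis (no_types, lifting) mem_Collect_eq)
        then show ?thesis using x False by (simp add: nth_append)
      qed
      then show "x \<in> ?S" using x by simp
    next
      fix x assume x: "x \<in> ?S"
      then have "take r x \<in> ?A" "drop r x \<in> ?B (take r x)" by auto
      then show "x \<in> (\<lambda>(c, d). c @ d) ` (SIGMA c:?A. ?B c)"
        by (intro image_eqI[of _ _ "(take r x, drop r x)"]) auto
    qed
  qed
  then have "card ?S = card (SIGMA c:?A. ?B c)"
    by (simp add: bij_betw_same_card)
  moreover have "finite ?A"
    by (rule finite_subset[of _ "{c. length c = r \<and> (\<forall>j<r. c ! j \<in> W j)}"])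
      (use card_lists_nth_mem[of r W] fin in auto)
  moreover have "finite (?B c)" for c
    by (rule finite_subset[of _ "{d. length d = t \<and> (\<forall>j<t. d ! j \<in> W (r + j))}"])
      (use card_lists_nth_mem[of t "\<lambda>j. W (r + j)"] fin in auto)
  ultimately show ?thesis
    by (simp add: card_SigmaI)
qed

text \<open>
  The factor behind \<open>card (carrier V) ^ t\<close> is the conditional probability of the quotient \<open>G\<close>, given
  the first \<open>n - t\<close> columns.  It is the same for all independent \<open>cs\<close>.
\<close>

lemma card_residue_completions:
  fixes p e n t :: nat and G :: "'g monoid"
  assumes p: "Factorial_Ring.prime p" and t: "t \<le> n"
    and G: "comm_group G" "finite (carrier G)" "order G = p ^ e"
  defines "V \<equiv> residue_group (p ^ Suc e) n"
  assumes cs: "length cs = n - t" "set cs \<subseteq> carrier V"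
    "indep_over V ((\<lambda>x. x [^]\<^bsub>V\<^esub> p) ` carrier V) cs"
  shows "real (card {ds. length ds = t \<and> set ds \<subseteq> carrier V \<and> V Mod generate V (set cs \<union> set ds) \<cong> G}) =
    real (card (carrier V)) ^ t * (1 / real (card (auto G)) *
      (real (card {gs. length gs = t \<and> set gs \<subseteq> carrier G \<and> generate G (set gs) = carrier G}) /
        real (card (carrier G)) ^ t) * euler_prod p t)"
proof -
  have p0: "p > 0" "p > 1" and q: "p ^ Suc e > 0" "p ^ Suc e > 1"
    using prime_gt_0_nat[OF p] prime_gt_1_nat[OF p] one_less_power[OF prime_gt_1_nat[OF p], of "Suc e"]
    by (auto simp del: power_Suc)
  interpret V: comm_group V
    unfolding V_def by (rule comm_group_residue_group)
  interpret G: comm_group G by fact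
  have fin: "finite (carrier V)"
    unfolding V_def by (rule finite_residue_group[OF q(1)])
  have n: "length cs + t = n"
    using cs t by simp
  have expG: "g [^]\<^bsub>G\<^esub> (p ^ e) = \<one>\<^bsub>G\<^esub>" if "g \<in> carrier G" for g
    using G.pow_order_eq_1[OF that] G by simp
  have expG': "g [^]\<^bsub>G\<^esub> (p ^ Suc e) = \<one>\<^bsub>G\<^esub>" if "g \<in> carrier G" for g
    using expG[OF that] G.nat_pow_pow[OF that, of "p ^ e" p] by (simp add: mult.commute)
  have expV: "x [^]\<^bsub>V\<^esub> (p ^ Suc e) = \<one>\<^bsub>V\<^esub>" if "x \<in> carrier V" for x
    using residue_group_nat_pow[of x "p ^ Suc e" n "p ^ Suc e"] that q unfolding V_def
    by (simp add: residue_group_simps del: power_Suc)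
  have cardV: "card (carrier V) = p ^ n * card ((\<lambda>x. x [^]\<^bsub>V\<^esub> p) ` carrier V)"
    using card_coord_subgroup[of n n "p ^ Suc e"] card_pow_image_coord_subgroup[of p n n e] p0
    unfolding V_def coord_subgroup_full[OF q(1)] by (simp add: power_mult_distrib)
  have aut: "card (auto G) > 0"
  proof -
    have "finite (auto G)"
      by (rule finite_subset[OF _ finite_ext_hom[OF G(2) G(2)]]) (auto simp: auto_def ext_hom_def Bij_def)
    then show ?thesis
      using G.id_in_auto by (auto simp: card_gt_0_iff)
  qed
  have Gpos: "card (carrier G) > 0"
    using G G.one_closed by (auto simp: card_gt_0_iff)
  have "real (card (auto G) * card {ds. length ds = t \<and> set ds \<subseteq> carrier V \<and>
      V Mod generate V (set cs \<union> set ds) \<cong> G}) =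
    real (card {gs. length gs = t \<and> set gs \<subseteq> carrier G \<and> generate G (set gs) = carrier G}) *
      (real (card (carrier V)) / real (card (carrier G))) ^ t * (\<Prod>i<t. 1 - 1 / real p ^ Suc i)"
  proof (rule card_completions_with_given_quotient[OF V.comm_group_axioms G(1) fin G(2) p expV cs(2,3)])
    show "card (carrier V) = p ^ (length cs + t) * card ((\<lambda>x. x [^]\<^bsub>V\<^esub> p) ` carrier V)"
      unfolding n by (rule cardV)
    show "card (carrier G) ^ (length cs + t) \<le> card (ext_hom V G)"
      unfolding n V_def by (rule card_ext_hom_residue_group[OF G(1,2) q(2) expG'])
    show "card (kernel V G h) = p ^ (length cs + t) * card ((\<lambda>x. x [^]\<^bsub>V\<^esub> p) ` kernel V G h)"
      if "h \<in> hom V G" for h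
      unfolding n V_def
      by (rule card_kernel_eq_card_pow_image[OF p0(1) G.is_group expG that[unfolded V_def]])
  qed
  then show ?thesis
    using aut Gpos unfolding euler_prod_def by (simp add: field_simps power_divide)
qed

text \<open>
  Independence of the first \<open>n - t\<close> columns has probability \<open>(1 - 1 / p ^ t) ^ (n - t)\<close>, and an event
  whose conditional probability \<open>\<beta>\<close> does not depend on these columns multiplies it by \<open>\<beta>\<close>.
\<close>

lemma card_stair_lists_leading_indep:
  fixes p e n t :: nat
  assumes p: "Factorial_Ring.prime p" and t: "t \<le> n"
  defines "V \<equiv> residue_group (p ^ Suc e) n"
  defines "leading_indep cs \<equiv> indep_over V ((\<lambda>x. x [^]\<^bsub>V\<^esub> p) ` carrier V) (take (n - t) cs)"
  assumes Q: "\<And>c. \<lbrakk>length c = n - t; set c \<subseteq> carrier V; leading_indep c\<rbrakk> \<Longrightarrow>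
    real (card {d. length d = t \<and> set d \<subseteq> carrier V \<and> Q c d}) = real (card (carrier V)) ^ t * \<beta>"
  shows "real (card {cs \<in> stair_lists (p ^ Suc e) n t. leading_indep cs \<and> Q (take (n - t) cs) (drop (n - t) cs)}) /
    real (card (stair_lists (p ^ Suc e) n t)) = (1 - 1 / real p ^ t) ^ (n - t) * \<beta>"
proof -
  have p0: "p > 0" and q: "p ^ Suc e > 0"
    using prime_gt_0_nat[OF p] by auto
  interpret V: comm_group V
    unfolding V_def by (rule comm_group_residue_group)
  let ?W = "\<lambda>j. coord_subgroup (p ^ Suc e) n (min (t + j) n)"
  let ?P = "\<lambda>c. indep_over V ((\<lambda>x. x [^]\<^bsub>V\<^esub> p) ` carrier V) c"
  define w where "w = (\<Prod>j<n - t. real (card (?W j)))"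
  define v where "v = real (card (carrier V)) ^ t"
  have n: "n - t + t = n"
    using t by simp
  have WV: "?W j \<subseteq> carrier V" for j
    using subgroup.subset[OF subgroup_coord_subgroup[OF q]] unfolding V_def by blast
  have finV: "finite (carrier V)"
    unfolding V_def by (rule finite_residue_group[OF q])
  have finW: "finite (?W j)" for j
    using WV finV finite_subset by blast
  have full: "?W (n - t + j) = carrier V" for j
  proof -
    have "min (t + (n - t + j)) n = n"
      using t by simp
    then show ?thesis
      by (simp only: coord_subgroup_full[OF q] V_def)
  qed
  have tail: "{d. length d = t \<and> (\<forall>j<t. d ! j \<in> ?W (n - t + j)) \<and> R d} = {d. length d = t \<and> set d \<subseteq> carrier V \<and> R d}" for R
    unfolding full by (auto simp: set_conv_nth)
  let ?A = "{c. length c = n - t \<and> (\<forall>j<n - t. c ! j \<in> ?W j) \<and> ?P c}"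
  have A: "real (card ?A) = w * (1 - 1 / real p ^ t) ^ (n - t)"
  proof -
    have "real (card {cs. length cs = n - t \<and> (\<forall>i<n - t. cs ! i \<in> coord_subgroup (p ^ Suc e) n (t + i)) \<and> ?P cs}) =
      (\<Prod>i<n - t. real (card (coord_subgroup (p ^ Suc e) n (t + i))) * (1 - 1 / real p ^ (t + i - i)))"
      unfolding V_def by (rule card_staircase_indep[OF p]) auto
    moreover have "min (t + i) n = t + i" if "i < n - t" for i
      using that by simp
    ultimately show ?thesis
      unfolding w_def by (simp add: prod.distrib cong: conj_cong)
  qed
  have "{cs \<in> stair_lists (p ^ Suc e) n t. leading_indep cs \<and> Q (take (n - t) cs) (drop (n - t) cs)} =
    {cs. length cs = n - t + t \<and> (\<forall>j<n - t + t. cs ! j \<in> ?W j) \<and> ?P (take (n - t) cs) \<and> Q (take (n - t) cs) (drop (n - t) cs)}"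
    unfolding n stair_lists_def leading_indep_def by blast
  then have "real (card {cs \<in> stair_lists (p ^ Suc e) n t. leading_indep cs \<and> Q (take (n - t) cs) (drop (n - t) cs)}) =
      (\<Sum>c\<in>?A. real (card {d. length d = t \<and> set d \<subseteq> carrier V \<and> Q c d}))"
    using card_lists_split[of "n - t" t ?W ?P Q] finW unfolding tail by simp
  also have "\<dots> = (\<Sum>c\<in>?A. v * \<beta>)"
  proof (rule sum.cong[OF refl])
    fix c assume c: "c \<in> ?A"
    then have "c ! i \<in> carrier V" if "i < length c" for i
      using that WV[of i] by auto
    then have "set c \<subseteq> carrier V"
      by (auto simp: in_set_conv_nth)
    then show "real (card {d. length d = t \<and> set d \<subseteq> carrier V \<and> Q c d}) = v * \<beta>"
      unfolding v_def using c by (intro Q) (auto simp: leading_indep_def)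
  qed
  finally have num: "real (card {cs \<in> stair_lists (p ^ Suc e) n t. leading_indep cs \<and> Q (take (n - t) cs) (drop (n - t) cs)}) =
      w * (1 - 1 / real p ^ t) ^ (n - t) * (v * \<beta>)"
    using A by simp
  have "card (stair_lists (p ^ Suc e) n t) = (\<Prod>j<n. card (?W j))"
    unfolding stair_lists_def using card_lists_nth_mem[of n ?W] finW by blast
  also have "(\<Prod>j<n. card (?W j)) = (\<Prod>j<n - t. card (?W j)) * (\<Prod>j<t. card (?W (n - t + j)))"
    using prod.atLeastLessThan_concat[of 0 "n - t" n "\<lambda>j. card (?W j)"]
      prod.shift_bounds_nat_ivl[of "\<lambda>j. card (?W j)" 0 "n - t" t] t
    by (simp add: atLeast0LessThan add.commute)
  finally have den: "real (card (stair_lists (p ^ Suc e) n t)) = w * v"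
    unfolding full w_def v_def by simp
  have Wpos: "card (?W j) > 0" for j
    using finW subgroup.one_closed[OF subgroup_coord_subgroup[OF q]] by (auto simp: card_gt_0_iff)
  have "w > 0"
    unfolding w_def using Wpos by (intro prod_pos) (simp only: of_nat_0_less_iff)
  then have "w \<noteq> 0" by simp
  moreover have "v \<noteq> 0"
    unfolding v_def using finV V.one_closed by (auto simp: card_eq_0_iff)
  ultimately show ?thesis
    unfolding num den by simp
qed

text \<open>
  A generating list of \<open>n\<close> elements is a basis modulo \<open>p\<close>, so its initial segments are independent.
\<close>

lemma stair_lists_leading_indep_of_generating:
  fixes p e n t :: nat
  assumes p: "Factorial_Ring.prime p" and t: "t \<le> n"
  defines "V \<equiv> residue_group (p ^ Suc e) n"
  assumes cs: "cs \<in> stair_lists (p ^ Suc e) n t" and gen: "generate V (set cs) = carrier V"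
  shows "indep_over V ((\<lambda>x. x [^]\<^bsub>V\<^esub> p) ` carrier V) (take (n - t) cs)"
proof -
  have p0: "p > 0" and q: "p ^ Suc e > 0"
    using prime_gt_0_nat[OF p] by auto
  interpret V: comm_group V
    unfolding V_def by (rule comm_group_residue_group)
  let ?P = "(\<lambda>x. x [^]\<^bsub>V\<^esub> p) ` carrier V"
  have P: "subgroup ?P V" "?P \<subseteq> carrier V"
    using V.subgroup_pow_image[OF V.subgroup_self] subgroup.subset by blast+
  have finV: "finite (carrier V)"
    unfolding V_def by (rule finite_residue_group[OF q])
  have len: "length cs = n"
    using cs by (simp add: stair_lists_def)
  have csV: "set cs \<subseteq> carrier V"
    unfolding gen[symmetric] by (auto intro: generate.incl)
  have "generate V (?P \<union> set cs) = carrier V"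
  proof
    show "generate V (?P \<union> set cs) \<subseteq> carrier V"
      using P csV by (intro V.generate_incl) auto
    show "carrier V \<subseteq> generate V (?P \<union> set cs)"
      using V.mono_generate[of "set cs" "?P \<union> set cs"] gen by auto
  qed
  moreover have "card (carrier V) = p ^ n * card ?P"
    using card_coord_subgroup[of n n "p ^ Suc e"] card_pow_image_coord_subgroup[of p n n e] p0
    unfolding V_def coord_subgroup_full[OF q] by (simp add: power_mult_distrib)
  ultimately have "indep_over V ?P cs"
    using V.card_generate_Un_indep[OF P(1) _ p, of cs] finV csV len by auto
  then have "indep_over V ?P (take (n - t) cs @ drop (n - t) cs)"
    by simp
  then show ?thesis
    using V.indep_over_append[of ?P "take (n - t) cs" "drop (n - t) cs"] P csV
      set_take_subset[of "n - t" cs] set_drop_subset[of "n - t" cs] by blast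
qed

text \<open>
  The conditional probability that the cokernel is isomorphic to \<open>G\<close>, given that the first \<open>n - t\<close>
  columns are independent modulo \<open>p\<close>.  It is also the probability that a matrix of size \<open>t\<close> whose
  entries are all independent and Haar-random has cokernel \<open>G\<close>.
\<close>

definition stair_density :: "nat \<Rightarrow> 'g monoid \<Rightarrow> nat \<Rightarrow> real" where
  "stair_density p G t = 1 / real (card (auto G)) *
      (real (card {gs. length gs = t \<and> set gs \<subseteq> carrier G \<and> generate G (set gs) = carrier G}) /
        real (card (carrier G)) ^ t) * euler_prod p t"

text \<open>
  The number \<open>a\<close> is the probability of the event \<open>E\<close> that the first \<open>n - t\<close> columns are independent
  modulo \<open>p\<close>.  The complement of \<open>E\<close> contributes between 0 and \<open>1 - a\<close>, and nothing if \<open>G\<close> is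
  trivial, because a trivial cokernel implies \<open>E\<close>.
\<close>

lemma prob_cok_iso_bounds:
  fixes X :: "'w \<Rightarrow> 'p :: prime_card padic_int mat" and G :: "'g monoid"
  assumes M: "prob_space M" and X: "haar_random_matrix_on M n (stair_support T n) X"
    and T: "1 \<le> T n" "T n \<le> n"
    and G: "finite_abelian_p_group CARD('p) G"
  defines "a \<equiv> (1 - 1 / real CARD('p) ^ T n) ^ (n - T n)"
  shows "a * stair_density CARD('p) G (T n) \<le> \<P>(\<omega> in M. cok (X \<omega>) \<cong> G)"
    and "\<P>(\<omega> in M. cok (X \<omega>) \<cong> G) \<le> a * stair_density CARD('p) G (T n) + (1 - a)"
    and "carrier G = {\<one>\<^bsub>G\<^esub>} \<Longrightarrow> \<P>(\<omega> in M. cok (X \<omega>) \<cong> G) = a * stair_density CARD('p) G (T n)"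
proof -
  define t where "t = T n"
  have Tt: "T n = t" and t: "1 \<le> t" "t \<le> n"
    using T by (auto simp: t_def)
  interpret prob_space M by fact
  obtain e where G': "comm_group G" "finite (carrier G)" "order G = CARD('p) ^ e"
    using G by (auto simp: finite_abelian_p_group_def)
  interpret G: comm_group G by fact
  have p: "Factorial_Ring.prime CARD('p)"
    by (rule prime_card)
  define V where "V = residue_group (CARD('p) ^ Suc e) n"
  interpret V: comm_group V
    unfolding V_def by (rule comm_group_residue_group)
  let ?S = "stair_lists (CARD('p) ^ Suc e) n t"
  let ?C = "\<lambda>\<omega>. residue_columns (Suc e) n (X \<omega>)"
  define E where "E cs \<longleftrightarrow> indep_over V ((\<lambda>x. x [^]\<^bsub>V\<^esub> CARD('p)) ` carrier V) (take (n - t) cs)" for cs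
  define R where "R cs \<longleftrightarrow> V Mod generate V (set cs) \<cong> G" for cs
  note unif = residue_columns_uniform[OF M X Tt t, where k = "Suc e"]
  have prS: "prob {\<omega> \<in> space M. ?C \<omega> \<in> S} = real (card (S \<inter> ?S)) / real (card ?S)" for S
    by (rule unif(3))
  have cok: "cok (X \<omega>) \<cong> G \<longleftrightarrow> R (?C \<omega>)" if "\<omega> \<in> space M" for \<omega>
  proof -
    have "X \<omega> \<in> carrier_mat n n"
      using X that by (auto simp: haar_random_matrix_on_def)
    from cok_iso_iff_residue_quotient_iso[OF this G.is_group G'(3)] show ?thesis
      by (simp add: R_def V_def residue_columns_def)
  qed
  have prE: "prob {\<omega> \<in> space M. ?C \<omega> \<in> {cs. E cs}} = a"
  proof -
    have "{cs. E cs} \<inter> ?S = {cs \<in> ?S. E cs \<and> True}" by auto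
    then show ?thesis
      unfolding prS a_def Tt
      using card_stair_lists_leading_indep[OF p t(2), of e "\<lambda>_ _. True" 1] 
        card_lists_length_eq[OF finite_residue_group[of "CARD('p) ^ Suc e" n], of t]
      unfolding E_def V_def by (simp add: conj_commute)
  qed
  have prER: "prob {\<omega> \<in> space M. ?C \<omega> \<in> {cs. E cs \<and> R cs}} = a * stair_density CARD('p) G t"
  proof -
    have un: "set (take (n - t) cs) \<union> set (drop (n - t) cs) = set cs" for cs :: "(nat \<Rightarrow> int) list"
      by (metis append_take_drop_id set_append)
    have "{cs. E cs \<and> R cs} \<inter> ?S =
        {cs \<in> ?S. E cs \<and> V Mod generate V (set (take (n - t) cs) \<union> set (drop (n - t) cs)) \<cong> G}"
      unfolding R_def un by auto
    then show ?thesis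
      unfolding prS a_def Tt stair_density_def E_def V_def
      using card_stair_lists_leading_indep[OF p t(2), of e "\<lambda>c d. V Mod generate V (set c \<union> set d) \<cong> G"
          "stair_density CARD('p) G t"]
        card_residue_completions[OF p t(2) G']
      unfolding V_def stair_density_def by (simp del: power_Suc)
  qed
  have ev: "{\<omega> \<in> space M. ?C \<omega> \<in> S} \<in> events" for S
    by (rule unif(2))
  have eq: "{\<omega> \<in> space M. cok (X \<omega>) \<cong> G} = {\<omega> \<in> space M. ?C \<omega> \<in> {cs. R cs}}"
    using cok by auto
  show "a * stair_density CARD('p) G (T n) \<le> \<P>(\<omega> in M. cok (X \<omega>) \<cong> G)"
    unfolding eq Tt prER[symmetric] by (intro finite_measure_mono ev) auto
  have "\<P>(\<omega> in M. cok (X \<omega>) \<cong> G) \<le>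
      prob ({\<omega> \<in> space M. ?C \<omega> \<in> {cs. E cs \<and> R cs}} \<union> {\<omega> \<in> space M. ?C \<omega> \<in> - {cs. E cs}})"
    unfolding eq by (intro finite_measure_mono sets.Un ev) auto
  also have "\<dots> \<le> prob {\<omega> \<in> space M. ?C \<omega> \<in> {cs. E cs \<and> R cs}} + prob {\<omega> \<in> space M. ?C \<omega> \<in> - {cs. E cs}}"
    by (intro measure_Un_le ev)
  also have "{\<omega> \<in> space M. ?C \<omega> \<in> - {cs. E cs}} = space M - {\<omega> \<in> space M. ?C \<omega> \<in> {cs. E cs}}"
    by auto
  also have "prob \<dots> = 1 - a"
    using prob_compl[OF ev[of "{cs. E cs}"]] prE by simp
  finally show "\<P>(\<omega> in M. cok (X \<omega>) \<cong> G) \<le> a * stair_density CARD('p) G (T n) + (1 - a)"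
    unfolding prER Tt .
  show "\<P>(\<omega> in M. cok (X \<omega>) \<cong> G) = a * stair_density CARD('p) G (T n)" if triv: "carrier G = {\<one>\<^bsub>G\<^esub>}"
  proof -
    have "E cs" if cs: "cs \<in> ?S" "R cs" for cs
    proof -
      have "set cs \<subseteq> carrier V"
        using cs(1) subgroup.subset[OF subgroup_coord_subgroup[of "CARD('p) ^ Suc e" n]]
        unfolding stair_lists_def V_def set_conv_nth by auto
      then have "generate V (set cs) = carrier V"
        using trivial_Mod_iso_iff[OF V.comm_group_axioms V.generate_is_subgroup G.is_group triv] cs(2)
        by (simp add: R_def)
      then show ?thesis
        using stair_lists_leading_indep_of_generating[OF p t(2) cs(1)] unfolding E_def V_def by blast
    qed
    then have "{\<omega> \<in> space M. cok (X \<omega>) \<cong> G} = {\<omega> \<in> space M. ?C \<omega> \<in> {cs. E cs \<and> R cs}}"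
      using eq unif(1) by blast
    then show ?thesis
      using prER Tt by simp
  qed
qed

lemma stair_density_trivial:
  assumes G: "group G" "carrier G = {\<one>\<^bsub>G\<^esub>}"
  shows "stair_density p G t = euler_prod p t" and "card (auto G) = 1"
proof -
  interpret group G by fact
  have "auto G = {\<lambda>x\<in>carrier G. x}"
  proof
    show "auto G \<subseteq> {\<lambda>x\<in>carrier G. x}"
    proof
      fix f assume "f \<in> auto G"
      then have "f \<in> extensional (carrier G)" "f ` carrier G = carrier G"
        by (auto simp: auto_def Bij_def bij_betw_def)
      then have "f = (\<lambda>x\<in>carrier G. x)"
        using G(2) by (intro extensionalityI[of _ "carrier G"]) auto
      then show "f \<in> {\<lambda>x\<in>carrier G. x}" by simp
    qed
  qed (use id_in_auto in simp)
  then show aut: "card (auto G) = 1"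
    by simp
  have "{gs. length gs = t \<and> set gs \<subseteq> carrier G \<and> generate G (set gs) = carrier G} = {replicate t \<one>\<^bsub>G\<^esub>}"
  proof -
    have "generate G (set gs) = carrier G" if "set gs \<subseteq> carrier G" for gs
      using generate_incl[OF that] generate.one[of G "set gs"] G(2) by auto
    moreover have "length gs = t \<and> set gs \<subseteq> carrier G \<longleftrightarrow> gs = replicate t \<one>\<^bsub>G\<^esub>" for gs
    proof
      assume gs: "length gs = t \<and> set gs \<subseteq> carrier G"
      then have "y = \<one>\<^bsub>G\<^esub>" if "y \<in> set gs" for y
        using G(2) that by blast
      then show "gs = replicate t \<one>\<^bsub>G\<^esub>"
        using gs by (intro replicate_eqI) auto
    next
      assume "gs = replicate t \<one>\<^bsub>G\<^esub>"
      then show "length gs = t \<and> set gs \<subseteq> carrier G"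
        by (auto split: if_splits)
    qed
    ultimately show ?thesis by blast
  qed
  then show "stair_density p G t = euler_prod p t"
    using G(2) unfolding stair_density_def aut by simp
qed

lemma stair_density_LIMSEQ:
  assumes p: "p > 1" and G: "group G" "finite (carrier G)"
  shows "stair_density p G \<longlonglongrightarrow> CL p G"
proof -
  have "stair_density p G \<longlonglongrightarrow> 1 / real (card (auto G)) * 1 * (\<Prod>i. 1 - 1 / real p ^ Suc i)"
    unfolding stair_density_def
    by (intro tendsto_mult tendsto_const card_generating_lists_LIMSEQ[OF G] euler_prod_LIMSEQ(1)[OF p])
  then show ?thesis
    by (simp add: CL_def)
qed

theorem corollary2p4:
  fixes t :: "nat \<Rightarrow> nat"
    and M :: "nat \<Rightarrow> 'w measure"
    and X :: "nat \<Rightarrow> 'w \<Rightarrow> 'p :: prime_card padic_int mat"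
  assumes "\<And>n. n \<ge> 1 \<Longrightarrow> 1 \<le> t n \<and> t n \<le> n"
    and "\<And>n. n \<ge> 1 \<Longrightarrow> prob_space (M n)"
    and "\<And>n. n \<ge> 1 \<Longrightarrow> haar_random_matrix_on (M n) n (stair_support t n) (X n)"
  shows
    "((\<lambda>n. \<P>(\<omega> in M n. Determinant.det (map_mat padic_reduce (X n \<omega>)) \<noteq> 0))
        \<longlonglongrightarrow> (\<Prod>i. 1 - 1 / real CARD('p) ^ Suc i)
      \<longleftrightarrow> filterlim (\<lambda>n. real (t n) - log (real CARD('p)) (real n)) at_top sequentially) \<and>
     (filterlim (\<lambda>n. real (t n) - log (real CARD('p)) (real n)) at_top sequentially
      \<longleftrightarrow> converges_to_CL CARD('p) M (\<lambda>n \<omega>. cok (X n \<omega>)))"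
proof -
  define det_prob where "det_prob n = \<P>(\<omega> in M n. Determinant.det (map_mat padic_reduce (X n \<omega>)) \<noteq> 0)" for n
  define a where "a n = (1 - 1 / real CARD('p) ^ t n) ^ (n - t n)" for n
  define C where "C = (\<Prod>i. 1 - 1 / real CARD('p) ^ Suc i)"
  have p1: "CARD('p) > 1"
    using prime_gt_1_nat[OF prime_card[where 'a = 'p]] .
  define G\<^sub>0 :: "nat monoid" where "G\<^sub>0 = singleton_group 0"
  have G0: "group G\<^sub>0" "carrier G\<^sub>0 = {\<one>\<^bsub>G\<^sub>0\<^esub>}" "finite_abelian_p_group CARD('p) G\<^sub>0"
  proof -
    show "group G\<^sub>0" "carrier G\<^sub>0 = {\<one>\<^bsub>G\<^sub>0\<^esub>}"
      using trivial_singleton_group[of "0 :: nat"] by (simp_all add: G\<^sub>0_def trivial_group_def)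
    have "comm_group G\<^sub>0"
      unfolding G\<^sub>0_def
      by (rule group.group_comm_groupI[OF singleton_group]) (simp add: singleton_group_def)
    then show "finite_abelian_p_group CARD('p) G\<^sub>0"
      by (auto simp: finite_abelian_p_group_def G\<^sub>0_def order_def intro!: exI[of _ 0])
  qed
  have det_cok: "det_prob n = \<P>(\<omega> in M n. cok (X n \<omega>) \<cong> G\<^sub>0)" if n: "n \<ge> 1" for n
  proof -
    have "X n \<omega> \<in> carrier_mat n n" if "\<omega> \<in> space (M n)" for \<omega>
      using assms(3)[OF n] that by (auto simp: haar_random_matrix_on_def)
    then have "{\<omega> \<in> space (M n). Determinant.det (map_mat padic_reduce (X n \<omega>)) \<noteq> 0} =
        {\<omega> \<in> space (M n). cok (X n \<omega>) \<cong> G\<^sub>0}"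
      using det_reduce_nonzero_iff_cok_trivial[OF _ G0(1,2)] by blast
    then show ?thesis
      by (simp only: det_prob_def)
  qed
  have det_eq: "det_prob n = a n * euler_prod CARD('p) (t n)" if n: "n \<ge> 1" for n
    using prob_cok_iso_bounds(3)[OF assms(2)[OF n] assms(3)[OF n] _ _ G0(3,2)] assms(1)[OF n]
    unfolding det_cok[OF n] a_def stair_density_trivial(1)[OF G0(1,2)] by simp
  have thr: "filterlim (\<lambda>n. real (t n) - log (real CARD('p)) (real n)) at_top sequentially \<longleftrightarrow>
      (\<lambda>n. real n / real CARD('p) ^ t n) \<longlonglongrightarrow> 0"
    by (rule threshold_iff_ratio_tendsto_0[OF p1])
  have one_two: "(\<lambda>n. real n / real CARD('p) ^ t n) \<longlonglongrightarrow> 0" if lim: "det_prob \<longlonglongrightarrow> C"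
  proof (rule ratio_tendsto_0_of_nonsingular_limit[OF p1 assms(1)])
    show "(\<lambda>n. (1 - 1 / real CARD('p) ^ t n) ^ (n - t n) * euler_prod CARD('p) (t n)) \<longlonglongrightarrow>
        (\<Prod>i. 1 - 1 / real CARD('p) ^ Suc i)"
      using lim unfolding C_def
      by (rule Lim_transform_eventually) (use det_eq in \<open>auto simp: a_def intro!: eventually_sequentiallyI[of 1]\<close>)
  qed
  have two_three: "converges_to_CL CARD('p) M (\<lambda>n \<omega>. cok (X n \<omega>))"
    if thr: "(\<lambda>n. real n / real CARD('p) ^ t n) \<longlonglongrightarrow> 0"
    unfolding converges_to_CL_def
  proof (intro allI impI)
    fix G :: "nat monoid" assume G: "finite_abelian_p_group CARD('p) G"
    then have G': "group G" "finite (carrier G)"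
      by (auto simp: finite_abelian_p_group_def comm_group.axioms)
    have dens: "(\<lambda>n. stair_density CARD('p) G (t n)) \<longlonglongrightarrow> CL CARD('p) G"
      by (rule filterlim_compose[OF stair_density_LIMSEQ[OF p1 G'] ratio_tendsto_0_imp(1)[OF p1 thr]])
    have a: "a \<longlonglongrightarrow> 1"
      unfolding a_def by (rule ratio_tendsto_0_imp(2)[OF p1 thr])
    have ab: "(\<lambda>n. a n * stair_density CARD('p) G (t n)) \<longlonglongrightarrow> CL CARD('p) G"
      using tendsto_mult[OF a dens] by simp
    show "(\<lambda>n. \<P>(\<omega> in M n. cok (X n \<omega>) \<cong> G)) \<longlonglongrightarrow> CL CARD('p) G"
    proof (rule tendsto_sandwich[OF _ _ ab])
      show "(\<lambda>n. a n * stair_density CARD('p) G (t n) + (1 - a n)) \<longlonglongrightarrow> CL CARD('p) G"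
        using tendsto_add[OF ab tendsto_diff[OF tendsto_const a, of 1]] by simp
      show "\<forall>\<^sub>F n in sequentially. a n * stair_density CARD('p) G (t n) \<le> \<P>(\<omega> in M n. cok (X n \<omega>) \<cong> G)"
      proof (rule eventually_sequentiallyI[of 1])
        fix n :: nat assume n: "1 \<le> n"
        show "a n * stair_density CARD('p) G (t n) \<le> \<P>(\<omega> in M n. cok (X n \<omega>) \<cong> G)"
          unfolding a_def using assms(1)[OF n] by (intro prob_cok_iso_bounds(1)[OF assms(2,3)] n G) auto
      qed
      show "\<forall>\<^sub>F n in sequentially. \<P>(\<omega> in M n. cok (X n \<omega>) \<cong> G) \<le> a n * stair_density CARD('p) G (t n) + (1 - a n)"
      proof (rule eventually_sequentiallyI[of 1])
        fix n :: nat assume n: "1 \<le> n"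
        show "\<P>(\<omega> in M n. cok (X n \<omega>) \<cong> G) \<le> a n * stair_density CARD('p) G (t n) + (1 - a n)"
          unfolding a_def using assms(1)[OF n] by (intro prob_cok_iso_bounds(2)[OF assms(2,3)] n G) auto
      qed
    qed
  qed
  have three_one: "det_prob \<longlonglongrightarrow> C" if conv: "converges_to_CL CARD('p) M (\<lambda>n \<omega>. cok (X n \<omega>))"
  proof -
    have "(\<lambda>n. \<P>(\<omega> in M n. cok (X n \<omega>) \<cong> G\<^sub>0)) \<longlonglongrightarrow> CL CARD('p) G\<^sub>0"
      using conv G0(3) by (simp add: converges_to_CL_def)
    also have "CL CARD('p) G\<^sub>0 = C"
      using stair_density_trivial(2)[OF G0(1,2)] by (simp add: CL_def C_def)
    finally show ?thesis
      by (rule Lim_transform_eventually) (use det_cok in \<open>auto intro!: eventually_sequentiallyI[of 1]\<close>)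
  qed
  show ?thesis
    unfolding det_prob_def[symmetric] C_def[symmetric] thr
    using one_two two_three three_one by blast
qed

end
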